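(* Let $(\Sigma,\sigma)$ be a transitive countable Markov shift, with compactification $(\bar\Sigma,\bar\sigma)$. Then the space $\mathcal{M}(\bar\Sigma,\bar\sigma)$ of $\bar\sigma$-invariant Borel probability measures on $\bar\Sigma$, with the weak$^*$ topology, is affine homeomorphic to the Poulsen simplex, and $\mathcal{M}(\Sigma,\sigma)$ is a dense subset of $\mathcal{M}(\bar\Sigma,\bar\sigma)$.
   Context: Countable Markov shift: let $M$ be an $\mathbb{N}\times\mathbb{N}$ matrix with entries in $\{0,1\}$, $\mathbb{N}=\{1,2,\dots\}$; $\Sigma=\{(x_1,x_2,\dots)\in\mathbb{N}^{\mathbb{N}}: M(x_i,x_{i+1})=1\ \forall i\in\mathbb{N}\}$ with the topology induced by the product of discrete topologies, and $\sigma(x_1,x_2,\dots)=(x_2,x_3,\dots)$. An admissible word is a finite string $a_1\dots a_N$ in $\mathbb{N}$ with $M(a_i,a_{i+1})=1$ for $1\le i<N$. The shift is transitive if for all $a,b\in\mathbb{N}$ there is an admissible word starting with $a$ and ending with $b$ (in particular $\Sigma$ is non-compact). $\mathcal{M}(\Sigma,\sigma)$ is the set of $\sigma$-invariant Borel probability measures on $\Sigma$. Compactification: equip $\mathbb{N}\cup\{\infty\}$ with the metric $\bar\rho(a,b)=|1/a-1/b|$ (with $1/\infty=0$) and $(\mathbb{N}\cup\{\infty\})^{\mathbb{N}}$ with $\bar d_\rho(x,y)=\sum_{n\in\mathbb{N}}2^{-n}\bar\rho(x_n,y_n)$ (a compact metric space). $\bar\Sigma$ is the closure of $\Sigma$ in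 this space, and $\bar\sigma:\bar\Sigma\to\bar\Sigma$ is the left shift, the continuous extension of $\sigma$. $\mathcal{M}(\bar\Sigma,\bar\sigma)$ carries the weak$^*$ topology, and $\mathcal{M}(\Sigma,\sigma)$ is identified with $\{\mu\in\mathcal{M}(\bar\Sigma,\bar\sigma):\mu(\Sigma)=1\}$. A Poulsen simplex is a metrizable compact convex Choquet simplex with at least two points whose set of extreme points is dense; it is unique up to affine homeomorphism. *)

theory Defs
  imports "HOL-Probability.Probability" "HOL-Library.Extended_Nat"
begin

section \<open>Countable Markov shifts and their compactification\<close>

text \<open>
  The alphabet is \<open>{1, 2, ...}\<close>, represented by the positive elements of \<^typ>\<open>nat\<close>, and
  \<open>{1, 2, ..., \<infinity>}\<close> is represented by the nonzero elements of \<^typ>\<open>enat\<close>.  Only the entries of a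
  transition matrix at positive indices matter.  Coordinates of sequences are indexed from \<open>0\<close>, so
  that the coordinate called \<open>x\<^sub>n\<close> in the usual one-based notation is \<open>x (n - 1)\<close>.
\<close>

definition zero_one_matrix :: "(nat \<Rightarrow> nat \<Rightarrow> nat) \<Rightarrow> bool" where
  "zero_one_matrix M \<longleftrightarrow> (\<forall>a\<ge>1. \<forall>b\<ge>1. M a b \<in> {0, 1})"

definition cms :: "(nat \<Rightarrow> nat \<Rightarrow> nat) \<Rightarrow> (nat \<Rightarrow> nat) set" where
  "cms M = {x. \<forall>i. x i \<ge> 1 \<and> M (x i) (x (Suc i)) = 1}"

definition admissible_word :: "(nat \<Rightarrow> nat \<Rightarrow> nat) \<Rightarrow> nat list \<Rightarrow> bool" where
  "admissible_word M w \<longleftrightarrow>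
     w \<noteq> [] \<and> (\<forall>a\<in>set w. a \<ge> 1) \<and> (\<forall>i. Suc i < length w \<longrightarrow> M (w ! i) (w ! Suc i) = 1)"

definition transitive_cms :: "(nat \<Rightarrow> nat \<Rightarrow> nat) \<Rightarrow> bool" where
  "transitive_cms M \<longleftrightarrow>
     (\<forall>a\<ge>1. \<forall>b\<ge>1. \<exists>w. admissible_word M w \<and> hd w = a \<and> last w = b)"

definition recip :: "enat \<Rightarrow> real" where
  "recip a = (case a of enat n \<Rightarrow> 1 / real n | \<infinity> \<Rightarrow> 0)"

definition rho_bar :: "enat \<Rightarrow> enat \<Rightarrow> real" where
  "rho_bar a b = \<bar>recip a - recip b\<bar>"

definition ext_seqs :: "(nat \<Rightarrow> enat) set" where
  "ext_seqs = {x. \<forall>n. x n \<ge> 1}"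

text \<open>With coordinates indexed from \<open>0\<close>, the \<open>n\<close>-th coordinate has weight \<open>2\<close> to the power \<open>-(n+1)\<close>.\<close>

definition d_bar :: "(nat \<Rightarrow> enat) \<Rightarrow> (nat \<Rightarrow> enat) \<Rightarrow> real" where
  "d_bar x y = (\<Sum>n. (1/2) ^ Suc n * rho_bar (x n) (y n))"

lemma recip_bounds: "0 \<le> recip a" "recip a \<le> 1"
proof -
  show "0 \<le> recip a" by (cases a) (auto simp: recip_def)
  have "1 / real n \<le> 1" for n by (cases n) auto
  then show "recip a \<le> 1" by (cases a) (auto simp: recip_def)
qed

lemma summable_d_bar: "summable (\<lambda>n. (1/2) ^ Suc n * rho_bar (x n) (y n))"
proof (rule summable_comparison_test')
  show "summable (\<lambda>n. (1/2::real) ^ Suc n)"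
    by (simp add: summable_geometric)
  show "norm ((1/2) ^ Suc n * rho_bar (x n) (y n)) \<le> (1/2) ^ Suc n" if "n \<ge> 0" for n
  proof -
    have "rho_bar (x n) (y n) \<le> 1" "0 \<le> rho_bar (x n) (y n)"
      using recip_bounds[of "x n"] recip_bounds[of "y n"] by (auto simp: rho_bar_def)
    then show ?thesis
      by (simp add: abs_mult)
  qed
qed

lemma recip_inj: "recip a = recip b \<Longrightarrow> a \<ge> 1 \<Longrightarrow> b \<ge> 1 \<Longrightarrow> a = b"
  by (cases a; cases b) (auto simp: recip_def one_enat_def)

lemma Metric_space_d_bar: "Metric_space ext_seqs d_bar"
proof
  have nn: "0 \<le> (1/2) ^ Suc n * rho_bar a b" for n a b
    by (simp add: rho_bar_def)
  show "0 \<le> d_bar x y" for x y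
    unfolding d_bar_def by (rule suminf_nonneg[OF summable_d_bar nn])
  show "d_bar x y = d_bar y x" for x y
    by (simp add: d_bar_def rho_bar_def abs_minus_commute)
  show "d_bar x y = 0 \<longleftrightarrow> x = y" if xy: "x \<in> ext_seqs" "y \<in> ext_seqs" for x y
  proof
    assume "d_bar x y = 0"
    then have "\<forall>n. (1/2) ^ Suc n * rho_bar (x n) (y n) = 0"
      unfolding d_bar_def using suminf_eq_zero_iff[OF summable_d_bar nn] by blast
    then have "recip (x n) = recip (y n)" for n
      by (simp add: rho_bar_def)
    then show "x = y"
      using xy recip_inj by (auto simp: ext_seqs_def)
  qed (simp add: d_bar_def rho_bar_def)
  show "d_bar x z \<le> d_bar x y + d_bar y z" for x y z
    unfolding d_bar_def suminf_add[OF summable_d_bar summable_d_bar]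
  proof (rule suminf_le[OF _ summable_d_bar summable_add[OF summable_d_bar summable_d_bar]])
    fix n
    have "rho_bar (x n) (z n) \<le> rho_bar (x n) (y n) + rho_bar (y n) (z n)"
      by (simp add: rho_bar_def)
    then have "(1/2) ^ Suc n * rho_bar (x n) (z n)
        \<le> (1/2) ^ Suc n * (rho_bar (x n) (y n) + rho_bar (y n) (z n))"
      by (rule mult_left_mono) simp
    then show "(1/2) ^ Suc n * rho_bar (x n) (z n)
        \<le> (1/2) ^ Suc n * rho_bar (x n) (y n) + (1/2) ^ Suc n * rho_bar (y n) (z n)"
      by (simp only: distrib_left)
  qed
qed

definition ext_top :: "(nat \<Rightarrow> enat) topology" where
  "ext_top = Metric_space.mtopology ext_seqs d_bar"

lemma topspace_ext_top [simp]: "topspace ext_top = ext_seqs"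
  unfolding ext_top_def
  by (rule Metric_space.topspace_mtopology[OF Metric_space_d_bar])

text \<open>The copy of the shift space inside the space of sequences that may contain \<open>\<infinity>\<close>.\<close>

definition cms_ext :: "(nat \<Rightarrow> nat \<Rightarrow> nat) \<Rightarrow> (nat \<Rightarrow> enat) set" where
  "cms_ext M = (\<lambda>x n. enat (x n)) ` cms M"

definition cms_bar :: "(nat \<Rightarrow> nat \<Rightarrow> nat) \<Rightarrow> (nat \<Rightarrow> enat) set" where
  "cms_bar M = ext_top closure_of cms_ext M"

definition cms_bar_top :: "(nat \<Rightarrow> nat \<Rightarrow> nat) \<Rightarrow> (nat \<Rightarrow> enat) topology" where
  "cms_bar_top M = subtopology ext_top (cms_bar M)"

lemma cms_ext_subset: "cms_ext M \<subseteq> ext_seqs"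
  by (auto simp: cms_ext_def cms_def ext_seqs_def one_enat_def)

lemma topspace_cms_bar_top [simp]: "topspace (cms_bar_top M) = cms_bar M"
  using closure_of_subset_topspace[of ext_top "cms_ext M"]
  by (auto simp: cms_bar_top_def cms_bar_def)

definition shift :: "(nat \<Rightarrow> 'a) \<Rightarrow> (nat \<Rightarrow> 'a)" where
  "shift x = (\<lambda>n. x (Suc n))"


section \<open>Spaces of invariant measures\<close>

definition borel_prob :: "'a topology \<Rightarrow> 'a measure set" where
  "borel_prob X =
     {\<mu>. prob_space \<mu> \<and> space \<mu> = topspace X \<and> sets \<mu> = sigma_sets (topspace X) {U. openin X U}}"

definition invariant_measures :: "'a topology \<Rightarrow> ('a \<Rightarrow> 'a) \<Rightarrow> 'a measure set" where
  "invariant_measures X T =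
     {\<mu> \<in> borel_prob X. \<forall>A\<in>sets \<mu>. emeasure \<mu> (T -` A \<inter> space \<mu>) = emeasure \<mu> A}"

text \<open>
  The topology on a set \<open>\<M>\<close> of Borel probability measures on a compact space \<open>X\<close> generated by the
  maps sending \<open>\<mu>\<close> to the integral of \<open>f\<close> against \<open>\<mu>\<close>, for \<open>f\<close> continuous on \<open>X\<close>.
\<close>

definition weak_star :: "'a topology \<Rightarrow> 'a measure set \<Rightarrow> 'a measure topology" where
  "weak_star X \<M> = topology_generated_by
     {{\<mu> \<in> \<M>. (\<integral>x. f x \<partial>\<mu>) \<in> U} | f U. continuous_map X euclideanreal f \<and> open U}"

lemma topspace_weak_star [simp]: "topspace (weak_star X \<M>) = \<M>"
proof -
  have "\<M> \<in> {{\<mu> \<in> \<M>. (\<integral>x. f x \<partial>\<mu>) \<in> U} | f U. continuous_map X euclideanreal f \<and> open U}"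
    by (rule CollectI, rule exI[of _ "\<lambda>_. 0"], rule exI[of _ UNIV]) auto
  then show ?thesis
    unfolding weak_star_def topology_generated_by_topspace by blast
qed

definition inv_bar :: "(nat \<Rightarrow> nat \<Rightarrow> nat) \<Rightarrow> (nat \<Rightarrow> enat) measure set" where
  "inv_bar M = invariant_measures (cms_bar_top M) shift"

definition inv_bar_top :: "(nat \<Rightarrow> nat \<Rightarrow> nat) \<Rightarrow> (nat \<Rightarrow> enat) measure topology" where
  "inv_bar_top M = weak_star (cms_bar_top M) (inv_bar M)"

text \<open>
  Invariant probability measures of the (noncompact) Markov shift, identified with the invariant
  measures on the compactification that give full mass to the Markov shift.
\<close>

definition inv_cms :: "(nat \<Rightarrow> nat \<Rightarrow> nat) \<Rightarrow> (nat \<Rightarrow> enat) measure set" where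
  "inv_cms M = {\<mu> \<in> inv_bar M. emeasure \<mu> (cms_ext M) = 1}"

definition mix_measure :: "real \<Rightarrow> 'a measure \<Rightarrow> 'a measure \<Rightarrow> 'a measure" where
  "mix_measure t \<mu> \<nu> = measure_of (space \<mu>) (sets \<mu>)
     (\<lambda>A. ennreal (1 - t) * emeasure \<mu> A + ennreal t * emeasure \<nu> A)"

lemma emeasure_mix_measure:
  assumes "sets \<nu> = sets \<mu>" "A \<in> sets \<mu>"
  shows "emeasure (mix_measure t \<mu> \<nu>) A =
           ennreal (1 - t) * emeasure \<mu> A + ennreal t * emeasure \<nu> A"
  unfolding mix_measure_def
proof (rule emeasure_measure_of_sigma)
  show "sigma_algebra (space \<mu>) (sets \<mu>)" by (rule sets.sigma_algebra_axioms)
  show "positive (sets \<mu>) (\<lambda>A. ennreal (1 - t) * emeasure \<mu> A + ennreal t * emeasure \<nu> A)"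
    by (simp add: positive_def)
  show "countably_additive (sets \<mu>)
          (\<lambda>A. ennreal (1 - t) * emeasure \<mu> A + ennreal t * emeasure \<nu> A)"
  proof (rule countably_additiveI)
    fix F :: "nat \<Rightarrow> _" assume F: "range F \<subseteq> sets \<mu>" "disjoint_family F"
    then have "range F \<subseteq> sets \<nu>" using assms by simp
    with F show "(\<Sum>i. ennreal (1 - t) * emeasure \<mu> (F i) + ennreal t * emeasure \<nu> (F i)) =
        ennreal (1 - t) * emeasure \<mu> (\<Union> (range F)) + ennreal t * emeasure \<nu> (\<Union> (range F))"
      by (simp add: suminf_emeasure flip: suminf_add)
  qed
qed (fact assms(2))


section \<open>The Poulsen simplex\<close>

definition locally_convex_tvs :: "'v::real_vector topology \<Rightarrow> bool" where
  "locally_convex_tvs T \<longleftrightarrow>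
     topspace T = UNIV \<and> Hausdorff_space T \<and>
     continuous_map (prod_topology T T) T (\<lambda>(x, y). x + y) \<and>
     continuous_map (prod_topology euclideanreal T) T (\<lambda>(c, x). c *\<^sub>R x) \<and>
     (\<forall>U. openin T U \<and> 0 \<in> U \<longrightarrow> (\<exists>V. openin T V \<and> 0 \<in> V \<and> convex V \<and> V \<subseteq> U))"

text \<open>
  Choquet's definition of a simplex: put the convex set \<open>K\<close> at height one in the product with the
  real line.  Then \<open>K\<close> is a simplex iff the linear space \<open>C - C\<close> spanned by the cone \<open>C\<close> over \<open>K\<close> is a
  lattice for the order in which \<open>C\<close> is the set of nonnegative elements.
\<close>

definition cone_over :: "'v::real_vector set \<Rightarrow> ('v \<times> real) set" where
  "cone_over K = {(t *\<^sub>R x, t) | t x. t \<ge> 0 \<and> x \<in> K}"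

definition cone_le :: "'w::real_vector set \<Rightarrow> 'w \<Rightarrow> 'w \<Rightarrow> bool" where
  "cone_le C a b \<longleftrightarrow> b - a \<in> C"

definition cone_lattice :: "'w::real_vector set \<Rightarrow> bool" where
  "cone_lattice C \<longleftrightarrow>
     (let E = {p - q | p q. p \<in> C \<and> q \<in> C} in
      \<forall>a\<in>E. \<forall>b\<in>E.
        (\<exists>s\<in>E. cone_le C a s \<and> cone_le C b s \<and>
           (\<forall>u\<in>E. cone_le C a u \<and> cone_le C b u \<longrightarrow> cone_le C s u)) \<and>
        (\<exists>i\<in>E. cone_le C i a \<and> cone_le C i b \<and>
           (\<forall>l\<in>E. cone_le C l a \<and> cone_le C l b \<longrightarrow> cone_le C l i)))"

definition choquet_simplex :: "'v::real_vector topology \<Rightarrow> 'v set \<Rightarrow> bool" where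
  "choquet_simplex T K \<longleftrightarrow>
     locally_convex_tvs T \<and> compactin T K \<and> convex K \<and> cone_lattice (cone_over K)"

definition poulsen_simplex :: "'v::real_vector topology \<Rightarrow> 'v set \<Rightarrow> bool" where
  "poulsen_simplex T K \<longleftrightarrow>
     choquet_simplex T K \<and> metrizable_space (subtopology T K) \<and>
     (\<exists>x\<in>K. \<exists>y\<in>K. x \<noteq> y) \<and>
     subtopology T K closure_of {x. x extreme_point_of K} = K"

text \<open>
  An affine homeomorphism from a space \<open>\<M>\<close> of probability measures with topology \<open>W\<close> onto a convex
  set \<open>K\<close> in a topological vector space.
\<close>

definition affine_homeomorphism ::
  "'a measure topology \<Rightarrow> 'v::real_vector topology \<Rightarrow> 'v set \<Rightarrow> ('a measure \<Rightarrow> 'v) \<Rightarrow> bool" where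
  "affine_homeomorphism W T K h \<longleftrightarrow>
     homeomorphic_map W (subtopology T K) h \<and>
     (\<forall>\<mu>\<in>topspace W. \<forall>\<nu>\<in>topspace W. \<forall>t\<in>{0..1}.
        h (mix_measure t \<mu> \<nu>) = (1 - t) *\<^sub>R h \<mu> + t *\<^sub>R h \<nu>)"

text \<open>
  A Poulsen simplex is unique up to affine homeomorphism, so being affinely homeomorphic to ``the''
  Poulsen simplex means being affinely homeomorphic to some Poulsen simplex.  Every metrizable
  compact convex subset of a locally convex space is affinely homeomorphic to a compact convex
  subset of the space of bounded real sequences (type \<^typ>\<open>nat \<Rightarrow>\<^sub>C real\<close>), so it suffices
  to look for the simplex there.
\<close>

definition affinely_homeomorphic_to_Poulsen :: "'a measure topology \<Rightarrow> bool" where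
  "affinely_homeomorphic_to_Poulsen W \<longleftrightarrow>
     (\<exists>(T :: (nat \<Rightarrow>\<^sub>C real) topology) K h. poulsen_simplex T K \<and> affine_homeomorphism W T K h)"

end

theory Submission
  imports Defs
begin

text \<open>
  \<^bold>\<open>Density of periodic orbits.\<close>  Fix a level \<open>m\<close>, identify all symbols \<open>\<ge> m\<close> (and \<open>\<infinity>\<close>) with
  \<open>m\<close>, and look at windows of length \<open>m\<close>.  Let \<open>loop_freqs M m\<close> be the set of limits of the window
  frequencies of closed walks (loops) in the graph of \<open>M\<close>.  Long concatenations of powers of two
  loops, joined by two fixed walks, show that this set is convex.  Every orbit segment of a point of
  the shift is, up to a bounded error that does not depend on its length, a nonnegative combination
  of loop frequencies (\<open>cnt_near_cone\<close>): cut it between the first and the last visit to a symbol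
  \<open>a < m\<close>; this middle part is a loop, and in the two outer parts one symbol fewer is available.  What
  remains at the end are segments with all symbols \<open>\<ge> m\<close>.  If their lengths are bounded, they belong
  to the error.  Otherwise close a long segment of this kind by a walk that visits no vertex twice.
  However long this walk is, it meets the symbols below \<open>m\<close> at most \<open>m\<close> times, so the frequency
  vector of the fixed point \<open>\<infinity>\<infinity>\<infinity>\<dots>\<close> is a
  limit of loop frequencies as well (\<open>infinity_freq\<close>).  Averaging over orbit segments of length \<open>n\<close>,
  with \<open>n\<close> tending to infinity, puts the window distribution of every invariant measure of the
  compactification into \<open>loop_freqs M m\<close> (\<open>invariant_loop_freqs\<close>).  No ergodic decomposition is
  needed.

  \<^bold>\<open>The simplex.\<close>  The sets of points with a given collapsed prefix (the cells) form a countable base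
  of clopen sets.  A measure is sent to its weighted sequence of cell values, an affine injective map
  \<open>emb\<close> into the bounded sequences.  It is a homeomorphism onto its image because continuous functions
  are uniform limits of finite combinations of indicators of cells, and its image is compact because
  limits of cell values extend to a measure: on a compact space every finitely additive function on
  the clopen sets is continuous at the empty set, so that Caratheodory's theorem applies
  (\<open>limit_measure\<close>).  Two finite invariant measures \<open>p\<close>, \<open>q\<close> have an invariant supremum, since a Hahn
  set of \<open>p - q\<close> is shift-invariant up to a null set (\<open>inv_fun_sup\<close>); this gives the lattice order on
  the cone.  Measures on periodic orbits are extreme points, because a periodic orbit carries only one
  invariant probability measure, and they give full mass to the Markov shift.  Their density therefore
  yields both the Poulsen property and the density of the invariant measures of the shift.
\<close>

section \<open>Walks and loops\<close>

text \<open>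
  \<open>walk M a u b\<close>: the list \<open>u\<close> followed by \<open>b\<close> is an admissible word that starts in \<open>a\<close>.  The end
  point is not part of the list, so that concatenation of lists is composition of walks and the
  empty list is the trivial walk at a vertex.
\<close>

fun walk :: "(nat \<Rightarrow> nat \<Rightarrow> nat) \<Rightarrow> nat \<Rightarrow> nat list \<Rightarrow> nat \<Rightarrow> bool" where
  "walk M a [] b \<longleftrightarrow> a = b \<and> 1 \<le> b"
| "walk M a (c # u) b \<longleftrightarrow> c = a \<and> 1 \<le> a \<and> (\<exists>d. M a d = 1 \<and> walk M d u b)"

lemma walk_pos: "walk M a u b \<Longrightarrow> 1 \<le> a \<and> 1 \<le> b \<and> (\<forall>c\<in>set u. 1 \<le> c)"
  by (induction u arbitrary: a) auto

lemma walk_append: "walk M a (u @ v) c \<longleftrightarrow> (\<exists>b. walk M a u b \<and> walk M b v c)"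
  by (induction u arbitrary: a) (auto dest: walk_pos)

lemma walk_start: "walk M a u b \<Longrightarrow> a = (u @ [b]) ! 0"
  by (cases u) auto

lemma walk_nth:
  assumes "walk M a u b" "i < length u"
  shows "M (u ! i) ((u @ [b]) ! Suc i) = 1"
  using assms
proof (induction u arbitrary: a i)
  case (Cons c u)
  then obtain d where d: "c = a" "M a d = 1" "walk M d u b" by auto
  show ?case
  proof (cases i)
    case 0
    then show ?thesis using d walk_start[OF d(3)] by simp
  next
    case (Suc j)
    then show ?thesis using Cons.IH[OF d(3), of j] Cons.prems by simp
  qed
qed simp

lemma walk_of_admissible:
  assumes "admissible_word M w"
  shows "walk M (hd w) (butlast w) (last w)"
  using assms
proof (induction w)
  case (Cons a w)
  show ?case
  proof (cases "w = []")
    case True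
    then show ?thesis using Cons.prems by (auto simp: admissible_word_def)
  next
    case False
    have adm: "admissible_word M w"
      unfolding admissible_word_def
    proof (intro conjI ballI allI impI)
      fix i assume "Suc i < length w"
      then show "M (w ! i) (w ! Suc i) = 1"
        using Cons.prems unfolding admissible_word_def
        by (metis Suc_less_eq length_Cons nth_Cons_Suc)
    qed (use False Cons.prems in \<open>auto simp: admissible_word_def\<close>)
    have "M ((a # w) ! 0) ((a # w) ! Suc 0) = 1"
      using Cons.prems False unfolding admissible_word_def by (metis Suc_less_eq length_Cons length_greater_0_conv)
    then have "M a (hd w) = 1" using False by (simp add: hd_conv_nth)
    then show ?thesis using Cons.IH[OF adm] False Cons.prems by (auto simp: admissible_word_def)
  qed
qed (simp add: admissible_word_def)

lemma walk_of_cms: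
  assumes "x \<in> cms M" "i \<le> j"
  shows "walk M (x i) (map x [i..<j]) (x j)"
  using assms(2)
proof (induction j rule: dec_induct)
  case base
  then show ?case using assms(1) by (auto simp: cms_def)
next
  case (step j)
  have "walk M (x j) [x j] (x (Suc j))" using assms(1) by (auto simp: cms_def)
  then show ?case using step by (auto simp: walk_append)
qed

lemma walk_shorten:
  assumes "walk M a u b"
  shows "\<exists>v. walk M a v b \<and> distinct v"
  using assms
proof (induction "length u" arbitrary: u rule: less_induct)
  case less
  show ?case
  proof (cases "distinct u")
    case False
    then obtain xs ys zs y where u: "u = xs @ [y] @ ys @ [y] @ zs"
      using not_distinct_decomp by blast
    have w: "walk M a (xs @ ([y] @ ys) @ [y] @ zs) b" using less.prems u by simp
    obtain c d where "walk M a xs c" "walk M c ([y] @ ys) d" "walk M d ([y] @ zs) b"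
      using w unfolding walk_append by blast
    moreover from this have "c = d" by auto
    ultimately have "walk M a (xs @ [y] @ zs) b" by (auto simp: walk_append)
    then show ?thesis using less.hyps[of "xs @ [y] @ zs"] u by simp
  qed (use less.prems in blast)
qed

text \<open>
  A loop is the nonempty list of vertices met by a closed walk, based at its head.
\<close>

definition loop :: "(nat \<Rightarrow> nat \<Rightarrow> nat) \<Rightarrow> nat list \<Rightarrow> bool" where
  "loop M u \<longleftrightarrow> u \<noteq> [] \<and> walk M (hd u) u (hd u)"

text \<open>
  The periodic sequence obtained by repeating a list; meaningful for nonempty lists.
\<close>

definition per :: "'a list \<Rightarrow> nat \<Rightarrow> 'a" where
  "per u i = u ! (i mod length u)"

lemma walk_imp_loop: "walk M a u a \<Longrightarrow> u \<noteq> [] \<Longrightarrow> loop M u"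
  by (cases u) (auto simp: loop_def)

lemma per_in_cms:
  assumes "loop M u"
  shows "per u \<in> cms M"
proof -
  have w: "walk M (hd u) u (hd u)" and ne: "u \<noteq> []" using assms by (auto simp: loop_def)
  have "1 \<le> per u i \<and> M (per u i) (per u (Suc i)) = 1" for i
  proof
    have l: "i mod length u < length u" using ne by simp
    then show "1 \<le> per u i" using walk_pos[OF w] by (auto simp: per_def)
    have "(u @ [hd u]) ! Suc (i mod length u) = per u (Suc i)"
    proof (cases "Suc (i mod length u) = length u")
      case True
      then show ?thesis using ne by (simp add: per_def mod_Suc hd_conv_nth)
    next
      case False
      then have "Suc (i mod length u) < length u" using l by simp
      then show ?thesis using False by (simp add: per_def mod_Suc nth_append)
    qed
    then show "M (per u i) (per u (Suc i)) = 1"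
      using walk_nth[OF w l] by (simp add: per_def)
  qed
  then show ?thesis by (auto simp: cms_def)
qed

lemma per_add_length: "per u (i + length u) = per u i"
  by (simp add: per_def)

lemma nth_concat_replicate:
  "i < k * length u \<Longrightarrow> concat (replicate k u) ! i = u ! (i mod length u)"
proof (induction k arbitrary: i)
  case (Suc k)
  show ?case
  proof (cases "i < length u")
    case False
    then have "i - length u < k * length u" using Suc.prems by auto
    then show ?thesis using Suc.IH[of "i - length u"] False
      by (simp add: nth_append le_mod_geq)
  qed (simp add: nth_append)
qed simp

lemma length_concat_replicate: "length (concat (replicate k u)) = k * length u"
  by (induction k) auto

lemma per_concat_replicate:
  assumes "u \<noteq> []" "k > 0"
  shows "per (concat (replicate k u)) = per u"
proof
  fix i
  have "i mod (k * length u) < k * length u" using assms by simp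
  then show "per (concat (replicate k u)) i = per u i"
    by (simp add: per_def length_concat_replicate nth_concat_replicate mod_mod_cancel)
qed

lemma walk_concat_replicate: "walk M a u a \<Longrightarrow> walk M a (concat (replicate k u)) a"
  by (induction k) (auto simp: walk_append dest: walk_pos)


section \<open>Counting windows\<close>

text \<open>
  The window of length \<open>m\<close> of \<open>x\<close> at position \<open>k\<close>, with all symbols \<open>\<ge> m\<close> replaced by \<open>m\<close>.
\<close>

definition win :: "nat \<Rightarrow> (nat \<Rightarrow> nat) \<Rightarrow> nat \<Rightarrow> nat list" where
  "win m x k = map (\<lambda>i. min m (x (k + i))) [0..<m]"

text \<open>
  The number of positions in \<open>{i..<j}\<close> at which the window is \<open>w\<close>.  A window may extend beyond \<open>j\<close>.
\<close>

definition cnt :: "nat \<Rightarrow> (nat \<Rightarrow> nat) \<Rightarrow> nat \<Rightarrow> nat \<Rightarrow> nat list \<Rightarrow> real" where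
  "cnt m x i j w = (\<Sum>k\<in>{i..<j}. of_bool (win m x k = w))"

text \<open>
  The number of occurrences of \<open>w\<close> along one period of a loop.
\<close>

definition lcount :: "nat \<Rightarrow> nat list \<Rightarrow> nat list \<Rightarrow> real" where
  "lcount m u w = cnt m (per u) 0 (length u) w"

lemma cnt_split: "i \<le> j \<Longrightarrow> j \<le> l \<Longrightarrow> cnt m x i l w = cnt m x i j w + cnt m x j l w"
  unfolding cnt_def by (simp only: sum.atLeastLessThan_concat)

lemma cnt_nonneg: "0 \<le> cnt m x i j w"
  unfolding cnt_def by (intro sum_nonneg) auto

lemma cnt_le: "cnt m x i j w \<le> real (j - i)"
proof -
  have "cnt m x i j w \<le> (\<Sum>k\<in>{i..<j}. 1)" unfolding cnt_def by (intro sum_mono) auto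
  then show ?thesis by simp
qed

lemma lcount_bounds: "0 \<le> lcount m u w" "lcount m u w \<le> real (length u)"
  using cnt_nonneg cnt_le[of m "per u" 0 "length u"] by (auto simp: lcount_def)

lemma sum_of_bool_diff_le:
  assumes "finite A" "B \<subseteq> A" "\<And>k. k \<in> A - B \<Longrightarrow> P k \<longleftrightarrow> Q k"
  shows "\<bar>(\<Sum>k\<in>A. of_bool (P k) :: real) - (\<Sum>k\<in>A. of_bool (Q k))\<bar> \<le> real (card B)"
proof -
  have "\<bar>(\<Sum>k\<in>A. of_bool (P k) :: real) - (\<Sum>k\<in>A. of_bool (Q k))\<bar>
      = \<bar>\<Sum>k\<in>A. of_bool (P k) - (of_bool (Q k) :: real)\<bar>"
    by (simp add: sum_subtractf)
  also have "\<dots> \<le> (\<Sum>k\<in>A. \<bar>of_bool (P k) - (of_bool (Q k) :: real)\<bar>)" by (rule sum_abs)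
  also have "\<dots> \<le> (\<Sum>k\<in>A. of_bool (k \<in> B))"
    by (intro sum_mono) (use assms(3) in auto)
  also have "\<dots> = real (card B)"
  proof -
    have "A \<inter> {k. k \<in> B} = B" using assms(2) by auto
    then show ?thesis using assms(1) by simp
  qed
  finally show ?thesis .
qed

lemma cnt_shift: "cnt m x i (i + n) w = (\<Sum>k<n. of_bool (win m x (i + k) = w))"
  unfolding cnt_def
  by (rule sum.reindex_bij_witness[of _ "\<lambda>k. i + k" "\<lambda>k. k - i"]) auto

lemma card_tail_le: "card {k. k < n \<and> n < k + m} \<le> m"
proof -
  have "{k. k < n \<and> n < k + m} \<subseteq> {n - m..<n}" by auto
  then have "card {k. k < n \<and> n < k + m} \<le> card {n - m..<n}" by (intro card_mono) auto
  then show ?thesis by simp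
qed

lemma cnt_agree:
  assumes "\<And>k. k < n \<Longrightarrow> x (i + k) = y (j + k)"
  shows "\<bar>cnt m x i (i + n) w - cnt m y j (j + n) w\<bar> \<le> real m"
proof -
  have "\<bar>cnt m x i (i + n) w - cnt m y j (j + n) w\<bar> \<le> real (card {k. k < n \<and> n < k + m})"
    unfolding cnt_shift
  proof (rule sum_of_bool_diff_le)
    fix k assume "k \<in> {..<n} - {k. k < n \<and> n < k + m}"
    then have "win m x (i + k) = win m y (j + k)"
      using assms by (auto simp: win_def add.assoc)
    then show "win m x (i + k) = w \<longleftrightarrow> win m y (j + k) = w" by simp
  qed auto
  then show ?thesis using card_tail_le[of n m] by linarith
qed

lemma lcount_append:
  "\<bar>lcount m (u @ v) w - (lcount m u w + lcount m v w)\<bar> \<le> 2 * real m"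
proof -
  have "lcount m (u @ v) w
      = cnt m (per (u @ v)) 0 (length u) w
        + cnt m (per (u @ v)) (length u) (length u + length v) w"
    using cnt_split[of 0 "length u" "length u + length v" m "per (u @ v)" w]
    by (simp add: lcount_def)
  moreover have "\<bar>cnt m (per (u @ v)) 0 (0 + length u) w - cnt m (per u) 0 (0 + length u) w\<bar> \<le> real m"
    by (rule cnt_agree) (simp add: per_def nth_append)
  moreover have "\<bar>cnt m (per (u @ v)) (length u) (length u + length v) w
      - cnt m (per v) 0 (0 + length v) w\<bar> \<le> real m"
    by (rule cnt_agree) (simp add: per_def nth_append)
  ultimately show ?thesis unfolding lcount_def by simp
qed

lemma lcount_power:
  assumes "u \<noteq> []"
  shows "lcount m (concat (replicate k u)) w = real k * lcount m u w"
proof (cases "k = 0")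
  case False
  have "cnt m (per u) 0 (k * length u) w = real k * lcount m u w" for k
  proof (induction k)
    case 0
    then show ?case by (simp add: cnt_def)
  next
    case (Suc k)
    have pw: "per u (k * length u + l) = per u l" for l
      by (simp add: per_def)
    have "cnt m (per u) (k * length u) (k * length u + length u) w
        = cnt m (per u) 0 (0 + length u) w"
      unfolding cnt_shift by (simp add: win_def add.assoc pw)
    then show ?case
      using Suc cnt_split[of 0 "k * length u" "k * length u + length u" m "per u" w]
      by (simp add: lcount_def algebra_simps)
  qed
  then show ?thesis using assms False
    by (simp add: lcount_def per_concat_replicate length_concat_replicate)
qed (simp add: lcount_def cnt_def)

lemma lcount_interval:
  assumes "i \<le> j"
  shows "\<bar>lcount m (map x [i..<j]) w - cnt m x i j w\<bar> \<le> real m"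
proof -
  have "\<bar>cnt m (per (map x [i..<j])) 0 (0 + (j - i)) w - cnt m x i (i + (j - i)) w\<bar> \<le> real m"
    by (rule cnt_agree) (simp add: per_def)
  then show ?thesis using assms by (simp add: lcount_def)
qed


section \<open>Vectors of loop frequencies\<close>

text \<open>
  The closure of the set of window frequency vectors of loops, in the uniform distance.
\<close>

definition loop_freqs :: "(nat \<Rightarrow> nat \<Rightarrow> nat) \<Rightarrow> nat \<Rightarrow> (nat list \<Rightarrow> real) set" where
  "loop_freqs M m = {g. \<forall>\<epsilon>>0. \<exists>u. loop M u \<and> (\<forall>w. \<bar>lcount m u w / length u - g w\<bar> < \<epsilon>)}"

lemma loop_freq_mem:
  assumes "loop M u"
  shows "(\<lambda>w. lcount m u w / length u) \<in> loop_freqs M m"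
  unfolding loop_freqs_def using assms by (intro CollectI allI impI exI[of _ u]) simp

lemma loop_freqs_bounds:
  assumes "g \<in> loop_freqs M m"
  shows "0 \<le> g w" "g w \<le> 1"
proof -
  have b: "0 \<le> lcount m u w / length u" "lcount m u w / length u \<le> 1" for u
    using lcount_bounds[of m u w] by (auto simp: divide_le_eq_1)
  have *: "\<exists>c. 0 \<le> c \<and> c \<le> 1 \<and> \<bar>c - g w\<bar> < \<epsilon>" if pos: "0 < \<epsilon>" for \<epsilon> :: real
  proof -
    obtain u where "\<bar>lcount m u w / length u - g w\<bar> < \<epsilon>"
      using assms pos unfolding loop_freqs_def by blast
    then show ?thesis using b[of u] by blast
  qed
  show "0 \<le> g w"
  proof (rule ccontr)
    assume "\<not> 0 \<le> g w"
    then show False using *[of "- g w"] by auto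
  qed
  show "g w \<le> 1"
  proof (rule ccontr)
    assume "\<not> g w \<le> 1"
    then show False using *[of "g w - 1"] by auto
  qed
qed

text \<open>
  It suffices to find loops of unbounded length whose window counts differ from a multiple of \<open>g\<close> by
  a bounded amount; the multiple need only be roughly the length of the loop.
\<close>

lemma loop_freqs_criterion:
  assumes "\<And>w. \<bar>g w\<bar> \<le> 1"
    and "\<And>N::nat. \<exists>u (G::real). loop M u \<and> N \<le> length u \<and> \<bar>length u - G\<bar> \<le> C \<and>
            (\<forall>w. \<bar>lcount m u w - G * g w\<bar> \<le> C)"
  shows "g \<in> loop_freqs M m"
  unfolding loop_freqs_def
proof (intro CollectI allI impI)
  fix \<epsilon> :: real assume e: "0 < \<epsilon>"
  obtain N :: nat where N: "2 * C / \<epsilon> < real N" using reals_Archimedean2 by blast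
  obtain u and G :: real where u: "loop M u" "N \<le> length u" "\<bar>length u - G\<bar> \<le> C"
    "\<And>w. \<bar>lcount m u w - G * g w\<bar> \<le> C"
    using assms(2)[of N] by blast
  have n: "0 < real (length u)" using u(1) by (simp add: loop_def)
  have "\<bar>lcount m u w / length u - g w\<bar> < \<epsilon>" for w
  proof -
    have "\<bar>(G - length u) * g w\<bar> \<le> C * 1"
      unfolding abs_mult using u(3) assms(1) by (intro mult_mono) auto
    moreover have "lcount m u w - length u * g w = (lcount m u w - G * g w) + (G - length u) * g w"
      by (simp add: algebra_simps)
    ultimately have "\<bar>lcount m u w - length u * g w\<bar> \<le> 2 * C" using u(4)[of w] by linarith
    also have "\<dots> < \<epsilon> * N" using N e by (simp add: field_simps)
    also have "\<dots> \<le> \<epsilon> * length u" using u(2) e by simp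
    finally have "\<bar>lcount m u w - length u * g w\<bar> / length u < \<epsilon>" using n by (simp add: field_simps)
    moreover have "\<bar>lcount m u w / length u - g w\<bar> = \<bar>lcount m u w - length u * g w\<bar> / length u"
    proof -
      have "lcount m u w / length u - g w = (lcount m u w - length u * g w) / length u"
        using n by (simp add: diff_divide_distrib)
      then show ?thesis by simp
    qed
    ultimately show ?thesis by simp
  qed
  then show "\<exists>u. loop M u \<and> (\<forall>w. \<bar>lcount m u w / length u - g w\<bar> < \<epsilon>)" using u(1) by blast
qed

lemma loop_freqs_closed:
  assumes "\<And>\<epsilon>. 0 < \<epsilon> \<Longrightarrow> \<exists>d\<in>loop_freqs M m. \<forall>w. \<bar>d w - g w\<bar> \<le> \<epsilon>"
  shows "g \<in> loop_freqs M m"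
  unfolding loop_freqs_def
proof (intro CollectI allI impI)
  fix \<epsilon> :: real assume e: "0 < \<epsilon>"
  then obtain d where d: "d \<in> loop_freqs M m" "\<And>w. \<bar>d w - g w\<bar> \<le> \<epsilon> / 2"
    using assms[of "\<epsilon> / 2"] by auto
  have "0 < \<epsilon> / 2" using e by simp
  then obtain u where "loop M u" and u: "\<And>w. \<bar>lcount m u w / length u - d w\<bar> < \<epsilon> / 2"
    using d(1) unfolding loop_freqs_def by blast
  moreover have "\<bar>lcount m u w / length u - g w\<bar> < \<epsilon>" for w
    using d(2)[of w] u[of w] by linarith
  ultimately show "\<exists>u. loop M u \<and> (\<forall>w. \<bar>lcount m u w / length u - g w\<bar> < \<epsilon>)" by blast
qed

text \<open>
  Transitive countable Markov shifts.
\<close>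

locale markov =
  fixes M :: "nat \<Rightarrow> nat \<Rightarrow> nat"
  assumes trans: "transitive_cms M"
begin

lemma walk_exists: "1 \<le> a \<Longrightarrow> 1 \<le> b \<Longrightarrow> \<exists>u. walk M a u b"
  using trans walk_of_admissible unfolding transitive_cms_def by metis

lemma loop_through: "1 \<le> a \<Longrightarrow> \<exists>u. loop M u \<and> hd u = a"
proof -
  assume a: "1 \<le> a"
  obtain u where u: "walk M a u (Suc a)" using walk_exists[OF a, of "Suc a"] by auto
  obtain v where v: "walk M (Suc a) v a" using walk_exists[OF _ a, of "Suc a"] by auto
  have "u \<noteq> []" using u by auto
  then have "hd (u @ v) = a" using u by (cases u) auto
  moreover have "walk M a (u @ v) a" using u v by (auto simp: walk_append)
  ultimately show ?thesis using \<open>u \<noteq> []\<close> walk_imp_loop by blast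
qed

lemma loop_freqs_nonempty: "loop_freqs M m \<noteq> {}"
  using loop_freq_mem loop_through[of 1] by fastforce

lemma loop_freqs_mix_loops:
  assumes p: "loop M p" and q: "loop M q" and t: "0 \<le> t" "t \<le> 1"
  shows "(\<lambda>w. (1 - t) * (lcount m p w / length p) + t * (lcount m q w / length q)) \<in> loop_freqs M m"
    (is "?g \<in> _")
proof -
  define a b where "a = hd p" and "b = hd q"
  have P: "walk M a p a" "p \<noteq> []" and Q: "walk M b q b" "q \<noteq> []"
    using p q by (auto simp: loop_def a_def b_def)
  obtain r where r: "walk M a r b" using walk_exists walk_pos[OF P(1)] walk_pos[OF Q(1)] by blast
  obtain s where s: "walk M b s a" using walk_exists walk_pos[OF P(1)] walk_pos[OF Q(1)] by blast
  define C where "C = 2 * real (length p * length q) + 6 * real m + real (length r) + real (length s)"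
  show ?thesis
  proof (rule loop_freqs_criterion)
    show "\<bar>?g w\<bar> \<le> 1" for w
    proof -
      have b: "0 \<le> lcount m u w / length u" "lcount m u w / length u \<le> 1" for u
        using lcount_bounds[of m u w] by (auto simp: divide_le_eq_1)
      have "?g w \<le> (1 - t) * 1 + t * 1"
        using t b by (intro add_mono mult_left_mono) auto
      moreover have "0 \<le> ?g w" using t b by (intro add_nonneg_nonneg mult_nonneg_nonneg) auto
      ultimately show ?thesis by simp
    qed
    fix N :: nat
    define N' where "N' = real N + 3"
    define K L where "K = nat \<lfloor>(1 - t) * N'\<rfloor>" and "L = nat \<lfloor>t * N'\<rfloor>"
    have "0 \<le> (1 - t) * N'" "0 \<le> t * N'" using t by (auto simp: N'_def)
    then have KL: "real K \<le> (1 - t) * N'" "(1 - t) * N' \<le> real K + 1"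
      "real L \<le> t * N'" "t * N' \<le> real L + 1"
      unfolding K_def L_def by linarith+
    \<comment> \<open>powers of \<open>p\<close> and \<open>q\<close> whose lengths are about \<open>(1 - t) * G\<close> and \<open>t * G\<close>, with \<open>G = |p| * |q| * N'\<close>\<close>
    define pK where "pK = concat (replicate (K * length q) p)"
    define qL where "qL = concat (replicate (L * length p) q)"
    define u where "u = pK @ r @ qL @ s"
    define PQ where "PQ = real (length p) * real (length q)"
    have lp: "1 \<le> length p" and lq: "1 \<le> length q" using P Q by (auto simp: Suc_le_eq)
    have PQ1: "1 \<le> PQ" unfolding PQ_def
      using mult_mono[of 1 "real (length p)" 1 "real (length q)"] lp lq by simp
    define G where "G = PQ * N'"
    have lenu: "real (length u) = PQ * K + PQ * L + length r + length s"
      by (simp add: u_def pK_def qL_def length_concat_replicate PQ_def algebra_simps)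
    have GK: "G = PQ * ((1 - t) * N') + PQ * (t * N')" by (simp add: G_def algebra_simps)
    have PQ0: "0 \<le> PQ" using PQ1 by simp
    have dK: "PQ * K \<le> PQ * ((1 - t) * N')" "PQ * ((1 - t) * N') \<le> PQ * K + PQ"
      and dL: "PQ * L \<le> PQ * (t * N')" "PQ * (t * N') \<le> PQ * L + PQ"
      using KL[THEN mult_left_mono, OF PQ0] unfolding distrib_left mult_1_right by blast+
    have "walk M a pK a" "walk M b qL b"
      unfolding pK_def qL_def by (intro walk_concat_replicate P(1) Q(1))+
    then have wu: "walk M a u a" unfolding u_def walk_append using r s by blast
    have "N' = (1 - t) * N' + t * N'" by (simp add: algebra_simps)
    then have KL2: "real N + 1 \<le> real K + real L" using KL unfolding N'_def by linarith
    have lenN: "N \<le> length u"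
    proof -
      have "real N \<le> 1 * (real K + real L)" using KL2 by simp
      also have "\<dots> \<le> PQ * (real K + real L)" using PQ1 by (intro mult_right_mono) auto
      also have "\<dots> \<le> length u" using lenu by (simp add: algebra_simps)
      finally show ?thesis by simp
    qed
    have ne: "loop M u"
    proof -
      have "0 < PQ * (real K + real L)" using PQ1 KL2 by (intro mult_pos_pos) auto
      then have "0 < PQ * K + PQ * L" by (simp only: distrib_left)
      then have "0 < real (length u)" using lenu by simp
      then show ?thesis using wu walk_imp_loop by auto
    qed
    have cnt: "\<bar>lcount m u w - G * ?g w\<bar> \<le> C" for w
    proof -
      have 1: "lcount m pK w = PQ * K * (lcount m p w / length p)"
        unfolding pK_def lcount_power[OF P(2)] using P(2) by (simp add: PQ_def)
      have 2: "lcount m qL w = PQ * L * (lcount m q w / length q)"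
        unfolding qL_def lcount_power[OF Q(2)] using Q(2) by (simp add: PQ_def)
      have b: "0 \<le> lcount m u w / length u" "lcount m u w / length u \<le> 1" for u
        using lcount_bounds[of m u w] by (auto simp: divide_le_eq_1)
      have *: "\<bar>y * c - x * c\<bar> \<le> PQ" if "y \<le> x" "x \<le> y + PQ" "0 \<le> c" "c \<le> 1" for x y c :: real
      proof -
        have "\<bar>y * c - x * c\<bar> = (x - y) * c" using that
          by (simp add: abs_mult flip: left_diff_distrib)
        also have "\<dots> \<le> PQ * 1" using that PQ1 by (intro mult_mono) auto
        finally show ?thesis by simp
      qed
      have G: "G * ((1 - t) * X + t * Y) = PQ * ((1 - t) * N') * X + PQ * (t * N') * Y" for X Y
        by (simp add: G_def algebra_simps)
      show ?thesis
        using *[OF dK b[of p]] *[OF dL b[of q]] lcount_append[of m pK "r @ qL @ s" w]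
          lcount_append[of m r "qL @ s" w] lcount_append[of m qL s w] lcount_bounds[of m r w]
          lcount_bounds[of m s w]
        unfolding u_def[symmetric] G 1 2 C_def of_nat_mult PQ_def[symmetric]
        by linarith
    qed
    have len: "\<bar>length u - G\<bar> \<le> C"
      using dK dL unfolding lenu GK C_def of_nat_mult PQ_def[symmetric] by linarith
    show "\<exists>u (G::real). loop M u \<and> N \<le> length u \<and> \<bar>length u - G\<bar> \<le> C \<and> (\<forall>w. \<bar>lcount m u w - G * ?g w\<bar> \<le> C)"
      using ne lenN len cnt by blast
  qed
qed

lemma loop_freqs_convex:
  assumes "g \<in> loop_freqs M m" "h \<in> loop_freqs M m" "0 \<le> t" "t \<le> 1"
  shows "(\<lambda>w. (1 - t) * g w + t * h w) \<in> loop_freqs M m"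
proof (rule loop_freqs_closed)
  fix \<epsilon> :: real assume e: "0 < \<epsilon>"
  obtain p where p: "loop M p" "\<And>w. \<bar>lcount m p w / length p - g w\<bar> < \<epsilon>"
    using assms(1) e unfolding loop_freqs_def by blast
  obtain q where q: "loop M q" "\<And>w. \<bar>lcount m q w / length q - h w\<bar> < \<epsilon>"
    using assms(2) e unfolding loop_freqs_def by blast
  have "\<bar>(1 - t) * (lcount m p w / length p) + t * (lcount m q w / length q)
         - ((1 - t) * g w + t * h w)\<bar> \<le> \<epsilon>" for w
  proof -
    have 1: "\<bar>(1 - t) * (lcount m p w / length p - g w)\<bar> \<le> (1 - t) * \<epsilon>"
      unfolding abs_mult using p(2)[of w] assms by (intro mult_mono) auto
    have 2: "\<bar>t * (lcount m q w / length q - h w)\<bar> \<le> t * \<epsilon>"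
      unfolding abs_mult using q(2)[of w] assms by (intro mult_mono) auto
    have "(1 - t) * (lcount m p w / length p) + t * (lcount m q w / length q)
         - ((1 - t) * g w + t * h w)
        = (1 - t) * (lcount m p w / length p - g w) + t * (lcount m q w / length q - h w)"
      by (simp add: algebra_simps)
    also have "\<bar>\<dots>\<bar> \<le> (1 - t) * \<epsilon> + t * \<epsilon>" using 1 2 by linarith
    finally show ?thesis by (simp add: algebra_simps)
  qed
  then show "\<exists>d\<in>loop_freqs M m. \<forall>w. \<bar>d w - ((1 - t) * g w + t * h w)\<bar> \<le> \<epsilon>"
    using loop_freqs_mix_loops[OF p(1) q(1) assms(3,4)] by (intro bexI) auto
qed

text \<open>
  The vectors \<open>t * d\<close> with \<open>d\<close> in \<open>loop_freqs M m\<close>; the window counts of a segment of length \<open>t\<close> are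
  compared with these.
\<close>

definition freq_cone :: "nat \<Rightarrow> real \<Rightarrow> (nat list \<Rightarrow> real) \<Rightarrow> bool" where
  "freq_cone m t g \<longleftrightarrow> 0 \<le> t \<and> (\<exists>d\<in>loop_freqs M m. \<forall>w. g w = t * d w)"

lemma freq_cone_0: "freq_cone m 0 (\<lambda>_. 0)"
  using loop_freqs_nonempty by (auto simp: freq_cone_def)

lemma freq_cone_scale:
  "freq_cone m t g \<Longrightarrow> 0 \<le> c \<Longrightarrow> freq_cone m (c * t) (\<lambda>w. c * g w)"
  by (auto simp: freq_cone_def mult.assoc)

lemma freq_cone_add:
  assumes "freq_cone m s g" "freq_cone m t h"
  shows "freq_cone m (s + t) (\<lambda>w. g w + h w)"
proof (cases "s + t = 0")
  case True
  then have "s = 0" "t = 0" using assms by (auto simp: freq_cone_def)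
  then show ?thesis using assms by (auto simp: freq_cone_def)
next
  case False
  obtain d e where d: "d \<in> loop_freqs M m" "\<And>w. g w = s * d w" "0 \<le> s"
    and e: "e \<in> loop_freqs M m" "\<And>w. h w = t * e w" "0 \<le> t"
    using assms by (auto simp: freq_cone_def)
  define r where "r = t / (s + t)"
  have r: "0 \<le> r" "r \<le> 1" "(s + t) * r = t" "(s + t) * (1 - r) = s"
    using False d(3) e(3) by (auto simp: r_def field_simps)
  have "g w + h w = (s + t) * ((1 - r) * d w + r * e w)" for w
    unfolding d(2) e(2) distrib_left mult.assoc[symmetric] r(3,4) by simp
  then show ?thesis
    using loop_freqs_convex[OF d(1) e(1) r(1,2)] d(3) e(3) unfolding freq_cone_def
    by (intro conjI bexI) auto
qed

lemma freq_cone_sum: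
  assumes "finite A" "\<And>a. a \<in> A \<Longrightarrow> freq_cone m (t a) (g a)"
  shows "freq_cone m (\<Sum>a\<in>A. t a) (\<lambda>w. \<Sum>a\<in>A. g a w)"
  using assms by (induction A rule: finite_induct) (auto intro: freq_cone_0 freq_cone_add)


text \<open>
  The fixed point at infinity sees only the window \<open>m \<dots> m\<close>.  Its frequency vector is approximated by
  loops that consist of a long segment with symbols \<open>\<ge> m\<close> and of a way back without repeated vertex.
\<close>

lemma infinity_freq:
  assumes "\<And>N. \<exists>x\<in>cms M. \<exists>i j. i + N \<le> j \<and> (\<forall>k\<in>{i..<j}. m \<le> x k)"
  shows "(\<lambda>w. of_bool (w = replicate m m)) \<in> loop_freqs M m" (is "?e \<in> _")
proof (rule loop_freqs_criterion)
  show "\<bar>?e w\<bar> \<le> 1" for w by simp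
  fix N :: nat
  obtain x i j where x: "x \<in> cms M" "i + Suc N \<le> j" "\<And>k. i \<le> k \<Longrightarrow> k < j \<Longrightarrow> m \<le> x k"
    using assms[of "Suc N"] by (meson atLeastLessThan_iff)
  have w1: "walk M (x i) (map x [i..<j]) (x j)" using walk_of_cms[OF x(1)] x(2) by simp
  obtain v where v: "walk M (x j) v (x i)" "distinct v"
    using walk_exists walk_shorten walk_pos[OF w1] by metis
  define u where "u = map x [i..<j] @ v"
  have "walk M (x i) u (x i)" using w1 v by (auto simp: u_def walk_append)
  then have lu: "loop M u" using x(2) by (auto simp: u_def intro!: walk_imp_loop)
  have len: "N \<le> length u" using x(2) by (simp add: u_def)
  define n where "n = length u"
  define low where "low = {k. k < n \<and> u ! k < m}"
  \<comment> \<open>low positions lie on the way back, which has distinct vertices\<close>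
  have lowc: "card low \<le> m"
  proof -
    have sub: "low \<subseteq> {j - i..<n}"
    proof
      fix k assume k: "k \<in> low"
      have "\<not> k < j - i"
      proof
        assume "k < j - i"
        then have "u ! k = x (i + k)" "i + k < j" by (auto simp: u_def nth_append)
        then show False using k x(3)[of "i + k"] by (simp add: low_def)
      qed
      then show "k \<in> {j - i..<n}" using k by (simp add: low_def)
    qed
    have vn: "u ! k = v ! (k - (j - i))" if "k \<in> low" for k
      using that sub by (auto simp: u_def nth_append)
    have "inj_on (\<lambda>k. u ! k) low"
    proof (rule inj_onI)
      fix k l assume kl: "k \<in> low" "l \<in> low" "u ! k = u ! l"
      then have "v ! (k - (j - i)) = v ! (l - (j - i))" using vn by simp
      moreover have "k - (j - i) < length v" "l - (j - i) < length v" "j - i \<le> k" "j - i \<le> l"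
        using kl(1,2) subsetD[OF sub] unfolding n_def u_def by fastforce+
      ultimately have "k - (j - i) = l - (j - i)" using v(2) nth_eq_iff_index_eq by blast
      then show "k = l" using \<open>j - i \<le> k\<close> \<open>j - i \<le> l\<close> by linarith
    qed
    moreover have "(\<lambda>k. u ! k) ` low \<subseteq> {..<m}" by (auto simp: low_def)
    ultimately show ?thesis by (metis card_image card_lessThan card_mono finite_lessThan)
  qed
  \<comment> \<open>a window is bad only if it reaches a low position in fewer than \<open>m\<close> steps, cyclically\<close>
  define bad where "bad = {k. k < n \<and> win m (per u) k \<noteq> replicate m m}"
  have n0: "0 < n" using lu by (simp add: loop_def n_def)
  have bad_sub: "bad \<subseteq> (\<lambda>(l, i). nat ((int l - int i) mod int n)) ` (low \<times> {..<m})"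
  proof
    fix k assume k: "k \<in> bad"
    then have kn: "k < n" by (simp add: bad_def)
    have "\<exists>i<m. per u (k + i) < m"
    proof (rule ccontr)
      assume "\<not> ?thesis"
      then have "win m (per u) k = map (\<lambda>i. m) [0..<m]"
        unfolding win_def by (intro map_cong) auto
      then show False using k by (simp add: bad_def map_replicate_const)
    qed
    then obtain i where i: "i < m" "per u (k + i) < m" by blast
    have "(k + i) mod n \<in> low" using i n0 by (simp add: low_def per_def n_def)
    moreover have "nat ((int ((k + i) mod n) - int i) mod int n) = k"
    proof -
      have "(int ((k + i) mod n) - int i) mod int n = (int (k + i) - int i) mod int n"
        unfolding zmod_int by (rule mod_diff_left_eq)
      also have "\<dots> = int k" using kn by simp
      finally show ?thesis by simp
    qed
    ultimately show "k \<in> (\<lambda>(l, i). nat ((int l - int i) mod int n)) ` (low \<times> {..<m})"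
      using i(1) by (intro image_eqI[of _ _ "((k + i) mod n, i)"]) auto
  qed
  have "finite low" by (simp add: low_def)
  then have "card bad \<le> card (low \<times> {..<m})"
    using bad_sub by (intro surj_card_le) auto
  also have "\<dots> \<le> m * m" using lowc by (simp add: card_cartesian_product)
  finally have badc: "real (card bad) \<le> real m * real m" by (simp flip: of_nat_mult)
  have "\<bar>lcount m u w - real n * ?e w\<bar> \<le> real m * real m" for w
  proof -
    have "real n * ?e w = (\<Sum>k\<in>{0..<n}. of_bool (replicate m m = w))" by auto
    moreover have "\<bar>(\<Sum>k\<in>{0..<n}. of_bool (win m (per u) k = w) :: real)
        - (\<Sum>k\<in>{0..<n}. of_bool (replicate m m = w))\<bar> \<le> real (card bad)"
      by (rule sum_of_bool_diff_le) (auto simp: bad_def)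
    ultimately show ?thesis using badc unfolding lcount_def cnt_def n_def by linarith
  qed
  then show "\<exists>u (G::real). loop M u \<and> N \<le> length u \<and> \<bar>length u - G\<bar> \<le> real m * real m
      \<and> (\<forall>w. \<bar>lcount m u w - G * ?e w\<bar> \<le> real m * real m)"
    using lu len by (intro exI[of _ u] exI[of _ "real n"]) (simp add: n_def)
qed

text \<open>
  \<open>B\<close> contains the symbols below \<open>m\<close> that may occur in the segment.  The induction over \<open>B\<close> removes
  one symbol at a time.
\<close>

lemma cnt_near_cone:
  assumes "finite B"
  shows "\<exists>C\<ge>0. \<forall>x\<in>cms M. \<forall>i j. i \<le> j \<and> (\<forall>k\<in>{i..<j}. x k < m \<longrightarrow> x k \<in> B) \<longrightarrow>
           (\<exists>g. freq_cone m (real (j - i)) g \<and> (\<forall>w. \<bar>cnt m x i j w - g w\<bar> \<le> C))"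
  using assms
proof (induction B rule: finite_induct)
  case empty
  obtain d where d: "d \<in> loop_freqs M m" using loop_freqs_nonempty by blast
  show ?case
  proof (cases "\<forall>N. \<exists>x\<in>cms M. \<exists>i j. i + N \<le> j \<and> (\<forall>k\<in>{i..<j}. m \<le> x k)")
    case True
    let ?e = "\<lambda>w. of_bool (w = replicate m m) :: real"
    have e: "?e \<in> loop_freqs M m" using infinity_freq True by blast
    show ?thesis
    proof (intro exI[of _ "real m"] conjI ballI allI impI)
      fix x i j assume "x \<in> cms M" and ij: "i \<le> j \<and> (\<forall>k\<in>{i..<j}. x k < m \<longrightarrow> x k \<in> {})"
      have "\<bar>cnt m x i j w - real (j - i) * ?e w\<bar> \<le> real m" for w
      proof -
        have s: "real (j - i) * ?e w = (\<Sum>k\<in>{i..<j}. of_bool (replicate m m = w))" by auto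
        have "\<bar>cnt m x i j w - real (j - i) * ?e w\<bar> \<le> real (card {j - m..<j})"
        proof (cases "j \<le> i + m")
          case True
          have "\<bar>cnt m x i j w - real (j - i) * ?e w\<bar> \<le> real (j - i)"
            using cnt_nonneg[of m x i j w] cnt_le[of m x i j w] by auto
          then show ?thesis using True by auto
        next
          case False
          show ?thesis unfolding s cnt_def
          proof (rule sum_of_bool_diff_le)
            fix k assume k: "k \<in> {i..<j} - {j - m..<j}"
            have "win m x k = map (\<lambda>i. m) [0..<m]"
              unfolding win_def by (intro map_cong) (use ij k in \<open>auto simp: min_def not_less\<close>)
            then show "win m x k = w \<longleftrightarrow> replicate m m = w" by (simp add: map_replicate_const)
          qed (use False in auto)
        qed
        then show ?thesis by simp
      qed
      then show "\<exists>g. freq_cone m (real (j - i)) g \<and> (\<forall>w. \<bar>cnt m x i j w - g w\<bar> \<le> real m)"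
        using e unfolding freq_cone_def by (intro exI[of _ "\<lambda>w. real (j - i) * ?e w"] conjI bexI[of _ ?e]) auto
    qed simp
  next
    case False
    then obtain N where N: "\<And>x i j. x \<in> cms M \<Longrightarrow> i + N \<le> j \<Longrightarrow> \<exists>k\<in>{i..<j}. x k < m"
      by (meson not_le)
    show ?thesis
    proof (intro exI[of _ "real N"] conjI ballI allI impI)
      fix x i j assume x: "x \<in> cms M" and ij: "i \<le> j \<and> (\<forall>k\<in>{i..<j}. x k < m \<longrightarrow> x k \<in> {})"
      then have "j - i \<le> N" using N[OF x, of i j] by force
      moreover have "\<bar>cnt m x i j w - real (j - i) * d w\<bar> \<le> real (j - i)" for w
      proof -
        have "0 \<le> real (j - i) * d w" "real (j - i) * d w \<le> real (j - i)"
          using loop_freqs_bounds[OF d, of w] by (auto simp: mult_left_le)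
        then show ?thesis
          using cnt_nonneg[of m x i j w] cnt_le[of m x i j w] by linarith
      qed
      ultimately show "\<exists>g. freq_cone m (real (j - i)) g \<and> (\<forall>w. \<bar>cnt m x i j w - g w\<bar> \<le> real N)"
        using d by (intro exI[of _ "\<lambda>w. real (j - i) * d w"])
          (force simp: freq_cone_def intro: order_trans)
    qed simp
  qed
next
  case (insert a B)
  obtain C where C: "C \<ge> 0" "\<And>x i j. x \<in> cms M \<Longrightarrow> i \<le> j \<Longrightarrow> (\<And>k. i \<le> k \<Longrightarrow> k < j \<Longrightarrow> x k < m \<Longrightarrow> x k \<in> B) \<Longrightarrow>
           \<exists>g. freq_cone m (real (j - i)) g \<and> (\<forall>w. \<bar>cnt m x i j w - g w\<bar> \<le> C)"
  proof -
    obtain C where C0: "C \<ge> 0" and C: "\<forall>x\<in>cms M. \<forall>i j. i \<le> j \<and> (\<forall>k\<in>{i..<j}. x k < m \<longrightarrow> x k \<in> B) \<longrightarrow>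
           (\<exists>g. freq_cone m (real (j - i)) g \<and> (\<forall>w. \<bar>cnt m x i j w - g w\<bar> \<le> C))"
      using insert.IH by blast
    show ?thesis
    proof (rule that[OF C0])
      fix x i j assume "x \<in> cms M" "i \<le> j" "\<And>k. i \<le> k \<Longrightarrow> k < j \<Longrightarrow> x k < m \<Longrightarrow> x k \<in> B"
      then show "\<exists>g. freq_cone m (real (j - i)) g \<and> (\<forall>w. \<bar>cnt m x i j w - g w\<bar> \<le> C)"
        using C[rule_format, of x i j] by simp
    qed
  qed
  obtain d where d: "d \<in> loop_freqs M m" using loop_freqs_nonempty by blast
  show ?case
  proof (intro exI[of _ "2 * C + real m + 1"] conjI ballI allI impI)
    fix x i j assume x: "x \<in> cms M"
      and ij: "i \<le> j \<and> (\<forall>k\<in>{i..<j}. x k < m \<longrightarrow> x k \<in> insert a B)"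
    show "\<exists>g. freq_cone m (real (j - i)) g \<and> (\<forall>w. \<bar>cnt m x i j w - g w\<bar> \<le> 2 * C + real m + 1)"
    proof (cases "\<exists>k\<in>{i..<j}. x k = a")
      case False
      then have "\<exists>g. freq_cone m (real (j - i)) g \<and> (\<forall>w. \<bar>cnt m x i j w - g w\<bar> \<le> C)"
        using ij by (intro C(2)[OF x]) auto
      moreover have "C \<le> 2 * C + real m + 1" using C(1) by linarith
      ultimately show ?thesis using order_trans by blast
    next
      case True
      define S where "S = {k\<in>{i..<j}. x k = a}"
      have S: "finite S" "S \<noteq> {}" using True by (auto simp: S_def)
      \<comment> \<open>between its first and its last occurrence of \<open>a\<close> the segment is a loop\<close>
      define k1 k2 where "k1 = Min S" and "k2 = Max S"
      have "k1 \<in> S" "k2 \<in> S" unfolding k1_def k2_def by (intro Min_in Max_in S)+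
      moreover have k12: "k1 \<le> k2" unfolding k1_def k2_def using S by (meson Max_ge Min_in)
      ultimately have k: "i \<le> k1" "k2 < j" "x k1 = a" "x k2 = a" by (auto simp: S_def)
      have nb: "l \<notin> S" if "l < k1 \<or> k2 < l" for l
        using that S unfolding k1_def k2_def by (meson Max_ge Min_le not_le)
      obtain g1 where g1: "freq_cone m (real (k1 - i)) g1" "\<And>w. \<bar>cnt m x i k1 w - g1 w\<bar> \<le> C"
      proof -
        have "\<exists>g. freq_cone m (real (k1 - i)) g \<and> (\<forall>w. \<bar>cnt m x i k1 w - g w\<bar> \<le> C)"
        proof (rule C(2)[OF x k(1)])
          fix l assume "i \<le> l" "l < k1" "x l < m"
          then show "x l \<in> B" using nb[of l] ij k k12 by (auto simp: S_def)
        qed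
        then show ?thesis using that by blast
      qed
      obtain g3 where g3: "freq_cone m (real (j - Suc k2)) g3" "\<And>w. \<bar>cnt m x (Suc k2) j w - g3 w\<bar> \<le> C"
      proof -
        have "\<exists>g. freq_cone m (real (j - Suc k2)) g \<and> (\<forall>w. \<bar>cnt m x (Suc k2) j w - g w\<bar> \<le> C)"
        proof (rule C(2)[OF x])
          show "Suc k2 \<le> j" using k by simp
          fix l assume "Suc k2 \<le> l" "l < j" "x l < m"
          then show "x l \<in> B" using nb[of l] ij k k12 by (auto simp: S_def)
        qed
        then show ?thesis using that by blast
      qed
      obtain g2 where g2: "freq_cone m (real (k2 - k1)) g2" "\<And>w. \<bar>cnt m x k1 k2 w - g2 w\<bar> \<le> real m"
      proof (cases "k1 = k2")
        case True
        then show ?thesis using that[of "\<lambda>_. 0"] freq_cone_0 by (simp add: cnt_def)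
      next
        case False
        define u where "u = map x [k1..<k2]"
        have "walk M a u a" using walk_of_cms[OF x k12] k by (simp add: u_def)
        then have "loop M u" using False k12 by (intro walk_imp_loop) (auto simp: u_def)
        then have "freq_cone m (real (k2 - k1)) (lcount m u)"
          unfolding freq_cone_def
          using loop_freq_mem[of M u m] False k12 by (auto intro!: bexI simp: u_def)
        then show ?thesis using that[of "lcount m u"] lcount_interval[OF k12, of m x]
          unfolding u_def abs_minus_commute[of "cnt _ _ _ _ _"] by blast
      qed
      have g4: "freq_cone m 1 d" "\<And>w. \<bar>cnt m x k2 (Suc k2) w - d w\<bar> \<le> 1"
      proof -
        show "freq_cone m 1 d" using d by (auto simp: freq_cone_def)
        show "\<bar>cnt m x k2 (Suc k2) w - d w\<bar> \<le> 1" for w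
          using loop_freqs_bounds[OF d, of w] cnt_nonneg[of m x k2 "Suc k2" w]
            cnt_le[of m x k2 "Suc k2" w] by simp
      qed
      define g where "g = (\<lambda>w. ((g1 w + g2 w) + d w) + g3 w)"
      have "freq_cone m (real (k1 - i) + real (k2 - k1) + 1 + real (j - Suc k2)) g"
        unfolding g_def by (intro freq_cone_add g1 g2 g3 g4)
      moreover have "real (k1 - i) + real (k2 - k1) + 1 + real (j - Suc k2) = real (j - i)"
        using k k12 by linarith
      moreover have "\<bar>cnt m x i j w - g w\<bar> \<le> 2 * C + real m + 1" for w
      proof -
        have "cnt m x i j w = cnt m x i k1 w + cnt m x k1 k2 w + cnt m x k2 (Suc k2) w + cnt m x (Suc k2) j w"
          using cnt_split[of i k1 j m x w] cnt_split[of k1 k2 j m x w] cnt_split[of k2 "Suc k2" j m x w] k k12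
          by linarith
        then show ?thesis
          using g1(2)[of w] g2(2)[of w] g3(2)[of w] g4(2)[of w] unfolding g_def by linarith
      qed
      ultimately show ?thesis by auto
    qed
  qed (use C(1) in auto)
qed

lemma cnt_near_cone_all:
  "\<exists>C. \<forall>x\<in>cms M. \<forall>n. \<exists>g. freq_cone m (real n) g \<and> (\<forall>w. \<bar>cnt m x 0 n w - g w\<bar> \<le> C)"
proof -
  obtain C where C: "\<forall>x\<in>cms M. \<forall>i j. i \<le> j \<and> (\<forall>k\<in>{i..<j}. x k < m \<longrightarrow> x k \<in> {..<m}) \<longrightarrow>
           (\<exists>g. freq_cone m (real (j - i)) g \<and> (\<forall>w. \<bar>cnt m x i j w - g w\<bar> \<le> C))"
    using cnt_near_cone[of "{..<m}" m] by auto
  have "\<exists>g. freq_cone m (real n) g \<and> (\<forall>w. \<bar>cnt m x 0 n w - g w\<bar> \<le> C)" if "x \<in> cms M" for x n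
    using C[rule_format, OF that, of 0 n] by simp
  then show ?thesis by blast
qed

end


section \<open>The topology of the compactification\<close>

text \<open>
  Symbols from \<open>m\<close> on, including \<open>\<infinity>\<close>, are collapsed to \<open>m\<close>.
\<close>

definition col :: "nat \<Rightarrow> enat \<Rightarrow> nat" where
  "col m e = (case e of enat a \<Rightarrow> min m a | \<infinity> \<Rightarrow> m)"

text \<open>
  The first \<open>m\<close> symbols, collapsed at \<open>m\<close>.  One parameter governs both the length of the prefix and
  the resolution of the symbols, so that these prefixes refine each other as \<open>m\<close> grows
  (\<open>pre_mono\<close>) and each takes finitely many values.
\<close>

definition pre :: "nat \<Rightarrow> (nat \<Rightarrow> enat) \<Rightarrow> nat list" where
  "pre m x = map (\<lambda>i. col m (x i)) [0..<m]"

lemma length_pre [simp]: "length (pre m x) = m"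
  by (simp add: pre_def)

lemma pre_eq_iff: "pre m x = pre m y \<longleftrightarrow> (\<forall>i<m. col m (x i) = col m (y i))"
  by (auto simp: pre_def)

lemma col_le: "col m e \<le> m"
  by (cases e) (auto simp: col_def)

lemma col_col: "m \<le> n \<Longrightarrow> col m e = min m (col n e)"
  by (cases e) (auto simp: col_def)

lemma pre_mono: "pre n x = pre n y \<Longrightarrow> m \<le> n \<Longrightarrow> pre m x = pre m y"
  unfolding pre_eq_iff by (simp add: col_col[of m n])

lemma funpow_shift: "(shift ^^ k) x = (\<lambda>n. x (k + n))"
  by (induction k) (auto simp: shift_def)

lemma pre_shift_cong: "pre n x = pre n y \<Longrightarrow> k + m \<le> n \<Longrightarrow> pre m ((shift ^^ k) x) = pre m ((shift ^^ k) y)"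
proof -
  assume *: "pre n x = pre n y" "k + m \<le> n"
  have "col m (x (k + i)) = col m (y (k + i))" if "i < m" for i
    using * that col_col[of m n] unfolding pre_eq_iff by simp
  then show ?thesis by (simp add: pre_eq_iff funpow_shift)
qed

lemma pre_enat: "pre m ((shift ^^ k) (\<lambda>n. enat (x n))) = win m x k"
  by (simp add: pre_def win_def funpow_shift col_def)

lemma finite_range_pre: "finite (range (pre m))"
proof (rule finite_subset)
  show "range (pre m) \<subseteq> {w. set w \<subseteq> {..m} \<and> length w = m}"
    using col_le by (auto simp: pre_def)
qed (simp add: finite_lists_length_eq)

lemma rho_bar_le_of_col_eq:
  assumes "col m a = col m b" "1 \<le> m"
  shows "rho_bar a b \<le> 1 / m"
proof (cases "a = b")
  case False
  have *: "recip e \<le> 1 / m" if "col m e = m" for e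
    using that assms(2) by (cases e) (auto simp: col_def recip_def min_def frac_le split: if_splits)
  have "col m a = m \<and> col m b = m"
    using False assms(1) by (cases a; cases b) (auto simp: col_def min_def split: if_splits)
  then show ?thesis using *[of a] *[of b] recip_bounds[of a] recip_bounds[of b]
    unfolding rho_bar_def by auto
qed (simp add: rho_bar_def)

lemma col_less_imp_recip_diff:
  assumes "col m a < col m b" "1 \<le> a"
  shows "1 / (real m + 1)\<^sup>2 \<le> recip a - recip b"
proof -
  obtain p where p: "a = enat p" "1 \<le> p" "p < m"
    using assms by (cases a; cases b) (auto simp: col_def one_enat_def min_def split: if_splits)
  have b: "recip b \<le> 1 / (real p + 1)"
    using assms p by (cases b) (auto simp: col_def recip_def min_def frac_le split: if_splits)
  have "real p * (real p + 1) \<le> (real m + 1)\<^sup>2"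
    unfolding power2_eq_square using p by (intro mult_mono) auto
  then have "1 / (real m + 1)\<^sup>2 \<le> 1 / (real p * (real p + 1))"
    using p by (intro divide_left_mono) auto
  also have "\<dots> = 1 / real p - 1 / (real p + 1)" using p by (simp add: field_simps)
  also have "\<dots> \<le> recip a - recip b" using b p by (simp add: recip_def)
  finally show ?thesis .
qed

lemma col_eq_of_rho_bar:
  assumes "rho_bar a b < 1 / (real m + 1)\<^sup>2" "1 \<le> a" "1 \<le> b"
  shows "col m a = col m b"
proof (rule ccontr)
  assume "col m a \<noteq> col m b"
  then consider "col m a < col m b" | "col m b < col m a" by linarith
  then show False
    using col_less_imp_recip_diff[of m a b] col_less_imp_recip_diff[of m b a] assms
    unfolding rho_bar_def by cases auto
qed

lemma d_bar_le_of_pre_eq: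
  assumes "pre m x = pre m y" "1 \<le> m"
  shows "d_bar x y \<le> 1 / m + (1/2) ^ m"
proof -
  have rho1: "0 \<le> rho_bar a b" "rho_bar a b \<le> 1" for a b
    using recip_bounds[of a] recip_bounds[of b] by (auto simp: rho_bar_def)
  have gs: "(\<Sum>n. (1/2::real) ^ Suc n) = 1" using power_half_series sums_unique by metis
  have sg: "summable (\<lambda>n. (1/2::real) ^ Suc n)" by (simp add: summable_geometric)
  have "d_bar x y = (\<Sum>n. (1/2) ^ Suc (n + m) * rho_bar (x (n + m)) (y (n + m)))
      + (\<Sum>n<m. (1/2) ^ Suc n * rho_bar (x n) (y n))"
    unfolding d_bar_def by (rule suminf_split_initial_segment[OF summable_d_bar])
  also have "(\<Sum>n. (1/2) ^ Suc (n + m) * rho_bar (x (n + m)) (y (n + m)))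
      \<le> (\<Sum>n. (1/2) ^ m * (1/2) ^ Suc n)"
  proof (rule suminf_le)
    show "summable (\<lambda>n. (1/2) ^ Suc (n + m) * rho_bar (x (n + m)) (y (n + m)))"
      using summable_ignore_initial_segment[OF summable_d_bar] .
    show "summable (\<lambda>n. (1/2::real) ^ m * (1/2) ^ Suc n)" by (rule summable_mult[OF sg])
    show "(1/2) ^ Suc (n + m) * rho_bar (x (n + m)) (y (n + m)) \<le> (1/2) ^ m * (1/2) ^ Suc n" for n
      using rho1[of "x (n + m)" "y (n + m)"] by (simp add: power_add mult_left_le)
  qed
  also have "(\<Sum>n. (1/2::real) ^ m * (1/2) ^ Suc n) = (1/2) ^ m"
    using suminf_mult[OF sg, of "(1/2) ^ m"] gs by simp
  also have "(\<Sum>n<m. (1/2) ^ Suc n * rho_bar (x n) (y n)) \<le> (\<Sum>n<m. (1/2) ^ Suc n * (1 / m))"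
  proof (intro sum_mono mult_left_mono)
    show "rho_bar (x n) (y n) \<le> 1 / m" if "n \<in> {..<m}" for n
      using assms that by (intro rho_bar_le_of_col_eq) (auto simp: pre_eq_iff)
  qed auto
  also have "\<dots> = (\<Sum>n<m. (1/2) ^ Suc n) * (1 / m)" by (simp only: sum_distrib_right)
  also have "\<dots> \<le> 1 * (1 / m)"
    using sum_le_suminf[OF sg, of "{..<m}"] gs by (intro mult_right_mono) auto
  finally show ?thesis by simp
qed

lemma pre_eq_of_d_bar:
  assumes "d_bar x y < (1/2) ^ m / (real m + 1)\<^sup>2" "x \<in> ext_seqs" "y \<in> ext_seqs"
  shows "pre m x = pre m y"
  unfolding pre_eq_iff
proof (intro allI impI)
  fix i assume i: "i < m"
  have "(\<Sum>n\<in>{i}. (1/2) ^ Suc n * rho_bar (x n) (y n)) \<le> d_bar x y"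
    unfolding d_bar_def by (intro sum_le_suminf[OF summable_d_bar]) (auto simp: rho_bar_def)
  moreover have "(1/2::real) ^ m * rho_bar (x i) (y i) \<le> (1/2) ^ Suc i * rho_bar (x i) (y i)"
    using i by (intro mult_right_mono power_decreasing) (auto simp: rho_bar_def)
  ultimately have "(1/2) ^ m * rho_bar (x i) (y i) < (1/2) ^ m * (1 / (real m + 1)\<^sup>2)"
    using assms(1) by simp
  then have "rho_bar (x i) (y i) < 1 / (real m + 1)\<^sup>2" by (simp only: mult_less_cancel_left_pos zero_less_power zero_less_divide_1_iff zero_less_numeral)
  then show "col m (x i) = col m (y i)"
    using assms(2,3) by (intro col_eq_of_rho_bar) (auto simp: ext_seqs_def)
qed

interpretation ext: Metric_space ext_seqs d_bar
  by (rule Metric_space_d_bar)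

lemma small_level:
  fixes \<epsilon> :: real
  assumes "0 < \<epsilon>"
  shows "\<exists>m\<ge>1. 1 / m + (1/2) ^ m < \<epsilon>"
proof -
  have "(\<lambda>m. 1 / real m) \<longlonglongrightarrow> 0" by (rule lim_1_over_n)
  moreover have "(\<lambda>m. (1/2::real) ^ m) \<longlonglongrightarrow> 0" by (rule LIMSEQ_power_zero) simp
  ultimately have lim: "(\<lambda>m. 1 / real m + (1/2) ^ m) \<longlonglongrightarrow> 0"
    using tendsto_add[of "\<lambda>m. 1 / real m" 0 sequentially "\<lambda>m. (1/2) ^ m" 0] by simp
  have "\<forall>\<^sub>F m in sequentially. 1 / real m + (1/2) ^ m < \<epsilon>"
    by (rule order_tendstoD(2)[OF lim assms])
  then obtain N where N: "\<And>m. N \<le> m \<Longrightarrow> 1 / real m + (1/2) ^ m < \<epsilon>"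
    unfolding eventually_sequentially by blast
  show ?thesis by (intro exI[of _ "max 1 N"] conjI N) auto
qed

text \<open>
  The sets on which \<open>pre m\<close> is constant form a base of the topology.
\<close>

lemma openin_ext_iff:
  "openin ext_top U \<longleftrightarrow> U \<subseteq> ext_seqs \<and> (\<forall>x\<in>U. \<exists>m. \<forall>y\<in>ext_seqs. pre m y = pre m x \<longrightarrow> y \<in> U)"
proof (intro iffI conjI ballI)
  assume U: "openin ext_top U"
  then show "U \<subseteq> ext_seqs" using openin_subset by fastforce
  fix x assume x: "x \<in> U"
  obtain \<epsilon> where e: "0 < \<epsilon>" "ext.mball x \<epsilon> \<subseteq> U"
    using U x by (auto simp: ext_top_def ext.openin_mtopology)
  obtain m where m: "1 \<le> m" "1 / m + (1/2) ^ m < \<epsilon>" using small_level[OF e(1)] by auto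
  have "\<forall>y\<in>ext_seqs. pre m y = pre m x \<longrightarrow> y \<in> U"
  proof (intro ballI impI)
    fix y assume "y \<in> ext_seqs" "pre m y = pre m x"
    then have "y \<in> ext.mball x \<epsilon>"
      using d_bar_le_of_pre_eq[of m x y] m x \<open>U \<subseteq> ext_seqs\<close> by (auto simp: ext.mball_def)
    then show "y \<in> U" using e(2) by blast
  qed
  then show "\<exists>m. \<forall>y\<in>ext_seqs. pre m y = pre m x \<longrightarrow> y \<in> U" by blast
next
  assume *: "U \<subseteq> ext_seqs \<and> (\<forall>x\<in>U. \<exists>m. \<forall>y\<in>ext_seqs. pre m y = pre m x \<longrightarrow> y \<in> U)"
  show "openin ext_top U"
    unfolding ext_top_def ext.openin_mtopology
  proof (intro conjI allI impI)
    show "U \<subseteq> ext_seqs" using * by blast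
    fix x assume x: "x \<in> U"
    then obtain m where m: "\<And>y. y \<in> ext_seqs \<Longrightarrow> pre m y = pre m x \<Longrightarrow> y \<in> U" using * by blast
    define r where "r = (1/2) ^ m / (real m + 1)\<^sup>2"
    have "0 < r" by (simp add: r_def)
    moreover have "ext.mball x r \<subseteq> U"
    proof
      fix y assume "y \<in> ext.mball x r"
      then have y: "x \<in> ext_seqs" "y \<in> ext_seqs" "d_bar x y < r" by (auto simp: ext.mball_def)
      then have "pre m x = pre m y" unfolding r_def by (intro pre_eq_of_d_bar)
      then show "y \<in> U" using m[OF y(2)] by simp
    qed
    ultimately show "\<exists>r>0. ext.mball x r \<subseteq> U" by blast
  qed
qed

text \<open>
  The space of sequences is a continuous image of a countable product of copies of the compact set
  \<open>{0} \<union> {1/n | n \<ge> 1}\<close>.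
\<close>

lemma compact_space_ext_top: "compact_space ext_top"
proof -
  define E where "E = {e::enat. 1 \<le> e}"
  define S where "S = PiE UNIV (\<lambda>_::nat. recip ` E)"
  define g where "g = (\<lambda>z (n::nat). inv_into E recip (z n :: real))"
  have E_eq: "recip ` E = insert 0 (range (\<lambda>k. 1 / real (Suc k)))"
  proof (intro equalityI subsetI)
    fix r assume "r \<in> recip ` E"
    then obtain e where e: "1 \<le> e" "r = recip e" by (auto simp: E_def)
    show "r \<in> insert 0 (range (\<lambda>k. 1 / real (Suc k)))"
    proof (cases e)
      case (enat n)
      then have "n = Suc (n - 1)" using e by (simp add: one_enat_def)
      then have "r = 1 / real (Suc (n - 1))" using enat e by (simp add: recip_def)
      then show ?thesis by blast
    qed (use e in \<open>simp add: recip_def\<close>)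
  next
    fix r assume "r \<in> insert 0 (range (\<lambda>k. 1 / real (Suc k)))"
    then consider "r = recip \<infinity>" | k where "r = recip (enat (Suc k))"
      by (auto simp: recip_def)
    then show "r \<in> recip ` E"
      by cases (auto simp: E_def one_enat_def)
  qed
  have "compact (recip ` E)"
    unfolding E_eq using LIMSEQ_inverse_real_of_nat
    by (intro compact_sequence_with_limit) (simp add: inverse_eq_divide)
  then have "compactin (product_topology (\<lambda>_::nat. euclideanreal) UNIV) S"
    unfolding S_def compactin_PiE by simp
  then have cS: "compactin euclidean S" by (simp only: euclidean_product_topology)
  have rg: "recip (g z n) = z n" "1 \<le> g z n" if "z \<in> S" for z n
  proof -
    have "z n \<in> recip ` E" using that by (auto simp: S_def)
    then show "recip (g z n) = z n" "1 \<le> g z n"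
      using f_inv_into_f[of "z n" recip E] inv_into_into[of "z n" recip E]
      by (auto simp: g_def E_def)
  qed
  have "continuous_map (subtopology euclidean S) ext_top g"
    unfolding continuous_map_def
  proof (intro conjI allI impI)
    show "g \<in> topspace (subtopology euclidean S) \<rightarrow> topspace ext_top"
      using rg by (auto simp: ext_seqs_def)
    fix U assume U: "openin ext_top U"
    have "\<exists>T. openin (subtopology euclidean S) T \<and> z \<in> T \<and> T \<subseteq> {z\<in>S. g z \<in> U}"
      if z: "z \<in> S" "g z \<in> U" for z
    proof -
      obtain m where m: "\<And>y. y \<in> ext_seqs \<Longrightarrow> pre m y = pre m (g z) \<Longrightarrow> y \<in> U"
        using U z unfolding openin_ext_iff by blast
      define T where "T = (\<Inter>i<m. {z'. dist (z' i) (z i) < 1 / (real m + 1)\<^sup>2})"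
      have "open T" unfolding T_def
        by (intro open_INT ballI open_Collect_less continuous_intros) auto
      then have "openin (subtopology euclidean S) (S \<inter> T)" by (simp add: openin_open_Int)
      moreover have "z \<in> S \<inter> T" using z by (auto simp: T_def)
      moreover have "S \<inter> T \<subseteq> {z\<in>S. g z \<in> U}"
      proof
        fix z' assume z': "z' \<in> S \<inter> T"
        have "pre m (g z') = pre m (g z)"
          unfolding pre_eq_iff
        proof (intro allI impI)
          fix i assume "i < m"
          then show "col m (g z' i) = col m (g z i)"
            using z' z rg by (intro col_eq_of_rho_bar) (auto simp: rho_bar_def T_def dist_real_def)
        qed
        then show "z' \<in> {z\<in>S. g z \<in> U}" using m[of "g z'"] z' rg by (auto simp: ext_seqs_def)
      qed
      ultimately show ?thesis by blast
    qed
    then show "openin (subtopology euclidean S) {x \<in> topspace (subtopology euclidean S). g x \<in> U}"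
      by (subst openin_subopen) auto
  qed
  moreover have "compactin (subtopology euclidean S) S"
    using cS by (simp add: compactin_subtopology)
  ultimately have "compactin ext_top (g ` S)"
    by (metis image_compactin)
  moreover have "g ` S = ext_seqs"
  proof (intro equalityI subsetI)
    fix x assume x: "x \<in> ext_seqs"
    then have "(\<lambda>n. recip (x n)) \<in> S" by (auto simp: S_def ext_seqs_def E_def)
    moreover from rg[OF this] have "g (\<lambda>n. recip (x n)) = x"
      using x recip_inj by (intro ext) (auto simp: ext_seqs_def)
    ultimately show "x \<in> g ` S" by (metis imageI)
  qed (use rg in \<open>auto simp: ext_seqs_def\<close>)
  ultimately show ?thesis by (simp add: compact_space_def)
qed

lemma cms_bar_subset: "cms_bar M \<subseteq> ext_seqs"
  using closure_of_subset_topspace[of ext_top "cms_ext M"] by (simp add: cms_bar_def)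

lemma openin_cms_bar_iff:
  "openin (cms_bar_top M) U \<longleftrightarrow>
     U \<subseteq> cms_bar M \<and> (\<forall>x\<in>U. \<exists>m. \<forall>y\<in>cms_bar M. pre m y = pre m x \<longrightarrow> y \<in> U)"
proof
  assume "openin (cms_bar_top M) U"
  then obtain V where V: "openin ext_top V" "U = V \<inter> cms_bar M"
    unfolding cms_bar_top_def openin_subtopology by blast
  have "\<exists>m. \<forall>y\<in>cms_bar M. pre m y = pre m x \<longrightarrow> y \<in> U" if "x \<in> U" for x
  proof -
    have "x \<in> V" using that V(2) by simp
    then obtain m where m: "\<And>y. y \<in> ext_seqs \<Longrightarrow> pre m y = pre m x \<Longrightarrow> y \<in> V"
      using V(1) unfolding openin_ext_iff by meson
    have "y \<in> U" if "y \<in> cms_bar M" "pre m y = pre m x" for y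
      using m[of y] that cms_bar_subset[of M] unfolding V(2) by auto
    then show ?thesis by blast
  qed
  then show "U \<subseteq> cms_bar M \<and> (\<forall>x\<in>U. \<exists>m. \<forall>y\<in>cms_bar M. pre m y = pre m x \<longrightarrow> y \<in> U)"
    unfolding V(2) by simp
next
  assume *: "U \<subseteq> cms_bar M \<and> (\<forall>x\<in>U. \<exists>m. \<forall>y\<in>cms_bar M. pre m y = pre m x \<longrightarrow> y \<in> U)"
  define P where "P m x \<longleftrightarrow> (\<forall>z\<in>cms_bar M. pre m z = pre m x \<longrightarrow> z \<in> U)" for m x
  define V where "V = {y\<in>ext_seqs. \<exists>m. P m y}"
  have P_cong: "P m z" if "P m y" "pre m z = pre m y" for m y z
    using that unfolding P_def by simp
  have "openin ext_top V"
    unfolding openin_ext_iff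
  proof (intro conjI ballI)
    fix y assume "y \<in> V"
    then obtain m where "P m y" unfolding V_def by blast
    then have "\<forall>z\<in>ext_seqs. pre m z = pre m y \<longrightarrow> z \<in> V"
      using P_cong[of m y] unfolding V_def by blast
    then show "\<exists>m. \<forall>z\<in>ext_seqs. pre m z = pre m y \<longrightarrow> z \<in> V" by blast
  qed (simp add: V_def)
  moreover have "V \<inter> cms_bar M = U"
  proof (intro equalityI subsetI)
    fix x assume x: "x \<in> U"
    then have xb: "x \<in> cms_bar M" using * by blast
    have "\<exists>m. P m x" using * x unfolding P_def by simp
    then show "x \<in> V \<inter> cms_bar M"
      using xb cms_bar_subset[of M] unfolding V_def by auto
  next
    fix x assume "x \<in> V \<inter> cms_bar M"
    then show "x \<in> U" unfolding V_def P_def by auto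
  qed
  ultimately show "openin (cms_bar_top M) U"
    unfolding cms_bar_top_def openin_subtopology by blast
qed

lemma openin_cms_barD:
  "openin (cms_bar_top M) U \<Longrightarrow> x \<in> U \<Longrightarrow> \<exists>m. \<forall>y\<in>cms_bar M. pre m y = pre m x \<longrightarrow> y \<in> U"
  unfolding openin_cms_bar_iff by blast

lemma cms_ext_subset_bar: "cms_ext M \<subseteq> cms_bar M"
  unfolding cms_bar_def using cms_ext_subset[of M] by (intro closure_of_subset) simp

lemma compact_space_cms_bar: "compact_space (cms_bar_top M)"
  unfolding cms_bar_top_def cms_bar_def
  by (intro compact_space_subtopology closedin_compact_space compact_space_ext_top closedin_closure_of)

lemma in_cms_bar_iff:
  "x \<in> cms_bar M \<longleftrightarrow> x \<in> ext_seqs \<and> (\<forall>m. \<exists>y\<in>cms_ext M. pre m y = pre m x)"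
proof (intro iffI conjI allI)
  assume x: "x \<in> cms_bar M"
  then show xe: "x \<in> ext_seqs" using cms_bar_subset by blast
  fix m
  have "openin ext_top {y\<in>ext_seqs. pre m y = pre m x}"
    unfolding openin_ext_iff by (auto intro!: exI[of _ m])
  then show "\<exists>y\<in>cms_ext M. pre m y = pre m x"
    using x xe unfolding cms_bar_def in_closure_of by (metis (mono_tags, lifting) mem_Collect_eq)
next
  assume *: "x \<in> ext_seqs \<and> (\<forall>m. \<exists>y\<in>cms_ext M. pre m y = pre m x)"
  show "x \<in> cms_bar M"
    unfolding cms_bar_def in_closure_of
  proof (intro conjI allI impI)
    fix T assume T: "x \<in> T \<and> openin ext_top T"
    then obtain m where m: "\<And>y. y \<in> ext_seqs \<Longrightarrow> pre m y = pre m x \<Longrightarrow> y \<in> T"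
      unfolding openin_ext_iff by blast
    obtain y where "y \<in> cms_ext M" "pre m y = pre m x" using * by blast
    then show "\<exists>y. y \<in> cms_ext M \<and> y \<in> T" using m cms_ext_subset by blast
  qed (use * in simp)
qed

lemma shift_cms_ext: "x \<in> cms_ext M \<Longrightarrow> shift x \<in> cms_ext M"
  by (auto simp: cms_ext_def cms_def shift_def)

lemma shift_cms_bar: "x \<in> cms_bar M \<Longrightarrow> shift x \<in> cms_bar M"
  unfolding in_cms_bar_iff
proof (intro conjI allI)
  assume *: "x \<in> ext_seqs \<and> (\<forall>m. \<exists>y\<in>cms_ext M. pre m y = pre m x)"
  then show "shift x \<in> ext_seqs" by (auto simp: shift_def ext_seqs_def)
  fix m
  obtain y where y: "y \<in> cms_ext M" "pre (Suc m) y = pre (Suc m) x" using * by blast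
  have "pre m (shift y) = pre m (shift x)" using pre_shift_cong[OF y(2), of 1 m] by simp
  then show "\<exists>y\<in>cms_ext M. pre m y = pre m (shift x)" using shift_cms_ext[OF y(1)] by blast
qed

text \<open>
  The points of the compactification with collapsed prefix \<open>w\<close>; the level is the length of \<open>w\<close>.
\<close>

definition cell :: "(nat \<Rightarrow> nat \<Rightarrow> nat) \<Rightarrow> nat list \<Rightarrow> (nat \<Rightarrow> enat) set" where
  "cell M w = {x \<in> cms_bar M. pre (length w) x = w}"

lemma openin_cells: "openin (cms_bar_top M) {x\<in>cms_bar M. pre m x \<in> W}"
  unfolding openin_cms_bar_iff by (auto intro!: exI[of _ m])

lemma continuous_cells:
  "continuous_map (cms_bar_top M) euclideanreal (\<lambda>x. of_bool (pre m x \<in> W))"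
  unfolding continuous_map_def
proof (intro conjI allI impI)
  fix U :: "real set"
  show "openin (cms_bar_top M) {x \<in> topspace (cms_bar_top M). of_bool (pre m x \<in> W) \<in> U}"
    unfolding openin_cms_bar_iff by (auto intro!: exI[of _ m])
qed simp

lemma uniform_on_cells:
  assumes f: "continuous_map (cms_bar_top M) euclideanreal f" and e: "0 < \<epsilon>"
  shows "\<exists>m. \<forall>x\<in>cms_bar M. \<forall>y\<in>cms_bar M. pre m x = pre m y \<longrightarrow> \<bar>f x - f y\<bar> < \<epsilon>"
proof -
  have "\<exists>m. \<forall>y\<in>cms_bar M. pre m y = pre m x \<longrightarrow> \<bar>f x - f y\<bar> < \<epsilon> / 2" if x: "x \<in> cms_bar M" for x
  proof -
    have "openin (cms_bar_top M) {y \<in> topspace (cms_bar_top M). f y \<in> ball (f x) (\<epsilon> / 2)}"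
      using f by (rule openin_continuous_map_preimage) simp
    moreover have "x \<in> {y \<in> topspace (cms_bar_top M). f y \<in> ball (f x) (\<epsilon> / 2)}" using x e by simp
    ultimately have "\<exists>m. \<forall>y\<in>cms_bar M. pre m y = pre m x \<longrightarrow> y \<in> {y \<in> topspace (cms_bar_top M). f y \<in> ball (f x) (\<epsilon> / 2)}"
      by (rule openin_cms_barD)
    then show ?thesis by (simp add: dist_real_def)
  qed
  then obtain m where m: "\<And>x y. x \<in> cms_bar M \<Longrightarrow> y \<in> cms_bar M \<Longrightarrow> pre (m x) y = pre (m x) x \<Longrightarrow> \<bar>f x - f y\<bar> < \<epsilon> / 2"
    by metis
  define V where "V x = {y\<in>cms_bar M. pre (m x) y \<in> {pre (m x) x}}" for x
  have "\<And>U. U \<in> V ` cms_bar M \<Longrightarrow> openin (cms_bar_top M) U"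
    unfolding V_def using openin_cells by blast
  moreover have "topspace (cms_bar_top M) \<subseteq> \<Union> (V ` cms_bar M)" by (auto simp: V_def)
  ultimately obtain \<F> where \<F>: "finite \<F>" "\<F> \<subseteq> V ` cms_bar M" "topspace (cms_bar_top M) \<subseteq> \<Union>\<F>"
    using compact_space_cms_bar[of M, unfolded compact_space_alt, rule_format, of "V ` cms_bar M"] by blast
  obtain F where "F \<subseteq> cms_bar M" "finite F" "\<F> = V ` F"
    using finite_subset_image[OF \<F>(1,2)] by blast
  with \<F>(3) have F: "finite F" "F \<subseteq> cms_bar M" "cms_bar M \<subseteq> (\<Union>x\<in>F. V x)" by auto
  define N where "N = Max (insert 0 (m ` F))"
  have N: "m x \<le> N" if "x \<in> F" for x using that F(1) by (auto simp: N_def)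
  have "\<bar>f x - f y\<bar> < \<epsilon>" if xy: "x \<in> cms_bar M" "y \<in> cms_bar M" "pre N x = pre N y" for x y
  proof -
    obtain z where z: "z \<in> F" "pre (m z) x = pre (m z) z" using F(3) xy(1) unfolding V_def by blast
    moreover have "pre (m z) y = pre (m z) z" using pre_mono[OF xy(3) N[OF z(1)]] z(2) by simp
    ultimately have "\<bar>f z - f x\<bar> < \<epsilon> / 2" "\<bar>f z - f y\<bar> < \<epsilon> / 2" using m F(2) xy by auto
    then show ?thesis by linarith
  qed
  then show ?thesis by blast
qed


section \<open>Finite measures as real set functions\<close>

text \<open>
  The Borel sets of the compactification.
\<close>

definition bsets :: "(nat \<Rightarrow> nat \<Rightarrow> nat) \<Rightarrow> (nat \<Rightarrow> enat) set set" where
  "bsets M = sigma_sets (cms_bar M) {U. openin (cms_bar_top M) U}"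

text \<open>
  Finite Borel measures, as real-valued set functions.  In this form sums, scalar multiples,
  restrictions and differences of measures are defined pointwise.  Values outside the Borel sets are
  irrelevant.
\<close>

definition fmeas :: "(nat \<Rightarrow> nat \<Rightarrow> nat) \<Rightarrow> ((nat \<Rightarrow> enat) set \<Rightarrow> real) \<Rightarrow> bool" where
  "fmeas M m \<longleftrightarrow> (\<forall>A\<in>bsets M. 0 \<le> m A) \<and>
     (\<forall>F. range F \<subseteq> bsets M \<longrightarrow> disjoint_family F \<longrightarrow> (\<lambda>i::nat. m (F i)) sums m (\<Union>i. F i))"

text \<open>
  The measure given by such a set function.
\<close>

definition mk :: "(nat \<Rightarrow> nat \<Rightarrow> nat) \<Rightarrow> ((nat \<Rightarrow> enat) set \<Rightarrow> real) \<Rightarrow> (nat \<Rightarrow> enat) measure" where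
  "mk M m = measure_of (cms_bar M) (bsets M) (\<lambda>A. ennreal (m A))"

lemma open_subset_Pow: "{U. openin (cms_bar_top M) U} \<subseteq> Pow (cms_bar M)"
  using openin_subset[of "cms_bar_top M"] by auto

lemma sigma_algebra_bsets: "sigma_algebra (cms_bar M) (bsets M)"
  unfolding bsets_def by (rule sigma_algebra_sigma_sets[OF open_subset_Pow])

lemma bsets_subset: "A \<in> bsets M \<Longrightarrow> A \<subseteq> cms_bar M"
  unfolding bsets_def using sigma_sets_into_sp[OF open_subset_Pow] .

lemma space_mk [simp]: "space (mk M m) = cms_bar M"
  unfolding mk_def using bsets_subset by (intro space_measure_of) auto

lemma sets_mk [simp]: "sets (mk M m) = bsets M"
  unfolding mk_def using sigma_algebra_bsets by (rule sigma_algebra.sets_measure_of_eq)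

lemma open_in_bsets: "openin (cms_bar_top M) U \<Longrightarrow> U \<in> bsets M"
  unfolding bsets_def by (rule sigma_sets.Basic) simp

lemma space_bsets: "cms_bar M \<in> bsets M"
  using openin_topspace[of "cms_bar_top M"] by (intro open_in_bsets) simp

lemma fmeas_empty:
  assumes "fmeas M m"
  shows "m {} = 0"
proof -
  have "{} \<in> bsets M" unfolding bsets_def by (rule sigma_sets.Empty)
  then have "(\<lambda>i::nat. m ((\<lambda>_. {}) i)) sums m (\<Union>i::nat. {})"
    using assms unfolding fmeas_def by (auto simp: disjoint_family_on_def)
  then have "summable (\<lambda>i::nat. m {})" using sums_summable by auto
  then show ?thesis by (simp add: summable_const_iff)
qed

lemma emeasure_mk:
  assumes "fmeas M m" "A \<in> bsets M"
  shows "emeasure (mk M m) A = ennreal (m A)"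
  unfolding mk_def
proof (rule emeasure_measure_of_sigma[OF sigma_algebra_bsets _ _ assms(2)])
  show "positive (bsets M) (\<lambda>A. ennreal (m A))"
    using fmeas_empty[OF assms(1)] by (simp add: positive_def)
  show "countably_additive (bsets M) (\<lambda>A. ennreal (m A))"
  proof (rule countably_additiveI)
    fix F :: "nat \<Rightarrow> _" assume F: "range F \<subseteq> bsets M" "disjoint_family F"
    then have "(\<lambda>i. m (F i)) sums m (\<Union>i. F i)" using assms(1) unfolding fmeas_def by blast
    moreover have "0 \<le> m (F i)" for i using F(1) assms(1) unfolding fmeas_def by blast
    ultimately show "(\<Sum>i. ennreal (m (F i))) = ennreal (m (\<Union> (range F)))"
      by (intro suminf_ennreal_eq)
  qed
qed

lemma finite_measure_mk: "fmeas M m \<Longrightarrow> finite_measure (mk M m)"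
  by (rule finite_measureI) (simp add: emeasure_mk[OF _ space_bsets])

lemma measure_mk: "fmeas M m \<Longrightarrow> A \<in> bsets M \<Longrightarrow> measure (mk M m) A = m A"
  unfolding measure_def by (simp add: emeasure_mk fmeas_def)

lemma fmeas_measure:
  assumes "finite_measure \<mu>" "sets \<mu> = bsets M"
  shows "fmeas M (measure \<mu>)"
  unfolding fmeas_def using finite_measure.finite_measure_UNION[OF assms(1)] assms(2)
  by (auto simp: measure_nonneg)

lemma fmeas_add:
  assumes "fmeas M m1" "fmeas M m2" shows "fmeas M (\<lambda>A. m1 A + m2 A)"
  using assms unfolding fmeas_def by (auto intro!: sums_add)

lemma fmeas_scale:
  assumes "fmeas M m" "0 \<le> c" shows "fmeas M (\<lambda>A. c * m A)"
  using assms unfolding fmeas_def by (auto intro!: sums_mult)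

lemma fmeas_diff:
  assumes "fmeas M m1" "fmeas M m2" "\<And>A. A \<in> bsets M \<Longrightarrow> m2 A \<le> m1 A"
  shows "fmeas M (\<lambda>A. m1 A - m2 A)"
  using assms unfolding fmeas_def by (auto intro!: sums_diff)

lemma fmeas_restrict:
  assumes "fmeas M m" "Y \<in> bsets M" shows "fmeas M (\<lambda>A. m (A \<inter> Y))"
  unfolding fmeas_def
proof (intro conjI ballI allI impI)
  interpret sigma_algebra "cms_bar M" "bsets M" by (rule sigma_algebra_bsets)
  show "0 \<le> m (A \<inter> Y)" if "A \<in> bsets M" for A
    using assms that unfolding fmeas_def by blast
  fix F :: "nat \<Rightarrow> _" assume F: "range F \<subseteq> bsets M" "disjoint_family F"
  have "range (\<lambda>i. F i \<inter> Y) \<subseteq> bsets M" using F(1) assms(2) by blast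
  moreover have "disjoint_family (\<lambda>i. F i \<inter> Y)"
    using F(2) unfolding disjoint_family_on_def by blast
  ultimately have "(\<lambda>i. m (F i \<inter> Y)) sums m (\<Union>i. F i \<inter> Y)"
    using assms(1) unfolding fmeas_def by blast
  then show "(\<lambda>i. m (F i \<inter> Y)) sums m ((\<Union>i. F i) \<inter> Y)" by simp
qed

lemma fmeas_nonneg: "fmeas M m \<Longrightarrow> A \<in> bsets M \<Longrightarrow> 0 \<le> m A"
  by (simp add: fmeas_def)

lemma fmeas_mono: "fmeas M m \<Longrightarrow> A \<in> bsets M \<Longrightarrow> B \<in> bsets M \<Longrightarrow> A \<subseteq> B \<Longrightarrow> m A \<le> m B"
  using finite_measure.finite_measure_mono[OF finite_measure_mk, of M m A B] by (simp add: measure_mk)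

lemma fmeas_Un:
  assumes "fmeas M m" "A \<in> bsets M" "B \<in> bsets M" "A \<inter> B = {}"
  shows "m (A \<union> B) = m A + m B"
proof -
  interpret sigma_algebra "cms_bar M" "bsets M" by (rule sigma_algebra_bsets)
  have "A \<union> B \<in> bsets M" using assms by blast
  then show ?thesis
    using finite_measure.finite_measure_Union[OF finite_measure_mk[OF assms(1)], of A B] assms
    by (simp add: measure_mk)
qed

lemma fmeas_split:
  assumes "fmeas M m" "A \<in> bsets M" "B \<in> bsets M"
  shows "m A = m (A \<inter> B) + m (A - B)"
proof -
  interpret sigma_algebra "cms_bar M" "bsets M" by (rule sigma_algebra_bsets)
  have "m ((A \<inter> B) \<union> (A - B)) = m (A \<inter> B) + m (A - B)"
    by (rule fmeas_Un[OF assms(1)]) (use assms in blast)+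
  then show ?thesis by (simp add: Int_Diff_Un)
qed

subsection \<open>Clopen sets\<close>

text \<open>
  The sets that are unions of cells of one level; they are clopen.
\<close>

definition clop :: "(nat \<Rightarrow> nat \<Rightarrow> nat) \<Rightarrow> (nat \<Rightarrow> enat) set set" where
  "clop M = {A. A \<subseteq> cms_bar M \<and>
     (\<exists>k. \<forall>x\<in>cms_bar M. \<forall>y\<in>cms_bar M. pre k x = pre k y \<longrightarrow> x \<in> A \<longrightarrow> y \<in> A)}"

lemma clopI:
  assumes "A \<subseteq> cms_bar M"
    and "\<And>x y. x \<in> A \<Longrightarrow> x \<in> cms_bar M \<Longrightarrow> y \<in> cms_bar M \<Longrightarrow> pre k y = pre k x \<Longrightarrow> y \<in> A"
  shows "A \<in> clop M"
  unfolding clop_def using assms by (intro CollectI conjI exI[of _ k]) auto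

lemma clopE:
  assumes "A \<in> clop M"
  obtains k where "A \<subseteq> cms_bar M"
    "\<forall>n x y. k \<le> n \<longrightarrow> x \<in> A \<longrightarrow> y \<in> cms_bar M \<longrightarrow> pre n y = pre n x \<longrightarrow> y \<in> A"
proof -
  obtain k where A: "A \<subseteq> cms_bar M"
    and k: "\<And>x y. x \<in> cms_bar M \<Longrightarrow> y \<in> cms_bar M \<Longrightarrow> pre k x = pre k y \<Longrightarrow> x \<in> A \<Longrightarrow> y \<in> A"
    using assms unfolding clop_def by blast
  show ?thesis
  proof (rule that[OF A], intro allI impI)
    fix n x y assume "k \<le> n" "x \<in> A" "y \<in> cms_bar M" "pre n y = pre n x"
    then show "y \<in> A" using k[of x y] pre_mono[of n y x k] A by auto
  qed
qed

lemma clop_open: "A \<in> clop M \<Longrightarrow> openin (cms_bar_top M) A"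
  unfolding openin_cms_bar_iff by (erule clopE) blast

lemma clop_Diff:
  assumes "A \<in> clop M" shows "cms_bar M - A \<in> clop M"
  using assms
proof (rule clopE)
  fix k assume k: "\<forall>n x y. k \<le> n \<longrightarrow> x \<in> A \<longrightarrow> y \<in> cms_bar M \<longrightarrow> pre n y = pre n x \<longrightarrow> y \<in> A"
  show "cms_bar M - A \<in> clop M"
  proof (rule clopI[of _ _ k])
    fix x y assume "x \<in> cms_bar M - A" "y \<in> cms_bar M" "pre k y = pre k x"
    then show "y \<in> cms_bar M - A" using k[rule_format, of k y x] by auto
  qed blast
qed

lemma clop_Un:
  assumes "A \<in> clop M" "B \<in> clop M" shows "A \<union> B \<in> clop M"
proof -
  obtain k where k: "A \<subseteq> cms_bar M"
    "\<forall>n x y. k \<le> n \<longrightarrow> x \<in> A \<longrightarrow> y \<in> cms_bar M \<longrightarrow> pre n y = pre n x \<longrightarrow> y \<in> A"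
    using assms(1) by (rule clopE)
  obtain l where l: "B \<subseteq> cms_bar M"
    "\<forall>n x y. l \<le> n \<longrightarrow> x \<in> B \<longrightarrow> y \<in> cms_bar M \<longrightarrow> pre n y = pre n x \<longrightarrow> y \<in> B"
    using assms(2) by (rule clopE)
  show ?thesis
  proof (rule clopI[of _ _ "max k l"])
    fix x y assume *: "x \<in> A \<union> B" "y \<in> cms_bar M" "pre (max k l) y = pre (max k l) x"
    then show "y \<in> A \<union> B" using k(2)[rule_format, of "max k l" x y] l(2)[rule_format, of "max k l" x y] by auto
  qed (use k l in auto)
qed

lemma clop_empty: "{} \<in> clop M"
  by (rule clopI) auto

lemma algebra_clop: "algebra (cms_bar M) (clop M)"
  unfolding algebra_iff_Un
  using clop_Diff clop_Un clop_empty by (auto simp: clop_def)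

lemma cell_clop: "cell M w \<in> clop M"
  by (rule clopI[of _ _ "length w"]) (auto simp: cell_def)

lemma clop_bsets: "A \<in> clop M \<Longrightarrow> A \<in> bsets M"
  by (intro open_in_bsets clop_open)

lemma cell_bsets: "cell M w \<in> bsets M"
  by (intro clop_bsets cell_clop)

lemma cell_Nil: "cell M [] = cms_bar M"
  by (auto simp: cell_def pre_def)

lemma shift_vimage_clop:
  assumes "A \<in> clop M" shows "shift -` A \<inter> cms_bar M \<in> clop M"
proof -
  obtain k where k: "A \<subseteq> cms_bar M"
    "\<forall>n x y. k \<le> n \<longrightarrow> x \<in> A \<longrightarrow> y \<in> cms_bar M \<longrightarrow> pre n y = pre n x \<longrightarrow> y \<in> A"
    using assms by (rule clopE)
  show ?thesis
  proof (rule clopI[of _ _ "Suc k"])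
    fix x y assume *: "x \<in> shift -` A \<inter> cms_bar M" "y \<in> cms_bar M" "pre (Suc k) y = pre (Suc k) x"
    have "pre k (shift y) = pre k (shift x)" using pre_shift_cong[OF *(3), of 1 k] by simp
    then show "y \<in> shift -` A \<inter> cms_bar M"
      using k(2)[rule_format, of k "shift x" "shift y"] * shift_cms_bar[of y] by auto
  qed auto
qed

subsection \<open>Generation by cells\<close>

lemma open_UN_cells:
  assumes "openin (cms_bar_top M) U"
  shows "U = \<Union> (cell M ` {w. cell M w \<subseteq> U})"
proof (intro equalityI subsetI)
  fix x assume x: "x \<in> U"
  obtain m where m: "\<forall>y\<in>cms_bar M. pre m y = pre m x \<longrightarrow> y \<in> U" using openin_cms_barD[OF assms x] by blast
  have "x \<in> cms_bar M" using openin_subset[OF assms] x by auto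
  then have "x \<in> cell M (pre m x)" "cell M (pre m x) \<subseteq> U" using m by (auto simp: cell_def)
  then show "x \<in> \<Union> (cell M ` {w. cell M w \<subseteq> U})" by blast
qed blast

lemma bsets_eq_cells: "bsets M = sigma_sets (cms_bar M) (insert {} (range (cell M)))"
proof -
  have sub: "insert {} (range (cell M)) \<subseteq> Pow (cms_bar M)" by (auto simp: cell_def)
  interpret G: sigma_algebra "cms_bar M" "sigma_sets (cms_bar M) (insert {} (range (cell M)))"
    by (rule sigma_algebra_sigma_sets[OF sub])
  have "U \<in> sigma_sets (cms_bar M) (insert {} (range (cell M)))" if "openin (cms_bar_top M) U" for U
  proof (subst open_UN_cells[OF that], rule G.countable_Union)
    show "countable (cell M ` {w. cell M w \<subseteq> U})" by simp
    show "cell M ` {w. cell M w \<subseteq> U} \<subseteq> sigma_sets (cms_bar M) (insert {} (range (cell M)))"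
      by (auto intro: sigma_sets.Basic)
  qed
  then have "bsets M \<subseteq> sigma_sets (cms_bar M) (insert {} (range (cell M)))"
    unfolding bsets_def by (intro sigma_sets_mono) auto
  moreover have "sigma_sets (cms_bar M) (insert {} (range (cell M))) \<subseteq> bsets M"
    unfolding bsets_def using clop_open[OF cell_clop]
    by (intro sigma_sets_mono subsetI) (auto intro: sigma_sets.Basic sigma_sets.Empty)
  ultimately show ?thesis by blast
qed

lemma cell_Int_cell:
  assumes "length v \<le> length w" shows "cell M v \<inter> cell M w = cell M w \<or> cell M v \<inter> cell M w = {}"
proof (cases "cell M v \<inter> cell M w = {}")
  case False
  then obtain x where x: "x \<in> cms_bar M" "pre (length v) x = v" "pre (length w) x = w"
    by (auto simp: cell_def)
  have "cell M w \<subseteq> cell M v"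
  proof
    fix y assume y: "y \<in> cell M w"
    then have "pre (length w) y = pre (length w) x" using x by (simp add: cell_def)
    then have "pre (length v) y = pre (length v) x" using assms by (rule pre_mono)
    then show "y \<in> cell M v" using y x by (simp add: cell_def)
  qed
  then show ?thesis by blast
qed simp

lemma Int_stable_cells: "Int_stable (insert {} (range (cell M)))"
proof (rule Int_stableI)
  have *: "cell M v \<inter> cell M w \<in> insert {} (range (cell M))" if "length v \<le> length w" for v w
    using cell_Int_cell[OF that, of M] by auto
  fix A B assume "A \<in> insert {} (range (cell M))" "B \<in> insert {} (range (cell M))"
  then consider "A \<inter> B = {}" | v w where "A = cell M v" "B = cell M w" by blast
  then show "A \<inter> B \<in> insert {} (range (cell M))"
  proof cases
    case (2 v w)
    then show ?thesis using *[of v w] *[of w v] by (cases "length v \<le> length w") (auto simp: Int_commute)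
  qed simp
qed

text \<open>
  The cells, together with the empty set, generate the Borel sets and are stable under intersection,
  so that Dynkin's theorem applies.
\<close>

lemma bsets_induct [consumes 1, case_names cell empty compl union]:
  assumes "A \<in> bsets M"
    and "\<And>w. P (cell M w)" "P {}"
    and "\<And>A. A \<in> bsets M \<Longrightarrow> P A \<Longrightarrow> P (cms_bar M - A)"
    and "\<And>A. disjoint_family A \<Longrightarrow> range A \<subseteq> bsets M \<Longrightarrow> (\<And>i. P (A i)) \<Longrightarrow> P (\<Union>i::nat. A i)"
  shows "P A"
proof (rule sigma_sets_induct_disjoint[OF Int_stable_cells[of M]])
  show "insert {} (range (cell M)) \<subseteq> Pow (cms_bar M)" by (auto simp: cell_def)
  show "A \<in> sigma_sets (cms_bar M) (insert {} (range (cell M)))" using assms(1) bsets_eq_cells by blast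
qed (use assms(2-) in \<open>auto simp: bsets_eq_cells[symmetric]\<close>)

lemma fmeas_compl:
  assumes "fmeas M m" "A \<in> bsets M"
  shows "m (cms_bar M - A) = m (cms_bar M) - m A"
  using fmeas_split[OF assms(1) space_bsets assms(2)] bsets_subset[OF assms(2)] by (simp add: Int_absorb1)

lemma fmeas_eq:
  assumes "fmeas M m1" "fmeas M m2" "\<And>w. m1 (cell M w) = m2 (cell M w)" "A \<in> bsets M"
  shows "m1 A = m2 A"
  using assms(4)
proof (induction rule: bsets_induct)
  case (compl A)
  then show ?case
    using fmeas_compl[OF assms(1) compl(1)] fmeas_compl[OF assms(2) compl(1)] assms(3)[of "[]"]
    by (simp add: cell_Nil)
next
  case (union A)
  then have "(\<lambda>i. m1 (A i)) sums m1 (\<Union>i. A i)" "(\<lambda>i. m2 (A i)) sums m2 (\<Union>i. A i)"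
    using assms(1,2) unfolding fmeas_def by blast+
  then show ?case using union(3) sums_unique2 by simp
qed (simp_all add: assms(3) fmeas_empty[OF assms(1)] fmeas_empty[OF assms(2)])

lemma shift_vimage_bsets: "A \<in> bsets M \<Longrightarrow> shift -` A \<inter> cms_bar M \<in> bsets M"
proof (induction rule: bsets_induct)
  interpret sigma_algebra "cms_bar M" "bsets M" by (rule sigma_algebra_bsets)
  {
    case (cell w)
    show ?case by (intro clop_bsets shift_vimage_clop cell_clop)
  next
    case empty
    show ?case by simp
  next
    case (compl A)
    have "shift -` (cms_bar M - A) \<inter> cms_bar M = cms_bar M - (shift -` A \<inter> cms_bar M)"
      using shift_cms_bar by auto
    then show ?case using compl by auto
  next
    case (union A)
    have "shift -` (\<Union>i. A i) \<inter> cms_bar M = (\<Union>i. shift -` A i \<inter> cms_bar M)" by auto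
    moreover have "(\<Union>i. shift -` A i \<inter> cms_bar M) \<in> bsets M"
      using union(3) by (intro countable_nat_UN) blast
    ultimately show ?case by (simp only:)
  }
qed

subsection \<open>Invariant measures\<close>

text \<open>
  Finite shift-invariant measures.
\<close>

definition inv_fun :: "(nat \<Rightarrow> nat \<Rightarrow> nat) \<Rightarrow> ((nat \<Rightarrow> enat) set \<Rightarrow> real) \<Rightarrow> bool" where
  "inv_fun M m \<longleftrightarrow> fmeas M m \<and> (\<forall>A\<in>bsets M. m (shift -` A \<inter> cms_bar M) = m A)"

lemma inv_fun_of_cells:
  assumes "fmeas M m" "\<And>w. m (shift -` cell M w \<inter> cms_bar M) = m (cell M w)"
  shows "inv_fun M m"
  unfolding inv_fun_def
proof (intro conjI ballI assms(1))
  fix A assume "A \<in> bsets M"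
  then show "m (shift -` A \<inter> cms_bar M) = m A"
  proof (induction rule: bsets_induct)
    case (compl A)
    have "shift -` (cms_bar M - A) \<inter> cms_bar M = cms_bar M - (shift -` A \<inter> cms_bar M)"
      using shift_cms_bar by auto
    then show ?case
      using compl fmeas_compl[OF assms(1)] shift_vimage_bsets by simp
  next
    case (union A)
    have "range (\<lambda>i. shift -` A i \<inter> cms_bar M) \<subseteq> bsets M" using union(2) shift_vimage_bsets by blast
    moreover have "disjoint_family (\<lambda>i. shift -` A i \<inter> cms_bar M)"
      using union(1) unfolding disjoint_family_on_def by blast
    ultimately have "(\<lambda>i. m (shift -` A i \<inter> cms_bar M)) sums m (\<Union>i. shift -` A i \<inter> cms_bar M)"
      using assms(1) unfolding fmeas_def by blast
    moreover have "(\<lambda>i. m (A i)) sums m (\<Union>i. A i)"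
      using assms(1) union unfolding fmeas_def by blast
    moreover have "shift -` (\<Union>i. A i) \<inter> cms_bar M = (\<Union>i. shift -` A i \<inter> cms_bar M)" by auto
    ultimately show ?case using union(3) sums_unique2 by simp
  qed (simp_all add: assms(2) fmeas_empty[OF assms(1)])
qed

lemma inv_bar_iff:
  "\<mu> \<in> inv_bar M \<longleftrightarrow> prob_space \<mu> \<and> space \<mu> = cms_bar M \<and> sets \<mu> = bsets M \<and>
     (\<forall>A\<in>bsets M. emeasure \<mu> (shift -` A \<inter> cms_bar M) = emeasure \<mu> A)"
proof -
  have "emeasure \<mu> (shift -` A \<inter> space \<mu>) = emeasure \<mu> (shift -` A \<inter> cms_bar M)"
    if "space \<mu> = cms_bar M" for A using that by simp
  then show ?thesis
    unfolding inv_bar_def invariant_measures_def borel_prob_def bsets_def mem_Collect_eq topspace_cms_bar_top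
    by metis
qed

lemma inv_fun_measure:
  assumes "\<mu> \<in> inv_bar M"
  shows "inv_fun M (measure \<mu>)" "measure \<mu> (cms_bar M) = 1"
proof -
  interpret prob_space \<mu> using assms by (simp add: inv_bar_iff)
  show "inv_fun M (measure \<mu>)"
    unfolding inv_fun_def
  proof (intro conjI ballI)
    show "fmeas M (measure \<mu>)"
      using assms by (intro fmeas_measure[OF finite_measure_axioms]) (simp add: inv_bar_iff)
    show "measure \<mu> (shift -` A \<inter> cms_bar M) = measure \<mu> A" if "A \<in> bsets M" for A
      using assms that by (simp add: inv_bar_iff measure_def)
  qed
  show "measure \<mu> (cms_bar M) = 1" using prob_space assms by (simp add: inv_bar_iff)
qed

lemma mk_inv_bar:
  assumes "inv_fun M m" "m (cms_bar M) = 1"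
  shows "mk M m \<in> inv_bar M"
proof -
  have f: "fmeas M m" using assms by (simp add: inv_fun_def)
  have "prob_space (mk M m)"
    by (rule prob_spaceI) (simp add: emeasure_mk[OF f space_bsets] assms(2))
  moreover have "emeasure (mk M m) (shift -` A \<inter> cms_bar M) = emeasure (mk M m) A" if "A \<in> bsets M" for A
    using assms(1) that by (simp add: emeasure_mk[OF f] shift_vimage_bsets inv_fun_def)
  ultimately show ?thesis unfolding inv_bar_iff by simp
qed

lemma inv_bar_eqI:
  assumes "\<mu> \<in> inv_bar M" "\<nu> \<in> inv_bar M" "\<And>w. measure \<mu> (cell M w) = measure \<nu> (cell M w)"
  shows "\<mu> = \<nu>"
proof (rule measure_eqI)
  interpret \<mu>: prob_space \<mu> using assms by (simp add: inv_bar_iff)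
  interpret \<nu>: prob_space \<nu> using assms by (simp add: inv_bar_iff)
  show "sets \<mu> = sets \<nu>" using assms by (simp add: inv_bar_iff)
  fix A assume "A \<in> sets \<mu>"
  then have A: "A \<in> bsets M" using assms(1) by (simp add: inv_bar_iff)
  have "fmeas M (measure \<mu>)" "fmeas M (measure \<nu>)"
    using assms inv_fun_measure(1) inv_fun_def by blast+
  then have "measure \<mu> A = measure \<nu> A" using assms(3) A by (rule fmeas_eq)
  then show "emeasure \<mu> A = emeasure \<nu> A" by (simp add: \<mu>.emeasure_eq_measure \<nu>.emeasure_eq_measure)
qed

lemma inv_fun_add: "inv_fun M m1 \<Longrightarrow> inv_fun M m2 \<Longrightarrow> inv_fun M (\<lambda>A. m1 A + m2 A)"
  unfolding inv_fun_def using fmeas_add by simp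

lemma inv_fun_scale: "inv_fun M m \<Longrightarrow> 0 \<le> c \<Longrightarrow> inv_fun M (\<lambda>A. c * m A)"
  unfolding inv_fun_def using fmeas_scale by simp

lemma inv_fun_diff:
  "inv_fun M m1 \<Longrightarrow> inv_fun M m2 \<Longrightarrow> (\<And>A. A \<in> bsets M \<Longrightarrow> m2 A \<le> m1 A) \<Longrightarrow> inv_fun M (\<lambda>A. m1 A - m2 A)"
  unfolding inv_fun_def using fmeas_diff by simp


subsection \<open>Decomposition into cells\<close>

text \<open>
  The collapsed prefixes of level \<open>k\<close> that occur in the compactification; their cells partition it.
\<close>

definition words :: "(nat \<Rightarrow> nat \<Rightarrow> nat) \<Rightarrow> nat \<Rightarrow> nat list set" where
  "words M k = pre k ` cms_bar M"

lemma finite_words: "finite (words M k)"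
  unfolding words_def using finite_range_pre by (rule finite_subset[rotated]) auto

lemma length_words: "w \<in> words M k \<Longrightarrow> length w = k"
  by (auto simp: words_def)

lemma fmeas_cells:
  assumes "fmeas M m" "A \<in> bsets M"
  shows "m A = (\<Sum>w\<in>words M k. m (A \<inter> cell M w))"
proof -
  interpret sigma_algebra "cms_bar M" "bsets M" by (rule sigma_algebra_bsets)
  have sets: "A \<inter> cell M w \<in> bsets M" for w using assms(2) cell_bsets by blast
  have "A = (\<Union>w\<in>words M k. A \<inter> cell M w)"
    using bsets_subset[OF assms(2)] by (fastforce simp: words_def cell_def)
  moreover have "measure (mk M m) (\<Union>w\<in>words M k. A \<inter> cell M w)
      = (\<Sum>w\<in>words M k. measure (mk M m) (A \<inter> cell M w))"
    by (rule finite_measure.finite_measure_finite_Union[OF finite_measure_mk[OF assms(1)] finite_words])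
      (use sets length_words in \<open>auto simp: disjoint_family_on_def cell_def\<close>)
  ultimately show ?thesis using sets assms by (simp add: measure_mk)
qed

lemma fmeas_clop:
  assumes "A \<in> clop M"
  shows "\<exists>k. \<forall>m. fmeas M m \<longrightarrow> m A = (\<Sum>w\<in>{w\<in>words M k. cell M w \<subseteq> A}. m (cell M w))"
proof -
  obtain k where k: "A \<subseteq> cms_bar M"
    "\<forall>n x y. k \<le> n \<longrightarrow> x \<in> A \<longrightarrow> y \<in> cms_bar M \<longrightarrow> pre n y = pre n x \<longrightarrow> y \<in> A"
    using assms by (rule clopE)
  have "m A = (\<Sum>w\<in>{w\<in>words M k. cell M w \<subseteq> A}. m (cell M w))" if m: "fmeas M m" for m
  proof -
    have "m (A \<inter> cell M w) = (if cell M w \<subseteq> A then m (cell M w) else 0)" if w: "w \<in> words M k" for w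
    proof (cases "cell M w \<subseteq> A")
      case False
      have "A \<inter> cell M w = {}"
      proof (rule ccontr)
        assume "A \<inter> cell M w \<noteq> {}"
        then obtain x where "x \<in> A" "pre k x = w" using length_words[OF w] by (auto simp: cell_def)
        then have "cell M w \<subseteq> A" using k(2)[rule_format, of k x] length_words[OF w] by (auto simp: cell_def)
        then show False using False by simp
      qed
      then show ?thesis using False fmeas_empty[OF m] by simp
    qed (simp add: Int_absorb1)
    then show ?thesis
      using fmeas_cells[OF m clop_bsets[OF assms], of k] finite_words[of M k]
      by (simp add: sum.inter_filter)
  qed
  then show ?thesis by blast
qed


section \<open>Limits of invariant measures\<close>

lemma bsets_eq_clop: "sigma_sets (cms_bar M) (clop M) = bsets M"
proof
  show "sigma_sets (cms_bar M) (clop M) \<subseteq> bsets M"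
    unfolding bsets_def using clop_open by (intro sigma_sets_mono subsetI sigma_sets.Basic) blast
  show "bsets M \<subseteq> sigma_sets (cms_bar M) (clop M)"
    unfolding bsets_eq_cells using cell_clop clop_empty
    by (intro sigma_sets_mono subsetI sigma_sets.Basic) blast
qed

text \<open>
  This is where compactness enters the construction of limit measures.
\<close>

lemma decseq_clop_empty:
  assumes A: "range A \<subseteq> clop M" "decseq A" "(\<Inter>i::nat. A i) = {}"
  shows "\<exists>N. \<forall>n\<ge>N. A n = {}"
proof -
  define V where "V i = cms_bar M - A i" for i
  have "openin (cms_bar_top M) U" if U_V: "U \<in> range V" for U
  proof -
    obtain i where U: "U = V i" using U_V by blast
    have "A i \<in> clop M" using A(1) by blast
    then show ?thesis unfolding U V_def by (intro clop_open clop_Diff)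
  qed
  moreover have "topspace (cms_bar_top M) \<subseteq> \<Union> (range V)" using A(3) by (auto simp: V_def)
  ultimately obtain \<F> where \<F>: "finite \<F>" "\<F> \<subseteq> range V" "topspace (cms_bar_top M) \<subseteq> \<Union>\<F>"
    using compact_space_cms_bar[of M, unfolded compact_space_alt, rule_format, of "range V"] by blast
  obtain F where F: "finite F" "\<F> = V ` F" using finite_subset_image[OF \<F>(1,2)] by blast
  define N where "N = Max (insert 0 F)"
  have "A n = {}" if n: "N \<le> n" for n
  proof (rule ccontr)
    assume "A n \<noteq> {}"
    then obtain x where x: "x \<in> A n" by blast
    have "A n \<subseteq> cms_bar M" using A(1) by (auto simp: clop_def)
    then have "x \<in> \<Union>\<F>" using x \<F>(3) by auto
    then obtain i where i: "i \<in> F" "x \<in> V i" using F(2) by blast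
    have "i \<le> N" using i(1) F(1) by (simp add: N_def)
    then have "A n \<subseteq> A i" using A(2) n by (simp add: decseq_def)
    then show False using x i(2) by (auto simp: V_def)
  qed
  then show ?thesis by blast
qed

text \<open>
  If the values of invariant probability measures converge on each cell, then the limits are the cell
  values of an invariant probability measure.
\<close>

lemma limit_measure:
  fixes m :: "nat \<Rightarrow> (nat \<Rightarrow> enat) set \<Rightarrow> real"
  assumes m: "\<And>n. inv_fun M (m n)" "\<And>n. m n (cms_bar M) = 1"
    and conv: "\<And>w. convergent (\<lambda>n. m n (cell M w))"
  obtains m' where "inv_fun M m'" "m' (cms_bar M) = 1"
    "\<And>w. (\<lambda>n. m n (cell M w)) \<longlonglongrightarrow> m' (cell M w)"
proof -
  have fm: "fmeas M (m n)" for n using m(1) by (simp add: inv_fun_def)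
  define \<nu> where "\<nu> A = lim (\<lambda>n. m n A)" for A
  have lim: "(\<lambda>n. m n A) \<longlonglongrightarrow> \<nu> A" if A: "A \<in> clop M" for A
  proof -
    obtain k where k: "\<forall>m. fmeas M m \<longrightarrow> m A = (\<Sum>w\<in>{w\<in>words M k. cell M w \<subseteq> A}. m (cell M w))"
      using fmeas_clop[OF A] by blast
    have "(\<lambda>n. \<Sum>w\<in>{w\<in>words M k. cell M w \<subseteq> A}. m n (cell M w))
        \<longlonglongrightarrow> (\<Sum>w\<in>{w\<in>words M k. cell M w \<subseteq> A}. lim (\<lambda>n. m n (cell M w)))"
      using conv by (intro tendsto_sum) (simp add: convergent_LIMSEQ_iff)
    then have L: "(\<lambda>n. m n A) \<longlonglongrightarrow> (\<Sum>w\<in>{w\<in>words M k. cell M w \<subseteq> A}. lim (\<lambda>n. m n (cell M w)))"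
      using k[rule_format, OF fm] by simp
    have "\<nu> A = (\<Sum>w\<in>{w\<in>words M k. cell M w \<subseteq> A}. lim (\<lambda>n. m n (cell M w)))"
      unfolding \<nu>_def by (rule limI[OF L])
    then show ?thesis using L by simp
  qed
  have nonneg: "0 \<le> \<nu> A" if "A \<in> clop M" for A
  proof -
    have "0 \<le> m n A" for n using fm[of n] clop_bsets[OF that] by (simp add: fmeas_def)
    then show ?thesis by (intro LIMSEQ_le_const[OF lim[OF that]]) blast
  qed
  interpret algebra "cms_bar M" "clop M" by (rule algebra_clop)
  have "\<exists>\<mu>. (\<forall>s\<in>clop M. \<mu> s = ennreal (\<nu> s)) \<and> measure_space (cms_bar M) (sigma_sets (cms_bar M) (clop M)) \<mu>"
  proof (rule caratheodory_empty_continuous)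
    have "(\<lambda>n. m n {}) \<longlonglongrightarrow> 0" using fmeas_empty[OF fm] by simp
    then have "\<nu> {} = 0" using lim[OF clop_empty] LIMSEQ_unique by blast
    then show "positive (clop M) (\<lambda>A. ennreal (\<nu> A))" by (simp add: positive_def)
    show "additive (clop M) (\<lambda>A. ennreal (\<nu> A))"
      unfolding additive_def
    proof (intro ballI impI)
      fix A B assume AB: "A \<in> clop M" "B \<in> clop M" "A \<inter> B = {}"
      have "(\<lambda>n. m n (A \<union> B)) \<longlonglongrightarrow> \<nu> A + \<nu> B"
        unfolding fmeas_Un[OF fm clop_bsets[OF AB(1)] clop_bsets[OF AB(2)] AB(3)]
        by (intro tendsto_add lim AB)
      then have "\<nu> (A \<union> B) = \<nu> A + \<nu> B" using lim[OF clop_Un[OF AB(1,2)]] LIMSEQ_unique by blast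
      then show "ennreal (\<nu> (A \<union> B)) = ennreal (\<nu> A) + ennreal (\<nu> B)"
        using nonneg AB by (simp add: ennreal_plus)
    qed
    fix A :: "nat \<Rightarrow> _" assume A: "range A \<subseteq> clop M" "decseq A" "(\<Inter>i. A i) = {}"
    then obtain N where "\<forall>n\<ge>N. A n = {}" using decseq_clop_empty by blast
    then have "\<forall>\<^sub>F n in sequentially. ennreal (\<nu> (A n)) = 0"
      unfolding eventually_sequentially using \<open>\<nu> {} = 0\<close> by (intro exI[of _ N]) simp
    then show "(\<lambda>n. ennreal (\<nu> (A n))) \<longlonglongrightarrow> 0" by (rule tendsto_eventually)
  qed simp
  then obtain \<mu> where \<mu>: "\<And>A. A \<in> clop M \<Longrightarrow> \<mu> A = ennreal (\<nu> A)"
    and ms: "measure_space (cms_bar M) (bsets M) \<mu>"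
    unfolding bsets_eq_clop by blast
  define N where "N = measure_of (cms_bar M) (bsets M) \<mu>"
  have sN: "sets N = bsets M"
    unfolding N_def by (rule sigma_algebra.sets_measure_of_eq[OF sigma_algebra_bsets])
  have spN: "space N = cms_bar M"
    unfolding N_def using bsets_subset by (intro space_measure_of subsetI) blast
  have eN: "emeasure N A = \<mu> A" if "A \<in> bsets M" for A
    unfolding N_def using ms that unfolding measure_space_def
    by (intro emeasure_measure_of_sigma) auto
  have space_clop: "cms_bar M \<in> clop M" using cell_clop[of M "[]"] by (simp add: cell_Nil)
  have nu1: "\<nu> (cms_bar M) = 1"
    using lim[OF space_clop] m(2) by (simp add: LIMSEQ_const_iff)
  have "finite_measure N"
    by (rule finite_measureI) (simp add: spN eN space_bsets \<mu>[OF space_clop])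
  then have fN: "fmeas M (measure N)" using sN by (rule fmeas_measure)
  have mN: "measure N A = \<nu> A" if "A \<in> clop M" for A
    unfolding measure_def using eN[OF clop_bsets[OF that]] \<mu>[OF that] nonneg[OF that] by simp
  have "inv_fun M (measure N)"
  proof (rule inv_fun_of_cells[OF fN])
    fix w
    have "(\<lambda>n. m n (shift -` cell M w \<inter> cms_bar M)) \<longlonglongrightarrow> \<nu> (shift -` cell M w \<inter> cms_bar M)"
      by (intro lim shift_vimage_clop cell_clop)
    moreover have "m n (shift -` cell M w \<inter> cms_bar M) = m n (cell M w)" for n
      using m(1)[of n] cell_bsets[of M w] by (simp add: inv_fun_def)
    ultimately have "(\<lambda>n. m n (cell M w)) \<longlonglongrightarrow> \<nu> (shift -` cell M w \<inter> cms_bar M)" by simp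
    then have "\<nu> (shift -` cell M w \<inter> cms_bar M) = \<nu> (cell M w)"
      using lim[OF cell_clop] by (rule LIMSEQ_unique)
    then show "measure N (shift -` cell M w \<inter> cms_bar M) = measure N (cell M w)"
      by (simp add: mN cell_clop shift_vimage_clop)
  qed
  then show ?thesis using that[of "measure N"] mN[OF space_clop] nu1 lim[OF cell_clop] mN[OF cell_clop] by simp
qed


section \<open>The affine embedding into the space of bounded sequences\<close>

text \<open>
  Coordinate \<open>k\<close> is the measure of the \<open>k\<close>-th cell, for an enumeration of all words.  The weights
  \<open>(1/2) ^ k\<close> make convergence in the supremum norm the same, for probability measures, as convergence
  on each cell.
\<close>

definition emb :: "(nat \<Rightarrow> nat \<Rightarrow> nat) \<Rightarrow> ((nat \<Rightarrow> enat) set \<Rightarrow> real) \<Rightarrow> (nat \<Rightarrow>\<^sub>C real)" where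
  "emb M m = Bcontfun (\<lambda>k. (1/2) ^ k * m (cell M (from_nat k)))"

lemma cell_le: "fmeas M m \<Longrightarrow> 0 \<le> m (cell M w) \<and> m (cell M w) \<le> m (cms_bar M)"
  using fmeas_mono[of M m "cell M w" "cms_bar M"] cell_bsets space_bsets
  by (auto simp: fmeas_def cell_def)

lemma emb_apply:
  assumes "fmeas M m"
  shows "apply_bcontfun (emb M m) k = (1/2) ^ k * m (cell M (from_nat k))"
proof -
  have "(\<lambda>k. (1/2) ^ k * m (cell M (from_nat k))) \<in> bcontfun"
  proof (rule bcontfun_normI)
    fix k :: nat
    have "(1/2::real) ^ k \<le> 1" by (simp add: power_le_one)
    then have "(1/2::real) ^ k * m (cell M (from_nat k)) \<le> 1 * m (cms_bar M)"
      using cell_le[OF assms, of "from_nat k"] by (intro mult_mono) auto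
    then show "norm ((1/2) ^ k * m (cell M (from_nat k))) \<le> m (cms_bar M)"
      using cell_le[OF assms, of "from_nat k"] by (simp add: abs_mult)
  qed simp
  then show ?thesis unfolding emb_def by (simp add: Bcontfun_inverse)
qed

lemma emb_cell:
  "fmeas M m \<Longrightarrow> m (cell M w) = 2 ^ to_nat w * apply_bcontfun (emb M m) (to_nat w)"
  by (simp add: emb_apply power_one_over field_simps)

lemma emb_cong: "(\<And>w. m1 (cell M w) = m2 (cell M w)) \<Longrightarrow> emb M m1 = emb M m2"
  by (simp add: emb_def)

lemma emb_eqD:
  assumes "fmeas M m1" "fmeas M m2" "emb M m1 = emb M m2" "A \<in> bsets M"
  shows "m1 A = m2 A"
proof (rule fmeas_eq[OF assms(1,2) _ assms(4)])
  show "m1 (cell M w) = m2 (cell M w)" for w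
    unfolding emb_cell[OF assms(1)] emb_cell[OF assms(2)] assms(3) ..
qed

lemma emb_add:
  assumes "fmeas M m1" "fmeas M m2"
  shows "emb M (\<lambda>A. m1 A + m2 A) = emb M m1 + emb M m2"
  by (rule bcontfun_eqI)
    (simp only: emb_apply[OF fmeas_add[OF assms]] emb_apply[OF assms(1)] emb_apply[OF assms(2)]
      plus_bcontfun.rep_eq distrib_left)

lemma emb_scale:
  assumes "fmeas M m" "0 \<le> c"
  shows "emb M (\<lambda>A. c * m A) = c *\<^sub>R emb M m"
  by (rule bcontfun_eqI)
    (simp add: emb_apply[OF fmeas_scale[OF assms]] emb_apply[OF assms(1)] scaleR_bcontfun.rep_eq)

lemma emb_combination:
  assumes f: "fmeas M m1" "fmeas M m2" and c: "0 \<le> c" "0 \<le> d"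
  shows "emb M (\<lambda>A. c * m1 A + d * m2 A) = c *\<^sub>R emb M m1 + d *\<^sub>R emb M m2"
  unfolding emb_add[OF fmeas_scale[OF f(1) c(1)] fmeas_scale[OF f(2) c(2)]]
    emb_scale[OF f(1) c(1)] emb_scale[OF f(2) c(2)] ..

lemma emb_diff:
  assumes "fmeas M m1" "fmeas M m2" "\<And>A. A \<in> bsets M \<Longrightarrow> m2 A \<le> m1 A"
  shows "emb M (\<lambda>A. m1 A - m2 A) = emb M m1 - emb M m2"
  by (rule bcontfun_eqI)
    (simp only: emb_apply[OF fmeas_diff[OF assms]] emb_apply[OF assms(1)] emb_apply[OF assms(2)]
      minus_bcontfun.rep_eq right_diff_distrib)

text \<open>
  Invariant probability measures, as set functions.
\<close>

definition prob_funs :: "(nat \<Rightarrow> nat \<Rightarrow> nat) \<Rightarrow> ((nat \<Rightarrow> enat) set \<Rightarrow> real) set" where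
  "prob_funs M = {m. inv_fun M m \<and> m (cms_bar M) = 1}"

lemma prob_funs_fmeas: "m \<in> prob_funs M \<Longrightarrow> fmeas M m"
  by (simp add: prob_funs_def inv_fun_def)

lemma measure_prob_funs: "\<mu> \<in> inv_bar M \<Longrightarrow> measure \<mu> \<in> prob_funs M"
  using inv_fun_measure by (simp add: prob_funs_def)

text \<open>
  The compact convex set that realizes the space of invariant measures.
\<close>

definition image_K :: "(nat \<Rightarrow> nat \<Rightarrow> nat) \<Rightarrow> (nat \<Rightarrow>\<^sub>C real) set" where
  "image_K M = emb M ` prob_funs M"

lemma image_K_eq: "image_K M = (\<lambda>\<mu>. emb M (measure \<mu>)) ` inv_bar M"
proof (intro equalityI subsetI)
  fix z assume "z \<in> image_K M"
  then obtain m where m: "m \<in> prob_funs M" "z = emb M m" by (auto simp: image_K_def)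
  have "emb M m = emb M (measure (mk M m))"
    using measure_mk[OF prob_funs_fmeas[OF m(1)] cell_bsets] by (intro emb_cong) simp
  moreover have "mk M m \<in> inv_bar M" using m(1) by (intro mk_inv_bar) (auto simp: prob_funs_def)
  ultimately show "z \<in> (\<lambda>\<mu>. emb M (measure \<mu>)) ` inv_bar M" using m(2) by blast
qed (use measure_prob_funs in \<open>auto simp: image_K_def\<close>)

lemma inj_emb: "inj_on (\<lambda>\<mu>. emb M (measure \<mu>)) (inv_bar M)"
proof (rule inj_onI)
  fix \<mu> \<nu> assume *: "\<mu> \<in> inv_bar M" "\<nu> \<in> inv_bar M" "emb M (measure \<mu>) = emb M (measure \<nu>)"
  show "\<mu> = \<nu>"
  proof (rule inv_bar_eqI[OF *(1,2)])
    show "measure \<mu> (cell M w) = measure \<nu> (cell M w)" for w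
      by (rule emb_eqD[OF prob_funs_fmeas prob_funs_fmeas *(3) cell_bsets])
        (intro measure_prob_funs *)+
  qed
qed

lemma emb_close:
  assumes "0 < e"
  shows "\<exists>N. \<forall>m1\<in>prob_funs M. \<forall>m2\<in>prob_funs M.
    (\<forall>k\<le>N. \<bar>m1 (cell M (from_nat k)) - m2 (cell M (from_nat k))\<bar> \<le> e) \<longrightarrow>
    dist (emb M m1) (emb M m2) \<le> e"
proof -
  obtain N where N: "(1/2::real) ^ N < e" using real_arch_pow_inv[OF assms, of "1/2"] by auto
  show ?thesis
  proof (intro exI[of _ N] ballI impI)
    fix m1 m2 assume m: "m1 \<in> prob_funs M" "m2 \<in> prob_funs M"
      and close: "\<forall>k\<le>N. \<bar>m1 (cell M (from_nat k)) - m2 (cell M (from_nat k))\<bar> \<le> e"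
    show "dist (emb M m1) (emb M m2) \<le> e"
    proof (rule dist_bound)
      fix k
      let ?d = "\<bar>m1 (cell M (from_nat k)) - m2 (cell M (from_nat k))\<bar>"
      have eq: "dist (apply_bcontfun (emb M m1) k) (apply_bcontfun (emb M m2) k) = (1/2) ^ k * ?d"
        using m by (simp add: emb_apply prob_funs_fmeas dist_real_def abs_mult flip: right_diff_distrib)
      have d1: "?d \<le> 1"
        using cell_le[OF prob_funs_fmeas[OF m(1)], of "from_nat k"]
          cell_le[OF prob_funs_fmeas[OF m(2)], of "from_nat k"] m
        by (auto simp: prob_funs_def)
      show "dist (apply_bcontfun (emb M m1) k) (apply_bcontfun (emb M m2) k) \<le> e"
      proof (cases "k \<le> N")
        case True
        have "(1/2) ^ k * ?d \<le> 1 * e"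
          using close[rule_format, OF True] by (intro mult_mono) (auto simp: power_le_one)
        then show ?thesis using eq by simp
      next
        case False
        then have "(1/2::real) ^ k \<le> (1/2) ^ N" by (intro power_decreasing) auto
        then have "(1/2) ^ k * ?d \<le> (1/2) ^ N * 1" using d1 by (intro mult_mono) auto
        then show ?thesis using eq N by simp
      qed
    qed
  qed
qed

lemma compact_image_K: "compact (image_K M)"
  unfolding compact_eq_seq_compact_metric seq_compact_def
proof (intro allI impI)
  fix f :: "nat \<Rightarrow> nat \<Rightarrow>\<^sub>C real" assume "\<forall>n. f n \<in> image_K M"
  then have "\<forall>n. \<exists>m. m \<in> prob_funs M \<and> f n = emb M m" unfolding image_K_def by blast
  then obtain m where m: "\<And>n. m n \<in> prob_funs M" "\<And>n. f n = emb M (m n)" by metis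
  define S :: "(nat \<Rightarrow> real) set" where "S = PiE UNIV (\<lambda>_. {0..1})"
  have "compactin (product_topology (\<lambda>_::nat. euclideanreal) UNIV) S"
    unfolding S_def compactin_PiE by simp
  then have "compact S" by (simp add: euclidean_product_topology)
  define g where "g n k = m n (cell M (from_nat k))" for n k
  have "g n \<in> S" for n
    using cell_le[OF prob_funs_fmeas[OF m(1)[of n]]] m(1)[of n] by (auto simp: S_def g_def prob_funs_def)
  then obtain l r where r: "strict_mono r" "(g \<circ> r) \<longlonglongrightarrow> l"
    using \<open>compact S\<close> unfolding compact_eq_seq_compact_metric seq_compact_def by meson
  have gl: "(\<lambda>n. g (r n) k) \<longlonglongrightarrow> l k" for k
  proof -
    have "continuous_on UNIV (\<lambda>x::nat \<Rightarrow> real. x k)" by (rule continuous_on_product_coordinates)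
    then show ?thesis
      using continuous_on_tendsto_compose[OF _ r(2), of UNIV "\<lambda>x. x k"] by (simp add: comp_def)
  qed
  have "convergent (\<lambda>n. m (r n) (cell M w))" for w
    using gl[of "to_nat w"] unfolding g_def convergent_def by auto
  moreover have "inv_fun M (m (r n))" "m (r n) (cms_bar M) = 1" for n
    using m(1)[of "r n"] by (auto simp: prob_funs_def)
  ultimately obtain m' where m': "inv_fun M m'" "m' (cms_bar M) = 1"
    "\<And>w. (\<lambda>n. m (r n) (cell M w)) \<longlonglongrightarrow> m' (cell M w)"
    using limit_measure[of M "\<lambda>n. m (r n)"] by blast
  have p': "m' \<in> prob_funs M" using m' by (simp add: prob_funs_def)
  have "(\<lambda>n. emb M (m (r n))) \<longlonglongrightarrow> emb M m'"
  proof (rule metric_LIMSEQ_I)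
    fix e :: real assume e: "0 < e"
    then obtain N where N: "\<forall>m1\<in>prob_funs M. \<forall>m2\<in>prob_funs M.
      (\<forall>k\<le>N. \<bar>m1 (cell M (from_nat k)) - m2 (cell M (from_nat k))\<bar> \<le> e / 2) \<longrightarrow>
      dist (emb M m1) (emb M m2) \<le> e / 2"
      using emb_close[of "e / 2" M] by auto
    have "\<forall>\<^sub>F n in sequentially. \<forall>k\<in>{..N}. dist (m (r n) (cell M (from_nat k))) (m' (cell M (from_nat k))) < e / 2"
      using m'(3) e by (intro eventually_ball_finite ballI tendstoD) auto
    then obtain n0 where n0: "\<And>n k. n0 \<le> n \<Longrightarrow> k \<le> N \<Longrightarrow> \<bar>m (r n) (cell M (from_nat k)) - m' (cell M (from_nat k))\<bar> \<le> e / 2"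
      unfolding eventually_sequentially dist_real_def by force
    have "dist (emb M (m (r n))) (emb M m') < e" if "n0 \<le> n" for n
      using N[rule_format, OF m(1) p'] n0[OF that] e by fastforce
    then show "\<exists>n0. \<forall>n\<ge>n0. dist (emb M (m (r n))) (emb M m') < e" by blast
  qed
  then have "(f \<circ> r) \<longlonglongrightarrow> emb M m'" using m(2) by (simp add: comp_def)
  then show "\<exists>l\<in>image_K M. \<exists>r. strict_mono r \<and> (f \<circ> r) \<longlonglongrightarrow> l"
    using r(1) p' unfolding image_K_def by blast
qed

lemma integral_cell:
  assumes "\<mu> \<in> inv_bar M"
  shows "(\<integral>x. of_bool (pre (length w) x \<in> {w}) \<partial>\<mu>) = measure \<mu> (cell M w)"
proof -
  have "(\<integral>x. of_bool (pre (length w) x \<in> {w}) \<partial>\<mu>) = (\<integral>x. indicator (cell M w) x \<partial>\<mu>)"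
    using assms by (intro Bochner_Integration.integral_cong) (auto simp: inv_bar_iff cell_def indicator_def)
  also have "\<dots> = measure \<mu> (cell M w)"
    using assms cell_bsets[of M w] bsets_subset[OF cell_bsets[of M w]] by (simp add: inv_bar_iff Int_absorb2)
  finally show ?thesis .
qed

lemma continuous_emb: "continuous_map (inv_bar_top M) euclidean (\<lambda>\<mu>. emb M (measure \<mu>))"
  unfolding continuous_map_def
proof (intro conjI allI impI)
  fix U :: "(nat \<Rightarrow>\<^sub>C real) set" assume "openin euclidean U"
  then have "open U" by simp
  have top: "topspace (inv_bar_top M) = inv_bar M" by (simp add: inv_bar_top_def)
  have "\<exists>T. openin (inv_bar_top M) T \<and> \<mu> \<in> T \<and> T \<subseteq> {\<mu> \<in> inv_bar M. emb M (measure \<mu>) \<in> U}"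
    if \<mu>: "\<mu> \<in> inv_bar M" "emb M (measure \<mu>) \<in> U" for \<mu>
  proof -
    obtain e where e: "0 < e" "ball (emb M (measure \<mu>)) e \<subseteq> U"
      using \<open>open U\<close> \<mu>(2) open_contains_ball by blast
    obtain N where N: "\<forall>m1\<in>prob_funs M. \<forall>m2\<in>prob_funs M.
      (\<forall>k\<le>N. \<bar>m1 (cell M (from_nat k)) - m2 (cell M (from_nat k))\<bar> \<le> e / 2) \<longrightarrow>
      dist (emb M m1) (emb M m2) \<le> e / 2"
      using emb_close[of "e / 2" M] e(1) by auto
    define B where "B k = {\<nu> \<in> inv_bar M. (\<integral>x. of_bool (pre (length (from_nat k :: nat list)) x \<in> {from_nat k}) \<partial>\<nu>)
        \<in> ball (measure \<mu> (cell M (from_nat k))) (e / 2)}" for k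
    have B: "openin (inv_bar_top M) (B k)" for k
      unfolding inv_bar_top_def weak_star_def B_def
      by (rule topology_generated_by_Basis) (use continuous_cells[of M] in \<open>blast intro: open_ball\<close>)
    define T where "T = (\<Inter>k\<in>{..N}. B k)"
    have "openin (inv_bar_top M) T"
      unfolding T_def using B by (intro openin_Inter) auto
    moreover have Bin: "B k = {\<nu> \<in> inv_bar M. \<bar>measure \<mu> (cell M (from_nat k)) - measure \<nu> (cell M (from_nat k))\<bar> < e / 2}" for k
      unfolding B_def using integral_cell by (auto simp: dist_real_def)
    have "\<mu> \<in> T" using \<mu>(1) e(1) by (simp add: T_def Bin)
    moreover have "T \<subseteq> {\<mu> \<in> inv_bar M. emb M (measure \<mu>) \<in> U}"
    proof
      fix \<nu> assume "\<nu> \<in> T"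
      then have \<nu>: "\<nu> \<in> inv_bar M"
        "\<And>k. k \<le> N \<Longrightarrow> \<bar>measure \<mu> (cell M (from_nat k)) - measure \<nu> (cell M (from_nat k))\<bar> \<le> e / 2"
        by (auto simp: T_def Bin intro: less_imp_le)
      then have "dist (emb M (measure \<mu>)) (emb M (measure \<nu>)) \<le> e / 2"
        using \<mu>(1) by (intro N[rule_format] measure_prob_funs) auto
      then show "\<nu> \<in> {\<mu> \<in> inv_bar M. emb M (measure \<mu>) \<in> U}" using e \<nu>(1) by auto
    qed
    ultimately show ?thesis by blast
  qed
  then show "openin (inv_bar_top M) {x \<in> topspace (inv_bar_top M). emb M (measure x) \<in> U}"
    unfolding top by (subst openin_subopen) blast
qed simp

lemma integral_approx:
  assumes f: "continuous_map (cms_bar_top M) euclideanreal f" and e: "0 < e"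
  shows "\<exists>k c. \<forall>\<mu>\<in>inv_bar M.
    \<bar>(\<integral>x. f x \<partial>\<mu>) - (\<Sum>w\<in>words M k. c w * measure \<mu> (cell M w))\<bar> \<le> e"
proof -
  obtain k where k: "\<And>x y. x \<in> cms_bar M \<Longrightarrow> y \<in> cms_bar M \<Longrightarrow> pre k x = pre k y \<Longrightarrow> \<bar>f x - f y\<bar> < e"
    using uniform_on_cells[OF f e] by blast
  define c where "c w = f (SOME x. x \<in> cell M w)" for w
  define \<phi> where "\<phi> x = (\<Sum>w\<in>words M k. c w * indicator (cell M w) x)" for x
  have \<phi>: "\<phi> x = c (pre k x)" "\<bar>f x - \<phi> x\<bar> \<le> e" if x: "x \<in> cms_bar M" for x
  proof -
    have "\<phi> x = (\<Sum>w\<in>words M k. if w = pre k x then c w else 0)"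
      unfolding \<phi>_def using x length_words[of _ M k]
      by (intro sum.cong refl) (auto simp: cell_def indicator_def)
    also have "\<dots> = c (pre k x)" using x finite_words[of M k] by (simp add: words_def)
    finally show 1: "\<phi> x = c (pre k x)" .
    have "x \<in> cell M (pre k x)" using x by (simp add: cell_def)
    then have "(SOME y. y \<in> cell M (pre k x)) \<in> cell M (pre k x)"
      by (rule someI[of "\<lambda>y. y \<in> cell M (pre k x)"])
    then have "\<bar>f x - c (pre k x)\<bar> < e" unfolding c_def using x k[of x] by (simp add: cell_def)
    then show "\<bar>f x - \<phi> x\<bar> \<le> e" using 1 by simp
  qed
  show ?thesis
  proof (intro exI ballI)
    fix \<mu> assume \<mu>: "\<mu> \<in> inv_bar M"
    interpret prob_space \<mu> using \<mu> by (simp add: inv_bar_iff)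
    have sp: "space \<mu> = cms_bar M" "sets \<mu> = bsets M" using \<mu> by (auto simp: inv_bar_iff)
    have cs: "cell M w \<in> sets \<mu>" for w using cell_bsets sp by blast
    have i\<phi>: "integrable \<mu> (\<lambda>x. c w * indicator (cell M w) x)" for w
      using cs[of w] by (intro integrable_mult_right integrable_real_indicator) (auto simp: emeasure_eq_measure)
    then have int\<phi>: "integrable \<mu> \<phi>" unfolding \<phi>_def by (intro Bochner_Integration.integrable_sum)
    have bf: "f \<in> borel_measurable \<mu>"
    proof (rule borel_measurableI)
      fix S :: "real set" assume "open S"
      then have "openin (cms_bar_top M) {x \<in> topspace (cms_bar_top M). f x \<in> S}"
        by (intro openin_continuous_map_preimage[OF f]) simp
      then have "{x \<in> topspace (cms_bar_top M). f x \<in> S} \<in> bsets M" by (rule open_in_bsets)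
      moreover have "f -` S \<inter> space \<mu> = {x \<in> topspace (cms_bar_top M). f x \<in> S}" using sp by auto
      ultimately show "f -` S \<inter> space \<mu> \<in> sets \<mu>" using sp by simp
    qed
    have intd: "integrable \<mu> (\<lambda>x. f x - \<phi> x)"
      using bf int\<phi> \<phi>(2) sp by (intro integrable_const_bound[of _ e]) auto
    have "integrable \<mu> (\<lambda>x. (f x - \<phi> x) + \<phi> x)" using intd int\<phi> by (rule Bochner_Integration.integrable_add)
    then have intf: "integrable \<mu> f" by simp
    have "(\<integral>x. \<phi> x \<partial>\<mu>) = (\<Sum>w\<in>words M k. c w * measure \<mu> (cell M w))"
      unfolding \<phi>_def using i\<phi> cs bsets_subset[OF cell_bsets[of M]]
      by (subst Bochner_Integration.integral_sum) (auto simp: sp Int_absorb2)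
    moreover have "(\<integral>x. f x - \<phi> x \<partial>\<mu>) = (\<integral>x. f x \<partial>\<mu>) - (\<integral>x. \<phi> x \<partial>\<mu>)"
      using intf int\<phi> by (rule Bochner_Integration.integral_diff)
    moreover have "\<bar>\<integral>x. f x - \<phi> x \<partial>\<mu>\<bar> \<le> e"
    proof -
      have "\<bar>\<integral>x. f x - \<phi> x \<partial>\<mu>\<bar> \<le> (\<integral>x. \<bar>f x - \<phi> x\<bar> \<partial>\<mu>)" by (rule integral_abs_bound)
      also have "\<dots> \<le> (\<integral>x. e \<partial>\<mu>)"
        using intd \<phi>(2) sp by (intro integral_mono integrable_abs) auto
      finally show ?thesis by (simp add: prob_space)
    qed
    ultimately show "\<bar>(\<integral>x. f x \<partial>\<mu>) - (\<Sum>w\<in>words M k. c w * measure \<mu> (cell M w))\<bar> \<le> e" by simp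
  qed
qed

lemma continuous_on_bcontfun_apply:
  "continuous_on S (\<lambda>z :: 'a::topological_space \<Rightarrow>\<^sub>C real. apply_bcontfun z k)"
  unfolding continuous_on_iff
proof (intro ballI allI impI)
  fix z :: "'a \<Rightarrow>\<^sub>C real" and e :: real assume "0 < e"
  then show "\<exists>d>0. \<forall>z'\<in>S. dist z' z < d \<longrightarrow> dist (apply_bcontfun z' k) (apply_bcontfun z k) < e"
    using dist_bounded[of _ k z] by (intro exI[of _ e]) (meson le_less_trans)
qed

lemma continuous_emb_inverse:
  "continuous_map (subtopology euclidean (image_K M)) (inv_bar_top M)
     (inv_into (inv_bar M) (\<lambda>\<mu>. emb M (measure \<mu>)))"
proof -
  define h where "h = (\<lambda>\<mu>. emb M (measure \<mu>))"
  define g where "g = inv_into (inv_bar M) h"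
  have g: "g z \<in> inv_bar M" "h (g z) = z" if "z \<in> image_K M" for z
    using that inv_into_into[of z h "inv_bar M"] f_inv_into_f[of z h "inv_bar M"]
    unfolding image_K_eq g_def h_def by auto
  have cont: "continuous_on (image_K M) (\<lambda>z. \<integral>x. f x \<partial>(g z))"
    if f: "continuous_map (cms_bar_top M) euclideanreal f" for f
  proof -
    have "\<exists>\<Phi>. continuous_on (image_K M) \<Phi> \<and> (\<forall>z\<in>image_K M. \<bar>\<Phi> z - (\<integral>x. f x \<partial>(g z))\<bar> \<le> inverse (real (Suc n)))" for n
    proof -
      obtain k c where kc: "\<And>\<mu>. \<mu> \<in> inv_bar M \<Longrightarrow>
        \<bar>(\<integral>x. f x \<partial>\<mu>) - (\<Sum>w\<in>words M k. c w * measure \<mu> (cell M w))\<bar> \<le> inverse (real (Suc n))"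
        using integral_approx[OF f, of "inverse (real (Suc n))"] positive_imp_inverse_positive[of "real (Suc n)"]
        by (metis of_nat_0_less_iff zero_less_Suc)
      define \<Phi> :: "(nat \<Rightarrow>\<^sub>C real) \<Rightarrow> real" where
        "\<Phi> z = (\<Sum>w\<in>words M k. c w * (2 ^ to_nat w * apply_bcontfun z (to_nat w)))" for z
      have "continuous_on (image_K M) \<Phi>"
        unfolding \<Phi>_def by (intro continuous_intros continuous_on_bcontfun_apply)
      moreover have "\<bar>\<Phi> z - (\<integral>x. f x \<partial>(g z))\<bar> \<le> inverse (real (Suc n))" if z: "z \<in> image_K M" for z
      proof -
        have "fmeas M (measure (g z))" using g(1)[OF z] by (intro prob_funs_fmeas measure_prob_funs)
        then have "measure (g z) (cell M w) = 2 ^ to_nat w * apply_bcontfun z (to_nat w)" for w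
          using emb_cell[of M "measure (g z)" w] g(2)[OF z] by (simp add: h_def)
        then show ?thesis using kc[OF g(1)[OF z]] by (simp add: \<Phi>_def abs_minus_commute)
      qed
      ultimately show ?thesis by blast
    qed
    then obtain \<Phi> where \<Phi>: "\<And>n. continuous_on (image_K M) (\<Phi> n)"
      "\<And>n z. z \<in> image_K M \<Longrightarrow> \<bar>\<Phi> n z - (\<integral>x. f x \<partial>(g z))\<bar> \<le> inverse (real (Suc n))"
      by metis
    have "uniform_limit (image_K M) \<Phi> (\<lambda>z. \<integral>x. f x \<partial>(g z)) sequentially"
    proof (rule uniform_limitI)
      fix e :: real assume "0 < e"
      then obtain N where N: "inverse (real (Suc N)) < e" using reals_Archimedean by blast
      show "\<forall>\<^sub>F n in sequentially. \<forall>z\<in>image_K M. dist (\<Phi> n z) (\<integral>x. f x \<partial>(g z)) < e"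
        unfolding eventually_sequentially
      proof (intro exI[of _ N] allI impI ballI)
        fix n z assume "N \<le> n" "z \<in> image_K M"
        then have "dist (\<Phi> n z) (\<integral>x. f x \<partial>(g z)) \<le> inverse (real (Suc n))"
          using \<Phi>(2) by (simp add: dist_real_def)
        also have "\<dots> \<le> inverse (real (Suc N))" using \<open>N \<le> n\<close> by (intro le_imp_inverse_le) auto
        finally show "dist (\<Phi> n z) (\<integral>x. f x \<partial>(g z)) < e" using N by simp
      qed
    qed
    then show ?thesis using \<Phi>(1) by (intro uniform_limit_theorem) auto
  qed
  have "continuous_map (subtopology euclidean (image_K M)) (inv_bar_top M) g"
    unfolding inv_bar_top_def weak_star_def continuous_on_generated_topo_iff
  proof (intro conjI allI impI)
    fix B assume "B \<in> {{\<mu> \<in> inv_bar M. (\<integral>x. f x \<partial>\<mu>) \<in> U} | f U. continuous_map (cms_bar_top M) euclideanreal f \<and> open U}"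
    then obtain f U where B: "B = {\<mu> \<in> inv_bar M. (\<integral>x. f x \<partial>\<mu>) \<in> U}"
      "continuous_map (cms_bar_top M) euclideanreal f" "open U" by blast
    have "openin (top_of_set (image_K M)) (image_K M \<inter> (\<lambda>z. \<integral>x. f x \<partial>(g z)) -` U)"
      using cont[OF B(2)] B(3) by (rule continuous_openin_preimage_gen)
    moreover have "g -` B \<inter> topspace (subtopology euclidean (image_K M)) = image_K M \<inter> (\<lambda>z. \<integral>x. f x \<partial>(g z)) -` U"
      unfolding B(1) using g(1) by auto
    ultimately show "openin (top_of_set (image_K M)) (g -` B \<inter> topspace (top_of_set (image_K M)))" by simp
  next
    have "inv_bar M \<subseteq> \<Union> {{\<mu> \<in> inv_bar M. (\<integral>x. f x \<partial>\<mu>) \<in> U} | f U. continuous_map (cms_bar_top M) euclideanreal f \<and> open U}"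
      using topspace_weak_star[of "cms_bar_top M" "inv_bar M"]
      unfolding weak_star_def topology_generated_by_topspace by simp
    then show "g ` topspace (top_of_set (image_K M)) \<subseteq> \<Union> {{\<mu> \<in> inv_bar M. (\<integral>x. f x \<partial>\<mu>) \<in> U} | f U. continuous_map (cms_bar_top M) euclideanreal f \<and> open U}"
      using g(1) by auto
  qed
  then show ?thesis by (simp add: g_def h_def)
qed

lemma homeomorphic_emb:
  "homeomorphic_map (inv_bar_top M) (subtopology euclidean (image_K M)) (\<lambda>\<mu>. emb M (measure \<mu>))"
  unfolding homeomorphic_map_maps homeomorphic_maps_def
proof (intro exI conjI ballI)
  have top: "topspace (inv_bar_top M) = inv_bar M" by (simp add: inv_bar_top_def)
  show "continuous_map (inv_bar_top M) (subtopology euclidean (image_K M)) (\<lambda>\<mu>. emb M (measure \<mu>))"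
    using continuous_emb by (simp add: continuous_map_in_subtopology top image_K_eq)
  show "continuous_map (subtopology euclidean (image_K M)) (inv_bar_top M)
     (inv_into (inv_bar M) (\<lambda>\<mu>. emb M (measure \<mu>)))" by (rule continuous_emb_inverse)
  show "inv_into (inv_bar M) (\<lambda>\<mu>. emb M (measure \<mu>)) (emb M (measure x)) = x"
    if "x \<in> topspace (inv_bar_top M)" for x
    using that inv_into_f_f[OF inj_emb] by (simp add: top)
  show "emb M (measure (inv_into (inv_bar M) (\<lambda>\<mu>. emb M (measure \<mu>)) z)) = z"
    if "z \<in> topspace (subtopology euclidean (image_K M))" for z
    using that f_inv_into_f[of z "\<lambda>\<mu>. emb M (measure \<mu>)" "inv_bar M"] by (simp add: image_K_eq)
qed


section \<open>The simplex property\<close>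

text \<open>
  For a cone \<open>C\<close> closed under addition, it suffices to have suprema of pairs of elements of \<open>C\<close>:
  translation by an element of \<open>C\<close> moves two elements of \<open>C - C\<close> into \<open>C\<close>, and the infimum of \<open>a\<close>
  and \<open>b\<close> is \<open>a + b\<close> minus their supremum.
\<close>

lemma cone_latticeI:
  assumes add: "\<And>p q. p \<in> C \<Longrightarrow> q \<in> C \<Longrightarrow> p + q \<in> C"
    and sup: "\<And>p q. p \<in> C \<Longrightarrow> q \<in> C \<Longrightarrow>
      \<exists>s\<in>C. s - p \<in> C \<and> s - q \<in> C \<and> (\<forall>u. u - p \<in> C \<and> u - q \<in> C \<longrightarrow> u - s \<in> C)"
  shows "cone_lattice C"
proof -
  define E where "E = {p - q | p q. p \<in> C \<and> q \<in> C}"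
  have main: "(\<exists>s\<in>E. cone_le C a s \<and> cone_le C b s \<and>
           (\<forall>u\<in>E. cone_le C a u \<and> cone_le C b u \<longrightarrow> cone_le C s u)) \<and>
        (\<exists>i\<in>E. cone_le C i a \<and> cone_le C i b \<and>
           (\<forall>l\<in>E. cone_le C l a \<and> cone_le C l b \<longrightarrow> cone_le C l i))"
    if a: "a \<in> E" and b: "b \<in> E" for a b
  proof -
    obtain p1 q1 where 1: "a = p1 - q1" "p1 \<in> C" "q1 \<in> C" using a by (auto simp: E_def)
    obtain p2 q2 where 2: "b = p2 - q2" "p2 \<in> C" "q2 \<in> C" using b by (auto simp: E_def)
    define P Q R where "P = p1 + q2" and "Q = p2 + q1" and "R = q1 + q2"
    have PQR: "P \<in> C" "Q \<in> C" "R \<in> C" using 1 2 add by (auto simp: P_def Q_def R_def)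
    have aP: "a = P - R" and bQ: "b = Q - R" using 1(1) 2(1) by (simp_all add: P_def Q_def R_def)
    obtain S where S: "S \<in> C" "S - P \<in> C" "S - Q \<in> C"
      and least: "\<And>u. u - P \<in> C \<Longrightarrow> u - Q \<in> C \<Longrightarrow> u - S \<in> C"
      using sup[OF PQR(1,2)] by blast
    define s where "s = S - R"
    define i where "i = a + b - s"
    have sE: "s \<in> E" using S(1) PQR(3) by (auto simp: E_def s_def)
    have "i = (P + Q) - (S + R)" by (simp add: i_def aP bQ s_def)
    then have iE: "i \<in> E" using add[OF PQR(1,2)] add[OF S(1) PQR(3)] unfolding E_def by blast
    have sa: "s - a \<in> C" "s - b \<in> C" using S(2,3) by (simp_all add: s_def aP bQ)
    have sl: "u - s \<in> C" if "u - a \<in> C" "u - b \<in> C" for u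
    proof -
      have e: "(u + R) - P = u - a" "(u + R) - Q = u - b" "(u + R) - S = u - s"
        by (simp_all add: aP bQ s_def algebra_simps)
      have "(u + R) - S \<in> C" by (rule least) (simp_all only: e that)
      then show ?thesis by (simp only: e)
    qed
    have "a - i = s - b" "b - i = s - a" by (simp_all add: i_def algebra_simps)
    then have ia: "a - i \<in> C" "b - i \<in> C" using sa by simp_all
    have il: "i - l \<in> C" if "a - l \<in> C" "b - l \<in> C" for l
    proof -
      have e: "(a + b - l) - a = b - l" "(a + b - l) - b = a - l" "(a + b - l) - s = i - l"
        by (simp_all add: i_def algebra_simps)
      have "(a + b - l) - s \<in> C" by (rule sl) (simp_all only: e that)
      then show ?thesis by (simp only: e)
    qed
    show ?thesis
      unfolding cone_le_def using sE iE sa sl ia il by blast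
  qed
  show ?thesis unfolding cone_lattice_def Let_def E_def[symmetric] using main by blast
qed

lemma inv_fun_vimage: "inv_fun M m \<Longrightarrow> A \<in> bsets M \<Longrightarrow> m (shift -` A \<inter> cms_bar M) = m A"
  by (simp add: inv_fun_def)

lemma inv_fun_fmeas: "inv_fun M m \<Longrightarrow> fmeas M m"
  by (simp add: inv_fun_def)

text \<open>
  The supremum of \<open>p\<close> and \<open>q\<close> is \<open>p\<close> on a Hahn set \<open>Y\<close> of \<open>p - q\<close> and \<open>q\<close> off \<open>Y\<close>.  It is invariant
  because \<open>p - q\<close> takes the same maximal value on \<open>Y\<close> and on its preimage \<open>Y'\<close> under the shift, so that
  \<open>p\<close> and \<open>q\<close> agree on the subsets of the symmetric difference of \<open>Y\<close> and \<open>Y'\<close>.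
\<close>

lemma inv_fun_sup:
  assumes p: "inv_fun M p" and q: "inv_fun M q"
  shows "\<exists>s. inv_fun M s \<and> (\<forall>A\<in>bsets M. p A \<le> s A) \<and> (\<forall>A\<in>bsets M. q A \<le> s A) \<and>
    (\<forall>u. fmeas M u \<longrightarrow> (\<forall>A\<in>bsets M. p A \<le> u A) \<longrightarrow> (\<forall>A\<in>bsets M. q A \<le> u A) \<longrightarrow> (\<forall>A\<in>bsets M. s A \<le> u A))"
proof -
  interpret sigma_algebra "cms_bar M" "bsets M" by (rule sigma_algebra_bsets)
  have fp: "fmeas M p" and fq: "fmeas M q" using p q by (simp_all add: inv_fun_fmeas)
  have "\<exists>Y\<in>sets (mk M p). (\<forall>X\<in>sets (mk M p). X \<subseteq> Y \<longrightarrow> emeasure (mk M q) X \<le> emeasure (mk M p) X) \<and>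
      (\<forall>X\<in>sets (mk M p). X \<inter> Y = {} \<longrightarrow> emeasure (mk M p) X \<le> emeasure (mk M q) X)"
    by (rule finite_unsigned_Hahn_decomposition) (simp_all add: finite_measure_mk fp fq)
  then obtain Y where Y0: "Y \<in> sets (mk M p)"
    and Yp: "\<forall>X\<in>sets (mk M p). X \<subseteq> Y \<longrightarrow> emeasure (mk M q) X \<le> emeasure (mk M p) X"
    and Yq: "\<forall>X\<in>sets (mk M p). X \<inter> Y = {} \<longrightarrow> emeasure (mk M p) X \<le> emeasure (mk M q) X"
    by (elim bexE conjE)
  have Y: "Y \<in> bsets M" using Y0 by simp
  have Y1: "emeasure (mk M q) X \<le> emeasure (mk M p) X" if "X \<in> bsets M" "X \<subseteq> Y" for X
    using Yp that by simp
  have Y2: "emeasure (mk M p) X \<le> emeasure (mk M q) X" if "X \<in> bsets M" "X \<inter> Y = {}" for X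
    using Yq that by simp
  have pq1: "q X \<le> p X" if "X \<in> bsets M" "X \<subseteq> Y" for X
    using Y1[OF that] fmeas_nonneg[OF fp that(1)]
    by (simp add: emeasure_mk[OF fp that(1)] emeasure_mk[OF fq that(1)])
  have pq2: "p X \<le> q X" if "X \<in> bsets M" "X \<inter> Y = {}" for X
    using Y2[OF that] fmeas_nonneg[OF fq that(1)]
    by (simp add: emeasure_mk[OF fp that(1)] emeasure_mk[OF fq that(1)])
  define Y' where "Y' = shift -` Y \<inter> cms_bar M"
  have Y': "Y' \<in> bsets M" unfolding Y'_def by (rule shift_vimage_bsets[OF Y])
  have invY: "p Y' = p Y" "q Y' = q Y" unfolding Y'_def by (intro inv_fun_vimage p q Y)+
  have YY: "Y - Y' \<in> bsets M" "Y' - Y \<in> bsets M" using Y Y' by blast+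
  have bal: "q (Y - Y') \<le> p (Y - Y')" "p (Y' - Y) \<le> q (Y' - Y)"
    using pq1[OF YY(1)] pq2[OF YY(2)] by auto
  have "p Y = p (Y \<inter> Y') + p (Y - Y')" "q Y = q (Y \<inter> Y') + q (Y - Y')"
    using fmeas_split[OF fp Y Y'] fmeas_split[OF fq Y Y'] .
  moreover have "p Y' = p (Y \<inter> Y') + p (Y' - Y)" "q Y' = q (Y \<inter> Y') + q (Y' - Y)"
    using fmeas_split[OF fp Y' Y] fmeas_split[OF fq Y' Y] by (simp_all add: Int_commute)
  ultimately have null: "q (Y - Y') = p (Y - Y')" "p (Y' - Y) = q (Y' - Y)"
    using bal invY by linarith+
  have eq1: "p X = q X" if X: "X \<in> bsets M" "X \<subseteq> Y - Y'" for X
  proof -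
    have X2: "(Y - Y') - X \<in> bsets M" using YY(1) X(1) by blast
    have "q X \<le> p X" "q ((Y - Y') - X) \<le> p ((Y - Y') - X)"
      using pq1[OF X(1)] pq1[OF X2] X(2) by auto
    moreover have "p (Y - Y') = p X + p ((Y - Y') - X)" "q (Y - Y') = q X + q ((Y - Y') - X)"
      using fmeas_split[OF fp YY(1) X(1)] fmeas_split[OF fq YY(1) X(1)] X(2) by (simp_all add: Int_absorb1)
    ultimately show ?thesis using null(1) by linarith
  qed
  have eq2: "p X = q X" if X: "X \<in> bsets M" "X \<subseteq> Y' - Y" for X
  proof -
    have X2: "(Y' - Y) - X \<in> bsets M" using YY(2) X(1) by blast
    have "p X \<le> q X" "p ((Y' - Y) - X) \<le> q ((Y' - Y) - X)"
      using pq2[OF X(1)] pq2[OF X2] X(2) by auto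
    moreover have "p (Y' - Y) = p X + p ((Y' - Y) - X)" "q (Y' - Y) = q X + q ((Y' - Y) - X)"
      using fmeas_split[OF fp YY(2) X(1)] fmeas_split[OF fq YY(2) X(1)] X(2) by (simp_all add: Int_absorb1)
    ultimately show ?thesis using null(2) by linarith
  qed
  have swap: "p (A \<inter> Y) - q (A \<inter> Y) = p (A \<inter> Y') - q (A \<inter> Y')" if A: "A \<in> bsets M" for A
  proof -
    have s: "A \<inter> Y \<in> bsets M" "A \<inter> Y' \<in> bsets M" using A Y Y' by blast+
    have t: "A \<inter> Y - Y' \<in> bsets M" "A \<inter> Y' - Y \<in> bsets M" using s Y Y' by blast+
    have "p (A \<inter> Y - Y') = q (A \<inter> Y - Y')" "p (A \<inter> Y' - Y) = q (A \<inter> Y' - Y)"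
      using eq1[OF t(1)] eq2[OF t(2)] by blast+
    moreover have "A \<inter> Y' \<inter> Y = A \<inter> Y \<inter> Y'" by blast
    ultimately show ?thesis
      using fmeas_split[OF fp s(1) Y'] fmeas_split[OF fq s(1) Y']
        fmeas_split[OF fp s(2) Y] fmeas_split[OF fq s(2) Y] by simp
  qed
  define s where "s A = (q A - q (A \<inter> Y)) + p (A \<inter> Y)" for A
  have AY: "A \<inter> Y \<in> bsets M" "A - Y \<in> bsets M" if "A \<in> bsets M" for A using that Y by blast+
  have "fmeas M (\<lambda>A. q A - q (A \<inter> Y))"
    using fmeas_mono[OF fq AY(1)] by (intro fmeas_diff fq fmeas_restrict Y) blast
  then have fs: "fmeas M s" unfolding s_def by (intro fmeas_add fmeas_restrict fp Y)
  have s_eq: "s A = p (A \<inter> Y) + q (A - Y)" if "A \<in> bsets M" for A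
    using fmeas_split[OF fq that Y] by (simp add: s_def)
  have "s (shift -` A \<inter> cms_bar M) = s A" if A: "A \<in> bsets M" for A
  proof -
    let ?B = "shift -` A \<inter> cms_bar M"
    have B: "?B \<in> bsets M" by (rule shift_vimage_bsets[OF A])
    have e: "?B \<inter> Y' = shift -` (A \<inter> Y) \<inter> cms_bar M" unfolding Y'_def by blast
    have "s ?B = q ?B + (p (?B \<inter> Y) - q (?B \<inter> Y))" by (simp add: s_def)
    also have "\<dots> = q ?B + (p (?B \<inter> Y') - q (?B \<inter> Y'))" using swap[OF B] by simp
    also have "\<dots> = q A + (p (A \<inter> Y) - q (A \<inter> Y))"
      unfolding e by (simp only: inv_fun_vimage[OF p AY(1)[OF A]] inv_fun_vimage[OF q AY(1)[OF A]] inv_fun_vimage[OF q A])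
    finally show ?thesis by (simp add: s_def)
  qed
  then have inv_s: "inv_fun M s" using fs by (simp add: inv_fun_def)
  show ?thesis
  proof (intro exI[of _ s] conjI ballI allI impI inv_s)
    fix A assume A: "A \<in> bsets M"
    have "p (A - Y) \<le> q (A - Y)" using pq2[OF AY(2)[OF A]] by blast
    then show "p A \<le> s A" using fmeas_split[OF fp A Y] s_eq[OF A] by linarith
    have "q (A \<inter> Y) \<le> p (A \<inter> Y)" using pq1[OF AY(1)[OF A]] by blast
    then show "q A \<le> s A" using fmeas_split[OF fq A Y] s_eq[OF A] by linarith
  next
    fix u A assume u: "fmeas M u" "\<forall>A\<in>bsets M. p A \<le> u A" "\<forall>A\<in>bsets M. q A \<le> u A" and A: "A \<in> bsets M"
    have "p (A \<inter> Y) \<le> u (A \<inter> Y)" "q (A - Y) \<le> u (A - Y)" using u(2,3) AY[OF A] by blast+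
    then show "s A \<le> u A" using fmeas_split[OF u(1) A Y] s_eq[OF A] by linarith
  qed
qed

text \<open>
  The point of the cone over \<open>image_K M\<close> that corresponds to a finite invariant measure; the second
  component is its total mass.
\<close>

definition cone_emb :: "(nat \<Rightarrow> nat \<Rightarrow> nat) \<Rightarrow> ((nat \<Rightarrow> enat) set \<Rightarrow> real) \<Rightarrow> (nat \<Rightarrow>\<^sub>C real) \<times> real" where
  "cone_emb M m = (emb M m, m (cms_bar M))"

lemma cone_emb_add:
  "fmeas M m1 \<Longrightarrow> fmeas M m2 \<Longrightarrow> cone_emb M (\<lambda>A. m1 A + m2 A) = cone_emb M m1 + cone_emb M m2"
  by (simp add: cone_emb_def emb_add)

lemma cone_emb_diff:
  assumes "fmeas M m1" "fmeas M m2" "\<And>A. A \<in> bsets M \<Longrightarrow> m2 A \<le> m1 A"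
  shows "cone_emb M (\<lambda>A. m1 A - m2 A) = cone_emb M m1 - cone_emb M m2"
  using emb_diff[OF assms] by (simp add: cone_emb_def)

lemma cone_over_image_K:
  assumes "prob_funs M \<noteq> {}"
  shows "cone_over (image_K M) = cone_emb M ` {m. inv_fun M m}"
proof (intro equalityI subsetI)
  fix z assume "z \<in> cone_over (image_K M)"
  then obtain t m where t: "0 \<le> t" "m \<in> prob_funs M" "z = (t *\<^sub>R emb M m, t)"
    unfolding cone_over_def image_K_def by blast
  have "inv_fun M (\<lambda>A. t * m A)" using t by (intro inv_fun_scale) (auto simp: prob_funs_def)
  moreover have "z = cone_emb M (\<lambda>A. t * m A)"
    using t emb_scale[OF prob_funs_fmeas[OF t(2)] t(1)] by (simp add: cone_emb_def prob_funs_def)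
  ultimately show "z \<in> cone_emb M ` {m. inv_fun M m}" by blast
next
  fix z assume "z \<in> cone_emb M ` {m. inv_fun M m}"
  then obtain m where m: "inv_fun M m" "z = cone_emb M m" by blast
  have fm: "fmeas M m" using m(1) by (rule inv_fun_fmeas)
  define t where "t = m (cms_bar M)"
  have t0: "0 \<le> t" using fm space_bsets unfolding t_def fmeas_def by blast
  show "z \<in> cone_over (image_K M)"
  proof (cases "t = 0")
    case True
    obtain m0 where m0: "m0 \<in> prob_funs M" using assms by blast
    have "m (cell M w) = 0" for w using cell_le[OF fm, of w] True by (simp add: t_def)
    then have "emb M m = 0" by (intro bcontfun_eqI) (simp add: emb_apply[OF fm] zero_bcontfun.rep_eq)
    then have "z = (0 *\<^sub>R emb M m0, 0)" using m(2) True by (simp add: cone_emb_def t_def)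
    then show ?thesis using m0 unfolding cone_over_def image_K_def by blast
  next
    case False
    define m' where "m' = (\<lambda>A. (1 / t) * m A)"
    have inv: "inv_fun M m'" unfolding m'_def using m(1) t0 by (intro inv_fun_scale) auto
    have "m' \<in> prob_funs M" using inv False by (simp add: prob_funs_def m'_def t_def)
    moreover have "emb M m' = (1 / t) *\<^sub>R emb M m"
      unfolding m'_def using t0 by (intro emb_scale fm) simp
    then have "z = (t *\<^sub>R emb M m', t)" using False m(2) by (simp add: cone_emb_def t_def)
    ultimately show ?thesis using t0 unfolding cone_over_def image_K_def by blast
  qed
qed

lemma cone_lattice_image_K:
  assumes "prob_funs M \<noteq> {}"
  shows "cone_lattice (cone_over (image_K M))"
  unfolding cone_over_image_K[OF assms]
proof (rule cone_latticeI)
  let ?C = "cone_emb M ` {m. inv_fun M m}"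
  fix x y assume "x \<in> ?C" "y \<in> ?C"
  then obtain p q where p: "inv_fun M p" "x = cone_emb M p" and q: "inv_fun M q" "y = cone_emb M q"
    by blast
  have fp: "fmeas M p" and fq: "fmeas M q" using p q by (simp_all add: inv_fun_fmeas)
  show "x + y \<in> ?C"
    unfolding p(2) q(2) cone_emb_add[OF fp fq, symmetric] using inv_fun_add[OF p(1) q(1)] by blast
  obtain s where s: "inv_fun M s" "\<forall>A\<in>bsets M. p A \<le> s A" "\<forall>A\<in>bsets M. q A \<le> s A"
    "\<forall>u. fmeas M u \<longrightarrow> (\<forall>A\<in>bsets M. p A \<le> u A) \<longrightarrow> (\<forall>A\<in>bsets M. q A \<le> u A) \<longrightarrow> (\<forall>A\<in>bsets M. s A \<le> u A)"
    using inv_fun_sup[OF p(1) q(1)] by (elim exE conjE)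
  have fs: "fmeas M s" using s(1) by (rule inv_fun_fmeas)
  have diffC: "cone_emb M a - cone_emb M b \<in> ?C"
    if "inv_fun M a" "inv_fun M b" "\<And>A. A \<in> bsets M \<Longrightarrow> b A \<le> a A" for a b
  proof -
    have "inv_fun M (\<lambda>A. a A - b A)" by (rule inv_fun_diff[OF that(1,2)]) (rule that(3))
    moreover have "cone_emb M (\<lambda>A. a A - b A) = cone_emb M a - cone_emb M b"
      by (rule cone_emb_diff[OF inv_fun_fmeas[OF that(1)] inv_fun_fmeas[OF that(2)]]) (rule that(3))
    ultimately show ?thesis by (metis imageI mem_Collect_eq)
  qed
  show "\<exists>s\<in>?C. s - x \<in> ?C \<and> s - y \<in> ?C \<and> (\<forall>u. u - x \<in> ?C \<and> u - y \<in> ?C \<longrightarrow> u - s \<in> ?C)"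
  proof (intro bexI[of _ "cone_emb M s"] conjI allI impI)
    show "cone_emb M s - x \<in> ?C" unfolding p(2) by (rule diffC[OF s(1) p(1) bspec[OF s(2)]])
    show "cone_emb M s - y \<in> ?C" unfolding q(2) by (rule diffC[OF s(1) q(1) bspec[OF s(3)]])
    show "cone_emb M s \<in> ?C" using s(1) by blast
    fix u assume u: "u - x \<in> ?C \<and> u - y \<in> ?C"
    then obtain c d where c: "inv_fun M c" "u - x = cone_emb M c" and d: "inv_fun M d" "u - y = cone_emb M d"
      by blast
    have fc: "fmeas M c" and fd: "fmeas M d" using c d by (simp_all add: inv_fun_fmeas)
    define W V where "W = (\<lambda>A. p A + c A)" and "V = (\<lambda>A. q A + d A)"
    have iW: "inv_fun M W" unfolding W_def by (rule inv_fun_add[OF p(1) c(1)])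
    have fW: "fmeas M W" "fmeas M V" unfolding W_def V_def by (intro fmeas_add fp fc fq fd)+
    have uW: "u = cone_emb M W" unfolding W_def cone_emb_add[OF fp fc] using c(2) p(2) by (simp add: algebra_simps)
    have uV: "u = cone_emb M V" unfolding V_def cone_emb_add[OF fq fd] using d(2) q(2) by (simp add: algebra_simps)
    have "emb M W = emb M V" using uW uV by (simp add: cone_emb_def)
    then have WV: "W A = V A" if "A \<in> bsets M" for A using emb_eqD[OF fW] that by blast
    have "\<forall>A\<in>bsets M. p A \<le> W A" using fc by (simp add: W_def fmeas_def)
    moreover have "\<forall>A\<in>bsets M. q A \<le> W A" using fd WV by (simp add: V_def fmeas_def)
    ultimately have "\<forall>A\<in>bsets M. s A \<le> W A" using s(4) fW(1) by simp
    then show "u - cone_emb M s \<in> ?C"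
      unfolding uW by (intro diffC iW s(1)) (rule bspec)
  qed
qed

lemma convex_image_K: "convex (image_K M)"
  unfolding convex_def
proof (intro ballI allI impI)
  fix x y and u v :: real assume "x \<in> image_K M" "y \<in> image_K M" and uv: "0 \<le> u" "0 \<le> v" "u + v = 1"
  then obtain m1 m2 where m: "m1 \<in> prob_funs M" "x = emb M m1" "m2 \<in> prob_funs M" "y = emb M m2"
    unfolding image_K_def by blast
  have f: "fmeas M m1" "fmeas M m2" using m prob_funs_fmeas by blast+
  have "u *\<^sub>R x + v *\<^sub>R y = emb M (\<lambda>A. u * m1 A + v * m2 A)"
    unfolding m emb_combination[OF f uv(1,2)] ..
  moreover have "inv_fun M (\<lambda>A. u * m1 A + v * m2 A)"
    using m uv by (intro inv_fun_add inv_fun_scale) (simp_all add: prob_funs_def)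
  then have "(\<lambda>A. u * m1 A + v * m2 A) \<in> prob_funs M" using m uv by (simp add: prob_funs_def)
  ultimately show "u *\<^sub>R x + v *\<^sub>R y \<in> image_K M" unfolding image_K_def by blast
qed

lemma emb_mix:
  assumes \<mu>: "\<mu> \<in> inv_bar M" and \<nu>: "\<nu> \<in> inv_bar M" and t: "t \<in> {0..1}"
  shows "emb M (measure (mix_measure t \<mu> \<nu>)) = (1 - t) *\<^sub>R emb M (measure \<mu>) + t *\<^sub>R emb M (measure \<nu>)"
proof -
  interpret \<mu>: prob_space \<mu> using \<mu> by (simp add: inv_bar_iff)
  interpret \<nu>: prob_space \<nu> using \<nu> by (simp add: inv_bar_iff)
  have t': "0 \<le> 1 - t" "0 \<le> t" using t by auto
  have f: "fmeas M (measure \<mu>)" "fmeas M (measure \<nu>)"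
    using \<mu> \<nu> measure_prob_funs prob_funs_fmeas by blast+
  have "measure (mix_measure t \<mu> \<nu>) (cell M w) = (1 - t) * measure \<mu> (cell M w) + t * measure \<nu> (cell M w)" for w
  proof -
    have "emeasure (mix_measure t \<mu> \<nu>) (cell M w) = ennreal (1 - t) * emeasure \<mu> (cell M w) + ennreal t * emeasure \<nu> (cell M w)"
      using \<mu> \<nu> cell_bsets by (intro emeasure_mix_measure) (simp_all add: inv_bar_iff)
    also have "\<dots> = ennreal ((1 - t) * measure \<mu> (cell M w) + t * measure \<nu> (cell M w))"
      using t' by (simp add: \<mu>.emeasure_eq_measure \<nu>.emeasure_eq_measure ennreal_mult ennreal_plus)
    finally have e: "emeasure (mix_measure t \<mu> \<nu>) (cell M w)
        = ennreal ((1 - t) * measure \<mu> (cell M w) + t * measure \<nu> (cell M w))" .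
    show ?thesis
      unfolding measure_def[of "mix_measure t \<mu> \<nu>"] e
      using t' by (intro enn2real_ennreal add_nonneg_nonneg mult_nonneg_nonneg measure_nonneg)
  qed
  then have "emb M (measure (mix_measure t \<mu> \<nu>)) = emb M (\<lambda>A. (1 - t) * measure \<mu> A + t * measure \<nu> A)"
    by (rule emb_cong)
  then show ?thesis
    unfolding emb_combination[OF f t'] .
qed

lemma locally_convex_tvs_euclidean:
  "locally_convex_tvs (euclidean :: 'v::real_normed_vector topology)"
  unfolding locally_convex_tvs_def
proof (intro conjI allI impI)
  show "continuous_map (prod_topology euclidean euclidean) euclidean (\<lambda>(x :: 'v, y). x + y)"
    by (simp add: split_beta continuous_map_iff_continuous2 continuous_intros)
  show "continuous_map (prod_topology euclideanreal euclidean) euclidean (\<lambda>(c, x :: 'v). c *\<^sub>R x)"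
    by (simp add: split_beta continuous_map_iff_continuous2 continuous_intros)
  fix U :: "'v set" assume "openin euclidean U \<and> 0 \<in> U"
  then have "open U" "0 \<in> U" by simp_all
  then obtain e where "0 < e" "ball 0 e \<subseteq> U" by (rule openE)
  then show "\<exists>V. openin euclidean V \<and> 0 \<in> V \<and> convex V \<and> V \<subseteq> U"
    by (intro exI[of _ "ball 0 e"]) simp
qed simp_all


section \<open>Measurable structure of the Markov shift\<close>

lemma pre_all_eq_imp_eq:
  assumes "\<And>k. pre k x = pre k y"
  shows "x = y"
proof
  fix i
  have col: "col (Suc i + a) (x i) = col (Suc i + a) (y i)" for a
    using assms[of "Suc i + a"] unfolding pre_eq_iff by simp
  show "x i = y i"
  proof (cases "x i"; cases "y i")
    fix a b assume "x i = enat a" "y i = enat b"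
    then show ?thesis using col[of "a + b"] by (simp add: col_def)
  next
    fix a assume "x i = enat a" "y i = \<infinity>"
    then show ?thesis using col[of a] by (simp add: col_def)
  next
    fix b assume "x i = \<infinity>" "y i = enat b"
    then show ?thesis using col[of b] by (simp add: col_def)
  qed simp
qed

lemma singleton_bsets:
  assumes "x \<in> cms_bar M" shows "{x} \<in> bsets M"
proof -
  interpret sigma_algebra "cms_bar M" "bsets M" by (rule sigma_algebra_bsets)
  have "(\<Inter>k. cell M (pre k x)) = {x}"
  proof (intro equalityI subsetI)
    fix y assume "y \<in> (\<Inter>k. cell M (pre k x))"
    then have "pre k y = pre k x" for k by (simp add: cell_def)
    then show "y \<in> {x}" using pre_all_eq_imp_eq by blast
  qed (use assms in \<open>simp add: cell_def\<close>)
  moreover have "(\<Inter>k. cell M (pre k x)) \<in> bsets M"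
    using cell_bsets by (intro countable_INT) auto
  ultimately show ?thesis by simp
qed

lemma coord_clop: "{x \<in> cms_bar M. x i = enat a} \<in> clop M"
proof (rule clopI[of _ _ "Suc (i + a)"])
  fix x y assume "x \<in> {x \<in> cms_bar M. x i = enat a}" "y \<in> cms_bar M" "pre (Suc (i + a)) y = pre (Suc (i + a)) x"
  moreover from this have "col (Suc (i + a)) (y i) = a" by (simp add: pre_eq_iff col_def)
  then have "y i = enat a" by (cases "y i") (auto simp: col_def)
  ultimately show "y \<in> {x \<in> cms_bar M. x i = enat a}" by simp
qed simp

text \<open>
  The points of the compactification without a coordinate \<open>\<infinity>\<close> are exactly those of the Markov shift,
  since finite symbols are isolated; in particular the Markov shift is a Borel set.
\<close>

lemma cms_ext_eq: "cms_ext M = (\<Inter>i. \<Union>a. {x \<in> cms_bar M. x i = enat a})"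
proof (intro equalityI subsetI)
  fix x assume x: "x \<in> cms_ext M"
  then have "x \<in> cms_bar M" using cms_ext_subset_bar by blast
  moreover have "\<exists>a. x i = enat a" for i using x by (auto simp: cms_ext_def)
  ultimately show "x \<in> (\<Inter>i. \<Union>a. {x \<in> cms_bar M. x i = enat a})" by simp
next
  fix x assume x: "x \<in> (\<Inter>i. \<Union>a. {x \<in> cms_bar M. x i = enat a})"
  then have xb: "x \<in> cms_bar M" by auto
  have "\<forall>i. \<exists>a. x i = enat a" using x by auto
  then obtain y where y: "\<And>i. x i = enat (y i)" by metis
  have "1 \<le> y i \<and> M (y i) (y (Suc i)) = 1" for i
  proof -
    define k where "k = Suc (Suc i + y i + y (Suc i))"
    obtain z where z: "z \<in> cms M" "pre k (\<lambda>n. enat (z n)) = pre k x"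
      using xb unfolding in_cms_bar_iff cms_ext_def by blast
    have "col k (enat (z i)) = col k (enat (y i))" "col k (enat (z (Suc i))) = col k (enat (y (Suc i)))"
      using z(2) y unfolding pre_eq_iff by (simp_all add: k_def)
    then have "z i = y i" "z (Suc i) = y (Suc i)"
      by (simp_all add: col_def k_def min_def split: if_splits)
    then show ?thesis using z(1) unfolding cms_def by (metis (mono_tags, lifting) mem_Collect_eq)
  qed
  then have "y \<in> cms M" by (simp add: cms_def)
  moreover have "x = (\<lambda>n. enat (y n))" using y by blast
  ultimately show "x \<in> cms_ext M" unfolding cms_ext_def by blast
qed

lemma cms_ext_bsets: "cms_ext M \<in> bsets M"
proof -
  interpret sigma_algebra "cms_bar M" "bsets M" by (rule sigma_algebra_bsets)
  have "(\<Union>a. {x \<in> cms_bar M. x i = enat a}) \<in> bsets M" for i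
    using clop_bsets[OF coord_clop] by (intro countable_UN) blast
  then show ?thesis unfolding cms_ext_eq by (intro countable_INT) auto
qed


section \<open>Measures on periodic orbits\<close>

text \<open>
  The \<open>k\<close>-th point of the orbit of the periodic point given by a loop, inside the compactification.
\<close>

definition orbit_pt :: "nat list \<Rightarrow> nat \<Rightarrow> nat \<Rightarrow> enat" where
  "orbit_pt u k = (shift ^^ k) (\<lambda>n. enat (per u n))"

text \<open>
  The invariant probability measure on this orbit.  The length of \<open>u\<close> need not be the least period.
\<close>

definition orbit_measure :: "nat list \<Rightarrow> (nat \<Rightarrow> enat) set \<Rightarrow> real" where
  "orbit_measure u A = (\<Sum>k<length u. of_bool (orbit_pt u k \<in> A)) / length u"

lemma orbit_pt_Suc: "shift (orbit_pt u k) = orbit_pt u (Suc k)"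
  by (simp add: orbit_pt_def)

lemma orbit_pt_shift: "(shift ^^ j) (orbit_pt u k) = orbit_pt u (k + j)"
  by (simp add: orbit_pt_def funpow_shift add.assoc)

lemma orbit_pt_period: "orbit_pt u (k + length u) = orbit_pt u k"
proof
  fix n
  have "per u (k + length u + n) = per u (k + n)"
    using per_add_length[of u "k + n"] by (simp add: ac_simps)
  then show "orbit_pt u (k + length u) n = orbit_pt u k n"
    by (simp add: orbit_pt_def funpow_shift)
qed

lemma orbit_pt_mem:
  assumes "loop M u" shows "orbit_pt u k \<in> cms_ext M"
proof (induction k)
  case 0
  then show ?case using per_in_cms[OF assms] by (auto simp: orbit_pt_def cms_ext_def)
next
  case (Suc k)
  then show ?case using shift_cms_ext[of "orbit_pt u k" M] by (simp add: orbit_pt_Suc)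
qed

lemma orbit_pt_bar: "loop M u \<Longrightarrow> orbit_pt u k \<in> cms_bar M"
  using orbit_pt_mem cms_ext_subset_bar by blast

lemma sum_period:
  fixes f :: "nat \<Rightarrow> real"
  assumes "\<And>k. f (k + n) = f k"
  shows "(\<Sum>j<n. f (i + j)) = (\<Sum>j<n. f j)"
proof (induction i)
  case (Suc i)
  have "(\<Sum>j<n. f (Suc i + j)) + f i = (\<Sum>j<Suc n. f (i + j))"
    by (subst sum.lessThan_Suc_shift) simp
  also have "\<dots> = (\<Sum>j<n. f (i + j)) + f i" using assms by simp
  finally show ?case using Suc by simp
qed simp

lemma of_bool_sums:
  assumes "disjoint_family F"
  shows "(\<lambda>i::nat. of_bool (x \<in> F i) :: real) sums of_bool (x \<in> (\<Union>i. F i))"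
proof (cases "\<exists>j. x \<in> F j")
  case True
  then obtain j where j: "x \<in> F j" by blast
  have "x \<in> F i \<longleftrightarrow> i = j" for i
    using j assms unfolding disjoint_family_on_def by blast
  then have "(\<lambda>i. of_bool (x \<in> F i) :: real) = (\<lambda>i. if i = j then 1 else 0)" by auto
  moreover have "(\<lambda>i. if i = j then (\<lambda>_. 1::real) i else 0) sums (\<lambda>_. 1) j" by (rule sums_single)
  ultimately show ?thesis using j by auto
qed simp

lemma orbit_measure_prob_funs:
  assumes u: "loop M u"
  shows "orbit_measure u \<in> prob_funs M"
proof -
  have n: "0 < length u" using u by (simp add: loop_def)
  have f: "fmeas M (orbit_measure u)"
    unfolding fmeas_def orbit_measure_def
  proof (intro conjI ballI allI impI)
    fix F :: "nat \<Rightarrow> (nat \<Rightarrow> enat) set" assume "disjoint_family F"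
    then show "(\<lambda>i. (\<Sum>k<length u. of_bool (orbit_pt u k \<in> F i)) / real (length u)) sums
      ((\<Sum>k<length u. of_bool (orbit_pt u k \<in> \<Union> (range F))) / real (length u))"
      by (intro sums_divide sums_sum of_bool_sums)
  qed (intro divide_nonneg_nonneg sum_nonneg, auto)
  have "orbit_measure u (shift -` A \<inter> cms_bar M) = orbit_measure u A" for A
  proof -
    have "orbit_pt u k \<in> shift -` A \<inter> cms_bar M \<longleftrightarrow> orbit_pt u (1 + k) \<in> A" for k
      using orbit_pt_bar[OF u, of k] by (simp add: orbit_pt_Suc)
    then have "(\<Sum>k<length u. of_bool (orbit_pt u k \<in> shift -` A \<inter> cms_bar M) :: real)
        = (\<Sum>k<length u. of_bool (orbit_pt u (1 + k) \<in> A))" by simp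
    also have "\<dots> = (\<Sum>k<length u. of_bool (orbit_pt u k \<in> A))"
      by (rule sum_period) (simp add: orbit_pt_period)
    finally show ?thesis by (simp add: orbit_measure_def)
  qed
  then have "inv_fun M (orbit_measure u)" using f by (simp add: inv_fun_def)
  moreover have "orbit_measure u (cms_bar M) = 1"
    using orbit_pt_bar[OF u] n by (simp add: orbit_measure_def)
  ultimately show ?thesis by (simp add: prob_funs_def)
qed

lemma orbit_measure_cell:
  assumes u: "loop M u"
  shows "orbit_measure u (cell M w) = lcount (length w) u w / length u"
proof -
  have "orbit_pt u k \<in> cell M w \<longleftrightarrow> win (length w) (per u) k = w" for k
    using orbit_pt_bar[OF u, of k] pre_enat[of "length w" k "per u"]
    by (simp add: cell_def orbit_pt_def)
  then show ?thesis by (simp only: orbit_measure_def lcount_def cnt_def atLeast0LessThan)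
qed

text \<open>
  The measure on a periodic orbit as an element of the space of measures.
\<close>

definition per_measure :: "(nat \<Rightarrow> nat \<Rightarrow> nat) \<Rightarrow> nat list \<Rightarrow> (nat \<Rightarrow> enat) measure" where
  "per_measure M u = mk M (orbit_measure u)"

lemma per_measure_inv_cms:
  assumes u: "loop M u" shows "per_measure M u \<in> inv_cms M"
proof -
  have p: "orbit_measure u \<in> prob_funs M" by (rule orbit_measure_prob_funs[OF u])
  have "per_measure M u \<in> inv_bar M"
    unfolding per_measure_def using p by (intro mk_inv_bar) (simp_all add: prob_funs_def)
  moreover have "orbit_measure u (cms_ext M) = 1"
    using orbit_pt_mem[OF u] u by (simp add: orbit_measure_def loop_def)
  then have "emeasure (per_measure M u) (cms_ext M) = 1"
    unfolding per_measure_def using emeasure_mk[OF prob_funs_fmeas[OF p] cms_ext_bsets] by simp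
  ultimately show ?thesis by (simp add: inv_cms_def)
qed

lemma emb_per_measure:
  assumes u: "loop M u" shows "emb M (measure (per_measure M u)) = emb M (orbit_measure u)"
  unfolding per_measure_def
  by (intro emb_cong measure_mk cell_bsets prob_funs_fmeas orbit_measure_prob_funs u)

lemma inv_fun_iterate:
  assumes "inv_fun M m" "A \<in> bsets M"
  shows "(shift ^^ j) -` A \<inter> cms_bar M \<in> bsets M \<and> m ((shift ^^ j) -` A \<inter> cms_bar M) = m A"
proof (induction j)
  case 0
  then show ?case using assms(2) bsets_subset[OF assms(2)] by (simp add: Int_absorb2)
next
  case (Suc j)
  define X where "X = (shift ^^ j) -` A \<inter> cms_bar M"
  have X: "X \<in> bsets M" "m X = m A" using Suc by (simp_all only: X_def)
  have e: "(shift ^^ Suc j) -` A \<inter> cms_bar M = shift -` X \<inter> cms_bar M"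
    using shift_cms_bar[of _ M] by (auto simp: X_def funpow_Suc_right simp del: funpow.simps)
  show ?case unfolding e using shift_vimage_bsets[OF X(1)] inv_fun_vimage[OF assms(1) X(1)] X(2) by simp
qed

text \<open>
  A periodic orbit carries only one invariant probability measure: averaging an event over one period
  gives the same value at all points of the orbit.
\<close>

lemma orbit_measure_unique:
  assumes u: "loop M u" and m: "m \<in> prob_funs M"
    and supp: "m (cms_bar M - range (orbit_pt u)) = 0" and A: "A \<in> bsets M"
  shows "m A = orbit_measure u A"
proof -
  interpret sigma_algebra "cms_bar M" "bsets M" by (rule sigma_algebra_bsets)
  define n where "n = length u"
  have n: "0 < n" using u by (simp add: loop_def n_def)
  define Orb where "Orb = orbit_pt u ` {..<n}"
  have per: "orbit_pt u k = orbit_pt u (k mod n)" for k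
  proof (induction k rule: less_induct)
    case (less k)
    show ?case
    proof (cases "k < n")
      case False
      then have "orbit_pt u k = orbit_pt u (k - n)"
        using orbit_pt_period[of u "k - n"] by (simp add: n_def)
      also have "\<dots> = orbit_pt u ((k - n) mod n)" using False n by (intro less) simp
      also have "(k - n) mod n = k mod n" using False by (simp add: le_mod_geq)
      finally show ?thesis .
    qed simp
  qed
  have "range (orbit_pt u) = Orb"
  proof (intro equalityI subsetI)
    fix x assume "x \<in> range (orbit_pt u)"
    then obtain k where "x = orbit_pt u k" by blast
    then have "x = orbit_pt u (k mod n)" using per by metis
    moreover have "k mod n \<in> {..<n}" using n by simp
    ultimately show "x \<in> Orb" unfolding Orb_def by blast
  qed (auto simp: Orb_def)
  have inv: "inv_fun M m" and m1: "m (cms_bar M) = 1" using m by (simp_all add: prob_funs_def)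
  have fm: "fmeas M m" using inv by (rule inv_fun_fmeas)
  have finO: "finite Orb" by (simp add: Orb_def)
  have Osub: "Orb \<subseteq> cms_bar M" using orbit_pt_bar[OF u] by (auto simp: Orb_def)
  have sing: "{x} \<in> bsets M" if "x \<in> Orb" for x using that Osub by (intro singleton_bsets) blast
  have OB: "Orb \<in> bsets M"
  proof -
    have "(\<Union>x\<in>Orb. {x}) \<in> bsets M" using sing finO by (intro finite_UN) auto
    then show ?thesis by simp
  qed
  have m_eq: "m B = (\<Sum>x\<in>Orb. of_bool (x \<in> B) * m {x})" if B: "B \<in> bsets M" for B
  proof -
    have BO: "B \<inter> Orb \<in> bsets M" "B - Orb \<in> bsets M" using B OB by blast+
    have "m (B - Orb) \<le> m (cms_bar M - Orb)"
      using bsets_subset[OF B] OB space_bsets by (intro fmeas_mono[OF fm] BO) blast+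
    then have "m (B - Orb) = 0"
      using supp \<open>range (orbit_pt u) = Orb\<close> fmeas_nonneg[OF fm BO(2)] by simp
    then have "m B = m (B \<inter> Orb)" using fmeas_split[OF fm B OB] by simp
    also have "B \<inter> Orb = (\<Union>x\<in>Orb. B \<inter> {x})" by blast
    also have "m (\<Union>x\<in>Orb. B \<inter> {x}) = (\<Sum>x\<in>Orb. m (B \<inter> {x}))"
    proof -
      have s: "B \<inter> {x} \<in> bsets M" if "x \<in> Orb" for x using B sing[OF that] by blast
      then have U: "(\<Union>x\<in>Orb. B \<inter> {x}) \<in> bsets M" using finO by (intro finite_UN) auto
      have "measure (mk M m) (\<Union>x\<in>Orb. B \<inter> {x}) = (\<Sum>x\<in>Orb. measure (mk M m) (B \<inter> {x}))"
        using s finO by (intro finite_measure.finite_measure_finite_Union[OF finite_measure_mk[OF fm]])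
          (auto simp: disjoint_family_on_def)
      then show ?thesis using s U by (simp add: measure_mk[OF fm])
    qed
    also have "\<dots> = (\<Sum>x\<in>Orb. of_bool (x \<in> B) * m {x})"
      using fmeas_empty[OF fm] by (intro sum.cong refl) simp
    finally show ?thesis .
  qed
  note iter = inv_fun_iterate[OF inv A]
  have orb: "(\<Sum>j<n. of_bool ((shift ^^ j) x \<in> A) :: real) = real n * orbit_measure u A" if xO: "x \<in> Orb" for x
  proof -
    obtain i where x: "x = orbit_pt u i" using xO by (auto simp: Orb_def)
    have "(\<Sum>j<n. of_bool (orbit_pt u (i + j) \<in> A) :: real) = (\<Sum>j<n. of_bool (orbit_pt u j \<in> A))"
      by (rule sum_period) (simp add: orbit_pt_period n_def)
    then show ?thesis using n by (simp add: x orbit_pt_shift orbit_measure_def n_def)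
  qed
  have "real n * m A = (\<Sum>j<n. m ((shift ^^ j) -` A \<inter> cms_bar M))" using iter by simp
  also have "\<dots> = (\<Sum>j<n. \<Sum>x\<in>Orb. of_bool ((shift ^^ j) x \<in> A) * m {x})"
  proof (intro sum.cong refl)
    fix j
    have "m ((shift ^^ j) -` A \<inter> cms_bar M) = (\<Sum>x\<in>Orb. of_bool (x \<in> (shift ^^ j) -` A \<inter> cms_bar M) * m {x})"
      using iter by (intro m_eq) blast
    also have "\<dots> = (\<Sum>x\<in>Orb. of_bool ((shift ^^ j) x \<in> A) * m {x})"
      using Osub by (intro sum.cong refl) auto
    finally show "m ((shift ^^ j) -` A \<inter> cms_bar M) = (\<Sum>x\<in>Orb. of_bool ((shift ^^ j) x \<in> A) * m {x})" .
  qed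
  also have "\<dots> = (\<Sum>x\<in>Orb. (\<Sum>j<n. of_bool ((shift ^^ j) x \<in> A)) * m {x})"
    by (subst sum.swap) (simp only: sum_distrib_right)
  also have "\<dots> = (\<Sum>x\<in>Orb. real n * orbit_measure u A * m {x})" using orb by (intro sum.cong refl) simp
  also have "\<dots> = real n * orbit_measure u A * (\<Sum>x\<in>Orb. m {x})" by (simp only: sum_distrib_left)
  also have "(\<Sum>x\<in>Orb. m {x}) = m Orb" using m_eq[OF OB] by simp
  also have "m Orb = 1" using fmeas_split[OF fm space_bsets OB] supp m1 Osub \<open>range (orbit_pt u) = Orb\<close> by (simp add: Int_absorb1)
  finally show ?thesis using n by simp
qed

lemma orbit_pts_bsets:
  assumes u: "loop M u" shows "cms_bar M - range (orbit_pt u) \<in> bsets M"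
proof -
  interpret sigma_algebra "cms_bar M" "bsets M" by (rule sigma_algebra_bsets)
  have "(\<Union>k. {orbit_pt u k}) \<in> bsets M"
    using singleton_bsets[OF orbit_pt_bar[OF u]] by (intro countable_UN) blast
  moreover have "(\<Union>k. {orbit_pt u k}) = range (orbit_pt u)" by blast
  ultimately show ?thesis using space_bsets[of M] by auto
qed

lemma orbit_measure_extreme:
  assumes u: "loop M u" shows "emb M (orbit_measure u) extreme_point_of image_K M"
  unfolding extreme_point_of_def
proof (intro conjI ballI notI)
  have pu: "orbit_measure u \<in> prob_funs M" by (rule orbit_measure_prob_funs[OF u])
  show "emb M (orbit_measure u) \<in> image_K M" unfolding image_K_def using pu by blast
  fix a b assume "a \<in> image_K M" "b \<in> image_K M" and seg: "emb M (orbit_measure u) \<in> open_segment a b"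
  then obtain m1 m2 where m: "m1 \<in> prob_funs M" "a = emb M m1" "m2 \<in> prob_funs M" "b = emb M m2"
    unfolding image_K_def by blast
  obtain t where ab: "a \<noteq> b" and t: "0 < t" "t < 1" "emb M (orbit_measure u) = (1 - t) *\<^sub>R a + t *\<^sub>R b"
    using seg unfolding in_segment by blast
  have f: "fmeas M m1" "fmeas M m2" using m prob_funs_fmeas by blast+
  have t': "0 \<le> 1 - t" "0 \<le> t" using t by simp_all
  define mm where "mm = (\<lambda>A. (1 - t) * m1 A + t * m2 A)"
  have fmm: "fmeas M mm" unfolding mm_def by (intro fmeas_add fmeas_scale f t')
  have "emb M (orbit_measure u) = emb M mm"
    unfolding mm_def t(3) m emb_combination[OF f t'] ..
  then have eq: "orbit_measure u A = mm A" if "A \<in> bsets M" for A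
    using emb_eqD[OF prob_funs_fmeas[OF pu] fmm] that by blast
  define N where "N = cms_bar M - range (orbit_pt u)"
  have N: "N \<in> bsets M" unfolding N_def by (rule orbit_pts_bsets[OF u])
  have "orbit_measure u N = 0" by (simp add: orbit_measure_def N_def)
  then have sum0: "(1 - t) * m1 N + t * m2 N = 0" using eq[OF N] by (simp add: mm_def)
  have nn: "0 \<le> m1 N" "0 \<le> m2 N" using fmeas_nonneg[OF f(1) N] fmeas_nonneg[OF f(2) N] .
  have "0 \<le> (1 - t) * m1 N" "0 \<le> t * m2 N" using nn t' by simp_all
  then have "(1 - t) * m1 N = 0" "t * m2 N = 0" using sum0 by linarith+
  then have "m1 N = 0" "m2 N = 0" using t by simp_all
  then have "m1 A = orbit_measure u A" "m2 A = orbit_measure u A" if "A \<in> bsets M" for A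
    using orbit_measure_unique[OF u m(1) _ that] orbit_measure_unique[OF u m(3) _ that] by (simp_all add: N_def)
  then have "a = b" unfolding m by (intro emb_cong) (simp add: cell_bsets)
  then show False using ab by simp
qed


section \<open>Density of periodic measures\<close>

text \<open>
  An invariant measure is the average over cells of higher level \<open>n + k\<close> of the empirical counts along
  orbit segments of length \<open>n\<close>; on such a cell the first \<open>n\<close> windows are constant, so they may be
  read off from any point \<open>y v\<close> of the Markov shift in the cell.
\<close>

lemma cell_frequency:
  assumes m: "inv_fun M m" and w: "length w = k"
    and y: "\<And>v. v \<in> words M (n + k) \<Longrightarrow> pre (n + k) (\<lambda>i. enat (y v i)) = v"
  shows "real n * m (cell M w) = (\<Sum>v\<in>words M (n + k). m (cell M v) * cnt k (y v) 0 n w)"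
proof -
  have fm: "fmeas M m" using m by (rule inv_fun_fmeas)
  define B where "B j = (shift ^^ j) -` cell M w \<inter> cms_bar M" for j
  have B: "B j \<in> bsets M" "m (B j) = m (cell M w)" for j
    using inv_fun_iterate[OF m cell_bsets[of M w], of j] by (simp_all add: B_def)
  have inter: "m (B j \<inter> cell M v) = m (cell M v) * of_bool (win k (y v) j = w)"
    if v: "v \<in> words M (n + k)" and j: "j < n" for v j
  proof -
    have lv: "length v = n + k" using length_words[OF v] .
    have *: "x \<in> B j \<longleftrightarrow> win k (y v) j = w" if x: "x \<in> cell M v" for x
    proof -
      have xb: "x \<in> cms_bar M" and px: "pre (n + k) x = pre (n + k) (\<lambda>i. enat (y v i))"
        using x y[OF v] lv by (simp_all add: cell_def)
      have "(shift ^^ j) x \<in> cms_bar M"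
        using xb shift_cms_bar[of _ M] by (induction j) simp_all
      moreover have "pre k ((shift ^^ j) x) = win k (y v) j"
        using pre_shift_cong[OF px, of j k] j by (simp add: pre_enat)
      ultimately show ?thesis using xb w by (simp add: B_def cell_def)
    qed
    show ?thesis
    proof (cases "win k (y v) j = w")
      case True
      then have "B j \<inter> cell M v = cell M v" using * by blast
      then show ?thesis using True by simp
    next
      case False
      then have "B j \<inter> cell M v = {}" using * by blast
      then show ?thesis using False fmeas_empty[OF fm] by simp
    qed
  qed
  have "real n * m (cell M w) = (\<Sum>j\<in>{0..<n}. m (B j))" using B(2) by simp
  also have "\<dots> = (\<Sum>j\<in>{0..<n}. \<Sum>v\<in>words M (n + k). m (B j \<inter> cell M v))"
    by (intro sum.cong refl fmeas_cells[OF fm] B(1))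
  also have "\<dots> = (\<Sum>j\<in>{0..<n}. \<Sum>v\<in>words M (n + k). m (cell M v) * of_bool (win k (y v) j = w))"
    by (intro sum.cong refl inter) auto
  also have "\<dots> = (\<Sum>v\<in>words M (n + k). m (cell M v) * cnt k (y v) 0 n w)"
    unfolding cnt_def by (subst sum.swap) (simp only: sum_distrib_left)
  finally show ?thesis .
qed

lemma coarse_cell_diff_le:
  assumes "fmeas M m1" "fmeas M m2" "length v \<le> k"
  shows "\<bar>m1 (cell M v) - m2 (cell M v)\<bar> \<le> (\<Sum>w\<in>words M k. \<bar>m1 (cell M w) - m2 (cell M w)\<bar>)"
proof -
  have eq: "m1 (cell M v) - m2 (cell M v) = (\<Sum>w\<in>words M k. m1 (cell M v \<inter> cell M w) - m2 (cell M v \<inter> cell M w))"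
    unfolding sum_subtractf fmeas_cells[OF assms(1) cell_bsets, of v k, symmetric]
      fmeas_cells[OF assms(2) cell_bsets, of v k, symmetric] ..
  have "\<bar>m1 (cell M v) - m2 (cell M v)\<bar> \<le> (\<Sum>w\<in>words M k. \<bar>m1 (cell M v \<inter> cell M w) - m2 (cell M v \<inter> cell M w)\<bar>)"
    unfolding eq by (rule sum_abs)
  also have "\<dots> \<le> (\<Sum>w\<in>words M k. \<bar>m1 (cell M w) - m2 (cell M w)\<bar>)"
  proof (rule sum_mono)
    fix w assume "w \<in> words M k"
    then have "length v \<le> length w" using assms(3) length_words[of w M k] by simp
    then have "cell M v \<inter> cell M w = cell M w \<or> cell M v \<inter> cell M w = {}"
      by (rule cell_Int_cell)
    then show "\<bar>m1 (cell M v \<inter> cell M w) - m2 (cell M v \<inter> cell M w)\<bar> \<le> \<bar>m1 (cell M w) - m2 (cell M w)\<bar>"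
      using fmeas_empty[OF assms(1)] fmeas_empty[OF assms(2)] by (elim disjE) simp_all
  qed
  finally show ?thesis .
qed


context markov
begin

text \<open>
  The factor \<open>of_bool (length w = k)\<close> is needed because vectors of \<open>loop_freqs M k\<close> vanish on words of
  other lengths.
\<close>

lemma invariant_loop_freqs:
  assumes m: "m \<in> prob_funs M"
  shows "(\<lambda>w. of_bool (length w = k) * m (cell M w)) \<in> loop_freqs M k"
proof (rule loop_freqs_closed)
  fix \<epsilon> :: real assume e: "0 < \<epsilon>"
  have inv: "inv_fun M m" and m1: "m (cms_bar M) = 1" using m by (simp_all add: prob_funs_def)
  have fm: "fmeas M m" using inv by (rule inv_fun_fmeas)
  obtain C where C: "\<forall>x\<in>cms M. \<forall>n. \<exists>g. freq_cone k (real n) g \<and> (\<forall>w. \<bar>cnt k x 0 n w - g w\<bar> \<le> C)"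
    using cnt_near_cone_all[of k] by blast
  obtain n0 :: nat where n0: "C / \<epsilon> < real n0" using reals_Archimedean2 by blast
  define n where "n = Suc n0"
  have n: "0 < real n" "C \<le> \<epsilon> * real n" using n0 e by (auto simp: n_def field_simps)
  have "\<exists>y. y \<in> cms M \<and> pre (n + k) (\<lambda>i. enat (y i)) = v" if v: "v \<in> words M (n + k)" for v
  proof -
    obtain x where "x \<in> cms_bar M" "v = pre (n + k) x" using v by (auto simp: words_def)
    then show ?thesis unfolding in_cms_bar_iff cms_ext_def by blast
  qed
  then obtain y where y: "\<And>v. v \<in> words M (n + k) \<Longrightarrow> y v \<in> cms M"
    "\<And>v. v \<in> words M (n + k) \<Longrightarrow> pre (n + k) (\<lambda>i. enat (y v i)) = v"
    by metis
  have "\<forall>v\<in>words M (n + k). \<exists>g. freq_cone k (real n) g \<and> (\<forall>w. \<bar>cnt k (y v) 0 n w - g w\<bar> \<le> C)"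
    using C y(1) by blast
  then obtain g where g: "\<And>v. v \<in> words M (n + k) \<Longrightarrow> freq_cone k (real n) (g v)"
    "\<And>v w. v \<in> words M (n + k) \<Longrightarrow> \<bar>cnt k (y v) 0 n w - g v w\<bar> \<le> C"
    by metis
  have mass: "(\<Sum>v\<in>words M (n + k). m (cell M v)) = 1"
    using fmeas_cells[OF fm space_bsets, of "n + k"] m1 bsets_subset[OF cell_bsets[of M]]
    by (simp add: Int_absorb1)
  have pos: "0 \<le> m (cell M v)" for v using cell_le[OF fm] by blast
  define G where "G w = (\<Sum>v\<in>words M (n + k). m (cell M v) / real n * g v w)" for w
  have "freq_cone k (\<Sum>v\<in>words M (n + k). m (cell M v) / real n * real n) G"
    unfolding G_def using pos n(1) by (intro freq_cone_sum finite_words freq_cone_scale g(1)) auto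
  then have "freq_cone k 1 G" using n(1) mass by simp
  then obtain d where d: "d \<in> loop_freqs M k" "\<And>w. G w = d w" unfolding freq_cone_def by auto
  have "\<bar>d w - of_bool (length w = k) * m (cell M w)\<bar> \<le> \<epsilon>" for w
  proof -
    have target: "of_bool (length w = k) * m (cell M w)
        = (\<Sum>v\<in>words M (n + k). m (cell M v) / real n * cnt k (y v) 0 n w)"
    proof (cases "length w = k")
      case True
      have freq: "real n * m (cell M w) = (\<Sum>v\<in>words M (n + k). m (cell M v) * cnt k (y v) 0 n w)"
        by (rule cell_frequency[OF inv True]) (rule y(2))
      have "m (cell M w) = (real n * m (cell M w)) / real n" using n(1) by simp
      also have "\<dots> = (\<Sum>v\<in>words M (n + k). m (cell M v) / real n * cnt k (y v) 0 n w)"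
        unfolding freq by (simp add: sum_divide_distrib)
      finally show ?thesis using True by simp
    next
      case False
      have "win k x j \<noteq> w" for x j
      proof
        assume "win k x j = w"
        then have "length w = k" by (auto simp: win_def)
        then show False using False by simp
      qed
      then have "cnt k x 0 n w = 0" for x by (simp add: cnt_def)
      then show ?thesis using False by simp
    qed
    have "\<bar>G w - of_bool (length w = k) * m (cell M w)\<bar>
        = \<bar>\<Sum>v\<in>words M (n + k). m (cell M v) / real n * (g v w - cnt k (y v) 0 n w)\<bar>"
      unfolding target G_def by (simp only: sum_subtractf right_diff_distrib)
    also have "\<dots> \<le> (\<Sum>v\<in>words M (n + k). \<bar>m (cell M v) / real n * (g v w - cnt k (y v) 0 n w)\<bar>)" by (rule sum_abs)
    also have "\<dots> \<le> (\<Sum>v\<in>words M (n + k). m (cell M v) / real n * C)"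
    proof (rule sum_mono)
      fix v assume "v \<in> words M (n + k)"
      then have "\<bar>g v w - cnt k (y v) 0 n w\<bar> \<le> C" using g(2) by (simp add: abs_minus_commute)
      then show "\<bar>m (cell M v) / real n * (g v w - cnt k (y v) 0 n w)\<bar> \<le> m (cell M v) / real n * C"
        unfolding abs_mult using pos[of v] n(1) by (intro mult_mono) auto
    qed
    also have "\<dots> = C / real n" using mass by (simp flip: sum_distrib_right sum_divide_distrib)
    also have "\<dots> \<le> \<epsilon>" using n by (simp add: divide_le_eq)
    finally show ?thesis using d(2) by simp
  qed
  then show "\<exists>d\<in>loop_freqs M k. \<forall>w. \<bar>d w - of_bool (length w = k) * m (cell M w)\<bar> \<le> \<epsilon>" using d(1) by blast
qed

lemma dense_orbit_measures:
  assumes m: "m \<in> prob_funs M" and e: "0 < e"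
  shows "\<exists>u. loop M u \<and> dist (emb M (orbit_measure u)) (emb M m) \<le> e"
proof -
  obtain N where N: "\<forall>m1\<in>prob_funs M. \<forall>m2\<in>prob_funs M.
    (\<forall>k\<le>N. \<bar>m1 (cell M (from_nat k)) - m2 (cell M (from_nat k))\<bar> \<le> e) \<longrightarrow>
    dist (emb M m1) (emb M m2) \<le> e"
    using emb_close[OF e] by blast
  define k where "k = Max ((\<lambda>i. length (from_nat i :: nat list)) ` {..N})"
  have k: "length (from_nat i :: nat list) \<le> k" if "i \<le> N" for i
    unfolding k_def using that by (intro Max_ge) auto
  define \<delta> where "\<delta> = e / (real (card (words M k)) + 1)"
  have d: "0 < \<delta>" using e by (simp add: \<delta>_def add_nonneg_pos)
  obtain u where u: "loop M u"
    "\<And>w. \<bar>lcount k u w / length u - of_bool (length w = k) * m (cell M w)\<bar> < \<delta>"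
    using invariant_loop_freqs[OF m, of k] d unfolding loop_freqs_def by blast
  have pu: "orbit_measure u \<in> prob_funs M" by (rule orbit_measure_prob_funs[OF u(1)])
  have "(\<Sum>w\<in>words M k. \<bar>orbit_measure u (cell M w) - m (cell M w)\<bar>) \<le> (\<Sum>w\<in>words M k. \<delta>)"
  proof (rule sum_mono)
    fix w assume "w \<in> words M k"
    then have "length w = k" by (rule length_words)
    then show "\<bar>orbit_measure u (cell M w) - m (cell M w)\<bar> \<le> \<delta>"
      using u(2)[of w] orbit_measure_cell[OF u(1), of w] by simp
  qed
  also have "\<dots> \<le> e"
  proof -
    have "real (card (words M k)) * e \<le> e * (real (card (words M k)) + 1)" using e by (simp add: algebra_simps)
    then show ?thesis by (simp add: \<delta>_def divide_le_eq add_nonneg_pos)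
  qed
  finally have le: "(\<Sum>w\<in>words M k. \<bar>orbit_measure u (cell M w) - m (cell M w)\<bar>) \<le> e" .
  have "\<bar>orbit_measure u (cell M (from_nat i)) - m (cell M (from_nat i))\<bar> \<le> e" if "i \<le> N" for i
    using coarse_cell_diff_le[OF prob_funs_fmeas[OF pu] prob_funs_fmeas[OF m] k[OF that]] le by linarith
  then have "dist (emb M (orbit_measure u)) (emb M m) \<le> e" using N pu m by simp
  then show ?thesis using u(1) by blast
qed

lemma closure_orbit_measures:
  assumes "S \<subseteq> image_K M" "\<And>u. loop M u \<Longrightarrow> emb M (orbit_measure u) \<in> S"
  shows "subtopology euclidean (image_K M) closure_of S = image_K M"
proof (intro equalityI subsetI)
  fix z assume "z \<in> subtopology euclidean (image_K M) closure_of S"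
  then show "z \<in> image_K M" using closure_of_subset_topspace[of "subtopology euclidean (image_K M)" S] by auto
next
  fix z assume z: "z \<in> image_K M"
  then obtain m where m: "m \<in> prob_funs M" "z = emb M m" unfolding image_K_def by blast
  show "z \<in> subtopology euclidean (image_K M) closure_of S"
    unfolding in_closure_of
  proof (intro conjI allI impI)
    fix T assume T: "z \<in> T \<and> openin (top_of_set (image_K M)) T"
    then obtain V where V: "open V" "T = image_K M \<inter> V" by (auto simp: openin_open)
    have "z \<in> V" using T V(2) by simp
    obtain e where e: "0 < e" "ball z e \<subseteq> V" using V(1) \<open>z \<in> V\<close> by (rule openE)
    obtain u where u: "loop M u" "dist (emb M (orbit_measure u)) (emb M m) \<le> e / 2"
      using dense_orbit_measures[OF m(1), of "e / 2"] e(1) by auto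
    have "dist z (emb M (orbit_measure u)) < e" using u(2) e(1) m(2) by (simp add: dist_commute)
    then have "emb M (orbit_measure u) \<in> V" using e(2) by auto
    then have "emb M (orbit_measure u) \<in> S \<inter> T" using assms u(1) V(2) by blast
    then show "\<exists>y. y \<in> S \<and> y \<in> T" by blast
  qed (use z in simp)
qed

lemma prob_funs_nonempty: "prob_funs M \<noteq> {}"
  using loop_through[of 1] orbit_measure_prob_funs by blast

text \<open>
  A loop through a vertex that a given loop avoids yields a different periodic measure.
\<close>

lemma two_points: "\<exists>x\<in>image_K M. \<exists>y\<in>image_K M. x \<noteq> y"
proof -
  obtain u where u: "loop M u" using loop_through[of 1] by auto
  obtain b where b: "b \<notin> insert 0 (set u)"
    using ex_new_if_finite[of "insert 0 (set u)"] by auto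
  then have "1 \<le> b" by (cases b) auto
  then obtain v where v: "loop M v" "hd v = b" using loop_through by blast
  define A where "A = {x \<in> cms_bar M. x 0 = enat b}"
  have A: "A \<in> bsets M" unfolding A_def by (rule clop_bsets[OF coord_clop])
  have "orbit_pt u k \<notin> A" for k
  proof -
    have "per u k \<in> set u" using u unfolding per_def loop_def by (intro nth_mem) simp
    then show ?thesis using b by (auto simp: A_def orbit_pt_def funpow_shift)
  qed
  then have u0: "orbit_measure u A = 0" by (simp add: orbit_measure_def)
  have lv: "0 < length v" "v ! 0 = b" using v by (auto simp: loop_def hd_conv_nth)
  have "orbit_pt v 0 \<in> A" using orbit_pt_bar[OF v(1), of 0] lv by (simp add: A_def orbit_pt_def per_def)
  then have "0 < (\<Sum>k<length v. of_bool (orbit_pt v k \<in> A) :: real)"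
    using lv(1) by (intro sum_pos2[of _ 0]) auto
  then have v0: "0 < orbit_measure v A" using lv(1) by (simp add: orbit_measure_def)
  have p: "orbit_measure u \<in> prob_funs M" "orbit_measure v \<in> prob_funs M"
    using orbit_measure_prob_funs u v(1) by blast+
  have "emb M (orbit_measure u) \<noteq> emb M (orbit_measure v)"
    using emb_eqD[OF prob_funs_fmeas[OF p(1)] prob_funs_fmeas[OF p(2)] _ A] u0 v0 by auto
  then show ?thesis using p unfolding image_K_def by blast
qed

lemma poulsen_image_K: "poulsen_simplex euclidean (image_K M)"
  unfolding poulsen_simplex_def choquet_simplex_def
proof (intro conjI)
  show "locally_convex_tvs (euclidean :: (nat \<Rightarrow>\<^sub>C real) topology)" by (rule locally_convex_tvs_euclidean)
  show "compactin euclidean (image_K M)" using compact_image_K by simp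
  show "convex (image_K M)" by (rule convex_image_K)
  show "cone_lattice (cone_over (image_K M))" by (rule cone_lattice_image_K[OF prob_funs_nonempty])
  show "metrizable_space (subtopology euclidean (image_K M))"
    by (intro metrizable_space_subtopology metrizable_space_euclidean)
  show "\<exists>x\<in>image_K M. \<exists>y\<in>image_K M. x \<noteq> y" by (rule two_points)
  show "subtopology euclidean (image_K M) closure_of {x. x extreme_point_of image_K M} = image_K M"
    using orbit_measure_extreme by (intro closure_orbit_measures) (auto simp: extreme_point_of_def)
qed

lemma dense_inv_cms: "inv_bar_top M closure_of inv_cms M = inv_bar M"
proof -
  define h where "h = (\<lambda>\<mu>. emb M (measure \<mu>))"
  have top: "topspace (inv_bar_top M) = inv_bar M" by (simp add: inv_bar_top_def)
  have sub: "inv_cms M \<subseteq> inv_bar M" by (auto simp: inv_cms_def)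
  have "subtopology euclidean (image_K M) closure_of (h ` inv_cms M) = h ` (inv_bar_top M closure_of inv_cms M)"
    unfolding h_def by (rule homeomorphic_map_closure_of[OF homeomorphic_emb]) (simp add: top sub)
  moreover have "subtopology euclidean (image_K M) closure_of (h ` inv_cms M) = image_K M"
  proof (rule closure_orbit_measures)
    show "h ` inv_cms M \<subseteq> image_K M" unfolding image_K_eq h_def using sub by blast
    show "emb M (orbit_measure u) \<in> h ` inv_cms M" if "loop M u" for u
      using emb_per_measure[OF that] per_measure_inv_cms[OF that] unfolding h_def by (metis imageI)
  qed
  ultimately have "h ` (inv_bar_top M closure_of inv_cms M) = h ` inv_bar M"
    by (simp add: image_K_eq h_def)
  moreover have "inv_bar_top M closure_of inv_cms M \<subseteq> inv_bar M"
    using closure_of_subset_topspace[of "inv_bar_top M" "inv_cms M"] by (simp add: top)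
  ultimately show ?thesis
    using inj_on_image_eq_iff[OF inj_emb[of M], of "inv_bar_top M closure_of inv_cms M" "inv_bar M"]
    by (simp add: h_def)
qed

end

theorem theorem1p1:
  fixes M :: "nat \<Rightarrow> nat \<Rightarrow> nat"
  assumes "zero_one_matrix M"
    and "transitive_cms M"
  shows "affinely_homeomorphic_to_Poulsen (inv_bar_top M)
       \<and> inv_cms M \<subseteq> inv_bar M
       \<and> inv_bar_top M closure_of inv_cms M = inv_bar M"
proof (intro conjI)
  interpret markov M using assms(2) by unfold_locales
  have "affine_homeomorphism (inv_bar_top M) euclidean (image_K M) (\<lambda>\<mu>. emb M (measure \<mu>))"
    unfolding affine_homeomorphism_def using homeomorphic_emb[of M] emb_mix[of _ M]
    by (simp add: inv_bar_top_def)
  then show "affinely_homeomorphic_to_Poulsen (inv_bar_top M)"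
    unfolding affinely_homeomorphic_to_Poulsen_def using poulsen_image_K by blast
  show "inv_cms M \<subseteq> inv_bar M" by (auto simp: inv_cms_def)
  show "inv_bar_top M closure_of inv_cms M = inv_bar M" by (rule dense_inv_cms)
qed

end
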